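(* Let $h\in\mathfrak h^{1}(\mu)$ and $f\in\mathfrak{rbmo}(\mu)$. Then the product $f\times h$ can be given a meaning in the sense of distributions, namely, for a decomposition $h=\sum_{j}b_{j}$ with $\sum_j|b_j|_{\mathfrak h^{1}_{atb}(\mu)}<\infty$, where $b_j$ is supported in a cube $R_j$ and is an atomic block if $\ell(R_j)\le1$ and a block if $\ell(R_j)>1$, as the sum of the two series (converging in the sense of distributions) $$f\times h:=\sum_{j=1}^{\infty}\left(f-f_{\tilde R_j}\right)b_j+\sum_{j=1}^{\infty}f_{\tilde R_j}\,b_j.$$ Moreover, $$f\times h\in L^{1}(\mu)+\mathfrak h^{\wp}_{*}(\mu),$$ where $\wp(t)=\dfrac{t}{\log(e+t)}$.
   Context: Setting. $0<n\le d$ are fixed integers and $\mu$ is a positive Radon measure on $\mathbb R^d$ (Euclidean norm $|\cdot|$) with $\mu(B(x,r))\le C_0r^n$ for all $x\in\mathbb R^d$, $r>0$; $\mu$ need not be doubling. A cube is a closed cube with sides parallel to the axes, centered at a point $x_Q$ of $\mathrm{supp}(\mu)$; if $\mu(\mathbb R^d)<\infty$, $Q=\mathbb R^d$ is also allowed. $\ell(Q)$ is the side length and $\alpha Q$ the concentric cube of side length $\alpha\ell(Q)$; $C_0$ is chosen so that also $\mu(Q)\le C_0\ell(Q)^n$ for all cubes. For cubes $Q\subset R$, $S_{Q,R}=1+\sum_{k=1}^{N_{Q,R}}\frac{\mu(2^kQ)}{\ell(2^kQ)^n}$, where $N_{Q,R}$ is the smallest positive integer $k$ with $\ell(2^kQ)\ge\ell(R)$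 ($N_{Q,R}=\infty$ if $R=\mathbb R^d\ne Q$). Doubling cubes. Let $\alpha>1$ and $\beta>\alpha^n$. A cube $Q$ is $(\alpha,\beta)$-doubling if $\mu(\alpha Q)\le\beta\mu(Q)$. For $\rho>1$, $\beta_\rho$ is a fixed large constant $\beta$ (for definiteness, twice the infimum of such constants) for which there are arbitrarily large $(\rho,\beta)$-doubling cubes centered at every point of $\mathrm{supp}(\mu)$, and, for $\mu$-a.e. $x$, a sequence of $(\rho,\beta)$-doubling cubes centered at $x$ with side lengths tending to $0$. For a cube $Q$, $\tilde Q=2^NQ$ with $N$ the smallest non-negative integer such that $2^NQ$ is $(\rho,\beta_\rho)$-doubling. $f_Q$ denotes the $\mu$-mean of $f$ over $Q$. $\mathfrak{rbmo}(\mu)$. Fix $1<\eta\le\rho<\infty$. $f\in L^1_{loc}(\mu)$ is in $\mathfrak{rbmo}(\mu)$ if there is a constant $C_3$ such that: $\frac1{\mu(\eta Q)}\int_Q|f-f_{\tilde Q}|\,d\mu\le C_3$ for every cube $Q$ with $\ell(Q)\le1$; $|f_Q-f_R|\le C_3S_{Q,R}$ for any two $(\rho,\beta_\rho)$-doubling cubes $Q\subset R$ with $\ell(Q)\le1$; and $\frac1{\mu(\eta Q)}\int_Q|f|\,d\mu\le C_3$ for every cube $Q$ with $\ell(Q)>1$. The norm $\|f\|_{\mathfrak{rbmo}(\mu)}$ is the infimum of such $C_3$. The space does not depend on the choice of $\eta,\rho,\beta_\rho$. $\mathfrak h^1(\mu)=\mathfrak h^{1,\infty}_{atb}(\mu)$.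 An ($\infty$-)block is $b\in L^1_{loc}(\mu)$ such that $\mathrm{supp}\,b\subset R$ for some cube $R$ and $b=\sum_{i}\lambda_ia_i$ with $\lambda_i\in\mathbb R$ and $a_i$ supported in cubes $Q_i\subset R$ with $\|a_i\|_{L^\infty(\mu)}\le\mu(2Q_i)^{-1}S_{Q_i,R}^{-1}$; it is an ($\infty$-)atomic block if in addition $\int b\,d\mu=0$. One puts $|b|_{\mathfrak h^{1}_{atb}(\mu)}=\sum_i|\lambda_i|$. $h\in\mathfrak h^1(\mu)$ iff $h=\sum_jb_j$ with $\sum_j|b_j|_{\mathfrak h^{1}_{atb}(\mu)}<\infty$, where $\mathrm{supp}\,b_j\subset R_j$, $b_j$ is an atomic block if $\ell(R_j)\le1$ and a block if $\ell(R_j)>1$. Amalgam-type spaces. For a measurable set $E$, $\|g\|_{L^\wp(E)}=\inf\{k>0:\int_E\wp(|g|/k)\,d\mu\le1\}$. With $\mathbb Q$ the unit cube centered at $0$, $L^\wp_*(\mu)$ is the space of functions $g$ with $\|g\|_{L^\wp_*}=\sum_{j\in\mathbb Z^d}\|g\|_{L^\wp(j+\mathbb Q)}<\infty$. For $x\in\mathbb R^d$, $F(x)$ is the set of $\varphi\in L^1(\mu)\cap C^1(\mathbb R^d)$ with $\|\varphi\|_{L^1(\mu)}\le1$, $0\le\varphi(y)\le|y-x|^{-n}$ and $|\nabla\varphi(y)|\le|y-x|^{-n-1}$ for all $y\in\mathbb R^d$; $F_{loc}(x)$ is the set of $\varphi\in F(x)$ supported in the cube $Q(x,1)$ centered at $x$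 with side length $1$. The local maximal function is $\mathcal M^{(1)}g(x)=\sup_{\varphi\in F_{loc}(x)}\left|\int g\varphi\,d\mu\right|$. A locally integrable function $g$ belongs to $\mathfrak h^\wp_*(\mu)$ if $\mathcal M^{(1)}g\in L^\wp_*(\mu)$.
   Formalization: The space h^℘_* is taken to contain distributions of order at most 1 (maximal function defined by pairing with F_loc), not only locally integrable functions, since f×h need not be a locally integrable function. *)

theory Defs
  imports "HOL-Analysis.Analysis"
begin

section \<open>Measures of polynomial growth, cubes\<close>

definition supp_measure :: "'a::euclidean_space measure \<Rightarrow> 'a set" where
  "supp_measure \<mu> = {x. \<forall>r>0. 0 < emeasure \<mu> (ball x r)}"

definition cube_set :: "'a::euclidean_space \<Rightarrow> real \<Rightarrow> 'a set" where
  "cube_set x l = cbox (x - (l / 2) *\<^sub>R One) (x + (l / 2) *\<^sub>R One)"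

text \<open>A Borel measure with the growth bounds is finite on bounded sets, hence Radon.\<close>

definition growth_measure :: "nat \<Rightarrow> real \<Rightarrow> 'a::euclidean_space measure \<Rightarrow> bool" where
  "growth_measure n C0 \<mu> \<longleftrightarrow>
     sets \<mu> = sets borel \<and>
     (\<forall>x. \<forall>r>0. emeasure \<mu> (ball x r) \<le> ennreal (C0 * r ^ n)) \<and>
     (\<forall>x\<in>supp_measure \<mu>. \<forall>l>0. emeasure \<mu> (cube_set x l) \<le> ennreal (C0 * l ^ n))"

text \<open>\<open>Whole\<close> is the full space, which counts as a cube of infinite side length when
  the measure is finite. \<open>Cube x l\<close> is determined by its point set (for \<open>l > 0\<close>), so working with
  this representation instead of sets loses nothing.\<close>

datatype 'a cube = Cube 'a real | Whole

fun cset :: "'a::euclidean_space cube \<Rightarrow> 'a set" where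
  "cset (Cube x l) = cube_set x l"
| "cset Whole = UNIV"

fun is_cube :: "'a::euclidean_space measure \<Rightarrow> 'a cube \<Rightarrow> bool" where
  "is_cube \<mu> (Cube x l) \<longleftrightarrow> x \<in> supp_measure \<mu> \<and> 0 < l"
| "is_cube \<mu> Whole \<longleftrightarrow> emeasure \<mu> UNIV < \<infinity>"

fun side :: "'a cube \<Rightarrow> ennreal" where
  "side (Cube x l) = ennreal l"
| "side Whole = \<infinity>"

fun dilate :: "real \<Rightarrow> 'a cube \<Rightarrow> 'a cube" where
  "dilate \<alpha> (Cube x l) = Cube x (\<alpha> * l)"
| "dilate \<alpha> Whole = Whole"

text \<open>\<open>N_coef Q R\<close> is \<open>\<infinity>\<close> when no dilate reaches the side length of \<open>R\<close> (infimum of the empty set).\<close>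

definition N_coef :: "'a cube \<Rightarrow> 'a cube \<Rightarrow> enat" where
  "N_coef Q R = Inf {enat k | k. 0 < k \<and> side R \<le> side (dilate (2 ^ k) Q)}"

definition S_coef :: "'a::euclidean_space measure \<Rightarrow> nat \<Rightarrow> 'a cube \<Rightarrow> 'a cube \<Rightarrow> ennreal" where
  "S_coef \<mu> n Q R =
     1 + (\<Sum>k. if 1 \<le> k \<and> enat k \<le> N_coef Q R
              then emeasure \<mu> (cset (dilate (2 ^ k) Q)) / side (dilate (2 ^ k) Q) ^ n else 0)"

section \<open>Doubling cubes\<close>

definition doubling :: "'a::euclidean_space measure \<Rightarrow> real \<Rightarrow> real \<Rightarrow> 'a cube \<Rightarrow> bool" where
  "doubling \<mu> \<alpha> \<beta> Q \<longleftrightarrow> emeasure \<mu> (cset (dilate \<alpha> Q)) \<le> ennreal \<beta> * emeasure \<mu> (cset Q)"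

text \<open>Admissible values of the constant \<open>\<beta>\<^sub>\<rho>\<close>. The last clause says that the smallest
  doubling dyadic dilate of a cube, on which everything below relies, exists; it has to be
  recorded separately because for \<open>\<rho>\<close> not a power of 2 it is not implied by the other clauses.
  The conditions are preserved when \<open>\<beta>\<close> grows.\<close>

definition doubling_constant :: "'a::euclidean_space measure \<Rightarrow> nat \<Rightarrow> real \<Rightarrow> real \<Rightarrow> bool" where
  "doubling_constant \<mu> n \<rho> \<beta> \<longleftrightarrow>
     \<rho> ^ n < \<beta> \<and>
     (\<forall>x\<in>supp_measure \<mu>. \<forall>L>0. \<exists>l>L. doubling \<mu> \<rho> \<beta> (Cube x l)) \<and>
     (AE x in \<mu>. \<exists>l :: nat \<Rightarrow> real.
        (\<forall>k. 0 < l k \<and> doubling \<mu> \<rho> \<beta> (Cube x (l k))) \<and> l \<longlonglongrightarrow> 0) \<and>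
     (\<forall>Q. is_cube \<mu> Q \<longrightarrow> (\<exists>N::nat. doubling \<mu> \<rho> \<beta> (dilate (2 ^ N) Q)))"

definition tilde :: "'a::euclidean_space measure \<Rightarrow> real \<Rightarrow> real \<Rightarrow> 'a cube \<Rightarrow> 'a cube" where
  "tilde \<mu> \<rho> \<beta> Q = dilate (2 ^ (LEAST N::nat. doubling \<mu> \<rho> \<beta> (dilate (2 ^ N) Q))) Q"

section \<open>The local space rbmo\<close>

definition loc_integrable :: "'a::euclidean_space measure \<Rightarrow> ('a \<Rightarrow> real) \<Rightarrow> bool" where
  "loc_integrable \<mu> f \<longleftrightarrow>
     f \<in> borel_measurable \<mu> \<and> (\<forall>K. compact K \<longrightarrow> set_integrable \<mu> K f)"

definition mean :: "'a::euclidean_space measure \<Rightarrow> ('a \<Rightarrow> real) \<Rightarrow> 'a cube \<Rightarrow> real" where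
  "mean \<mu> f Q = (LINT x:cset Q|\<mu>. f x) / measure \<mu> (cset Q)"

text \<open>The integrals of absolute values are Lebesgue integrals in \<open>[0,\<infinity>]\<close>: for \<open>Q = Whole\<close> their
  finiteness is part of the condition.\<close>

definition rbmo_bound ::
  "'a::euclidean_space measure \<Rightarrow> nat \<Rightarrow> real \<Rightarrow> real \<Rightarrow> real \<Rightarrow> ('a \<Rightarrow> real) \<Rightarrow> real \<Rightarrow> bool" where
  "rbmo_bound \<mu> n \<eta> \<rho> \<beta> f C \<longleftrightarrow>
     (\<forall>Q. is_cube \<mu> Q \<and> side Q \<le> 1 \<longrightarrow>
        (\<integral>\<^sup>+x\<in>cset Q. ennreal \<bar>f x - mean \<mu> f (tilde \<mu> \<rho> \<beta> Q)\<bar> \<partial>\<mu>)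
          / emeasure \<mu> (cset (dilate \<eta> Q)) \<le> ennreal C) \<and>
     (\<forall>Q R. is_cube \<mu> Q \<and> is_cube \<mu> R \<and> doubling \<mu> \<rho> \<beta> Q \<and> doubling \<mu> \<rho> \<beta> R \<and>
        cset Q \<subseteq> cset R \<and> side Q \<le> 1 \<longrightarrow>
        ennreal \<bar>mean \<mu> f Q - mean \<mu> f R\<bar> \<le> ennreal C * S_coef \<mu> n Q R) \<and>
     (\<forall>Q. is_cube \<mu> Q \<and> 1 < side Q \<longrightarrow>
        (\<integral>\<^sup>+x\<in>cset Q. ennreal \<bar>f x\<bar> \<partial>\<mu>) / emeasure \<mu> (cset (dilate \<eta> Q)) \<le> ennreal C)"

definition rbmo ::
  "'a::euclidean_space measure \<Rightarrow> nat \<Rightarrow> real \<Rightarrow> real \<Rightarrow> real \<Rightarrow> ('a \<Rightarrow> real) set" where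
  "rbmo \<mu> n \<eta> \<rho> \<beta> = {f. loc_integrable \<mu> f \<and> (\<exists>C\<ge>0. rbmo_bound \<mu> n \<eta> \<rho> \<beta> f C)}"

section \<open>The local atomic Hardy space\<close>

text \<open>Functions are considered modulo null sets, so supports of functions and pointwise sums are
  understood almost everywhere. Since an atom \<open>a\<close> below has \<open>L\<^sup>1\<close> norm at most 1 and the coefficients
  are absolutely summable, almost everywhere convergence of the series below is the same as
  convergence in \<open>L\<^sup>1\<close>.\<close>

definition supported_in :: "'a::euclidean_space measure \<Rightarrow> ('a \<Rightarrow> real) \<Rightarrow> 'a cube \<Rightarrow> bool" where
  "supported_in \<mu> b Q \<longleftrightarrow> (AE x in \<mu>. x \<notin> cset Q \<longrightarrow> b x = 0)"

definition atom :: "'a::euclidean_space measure \<Rightarrow> nat \<Rightarrow> 'a cube \<Rightarrow> 'a cube \<Rightarrow> ('a \<Rightarrow> real) \<Rightarrow> bool" where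
  "atom \<mu> n R Q a \<longleftrightarrow>
     is_cube \<mu> Q \<and> cset Q \<subseteq> cset R \<and> a \<in> borel_measurable \<mu> \<and> supported_in \<mu> a Q \<and>
     (AE x in \<mu>. ennreal \<bar>a x\<bar> \<le> 1 / (emeasure \<mu> (cset (dilate 2 Q)) * S_coef \<mu> n Q R))"

text \<open>\<open>block \<mu> n R b s\<close>: \<open>b\<close> is a block with respect to \<open>R\<close> and has a representation for which
  \<open>|b| = s\<close>.\<close>

definition block :: "'a::euclidean_space measure \<Rightarrow> nat \<Rightarrow> 'a cube \<Rightarrow> ('a \<Rightarrow> real) \<Rightarrow> real \<Rightarrow> bool" where
  "block \<mu> n R b s \<longleftrightarrow>
     is_cube \<mu> R \<and> loc_integrable \<mu> b \<and> supported_in \<mu> b R \<and>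
     (\<exists>c a Q. (\<forall>i::nat. atom \<mu> n R (Q i) (a i)) \<and>
        (AE x in \<mu>. (\<lambda>i. c i * a i x) sums b x) \<and> (\<lambda>i. \<bar>c i :: real\<bar>) sums s)"

definition atomic_block ::
  "'a::euclidean_space measure \<Rightarrow> nat \<Rightarrow> 'a cube \<Rightarrow> ('a \<Rightarrow> real) \<Rightarrow> real \<Rightarrow> bool" where
  "atomic_block \<mu> n R b s \<longleftrightarrow> block \<mu> n R b s \<and> (LINT x|\<mu>. b x) = 0"

definition h1_decomposition ::
  "'a::euclidean_space measure \<Rightarrow> nat \<Rightarrow> ('a \<Rightarrow> real) \<Rightarrow> (nat \<Rightarrow> 'a \<Rightarrow> real) \<Rightarrow> (nat \<Rightarrow> 'a cube) \<Rightarrow> bool"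
where
  "h1_decomposition \<mu> n h b R \<longleftrightarrow>
     (AE x in \<mu>. (\<lambda>j. b j x) sums h x) \<and>
     (\<exists>s. summable s \<and>
        (\<forall>j. (side (R j) \<le> 1 \<longrightarrow> atomic_block \<mu> n (R j) (b j) (s j)) \<and>
             (1 < side (R j) \<longrightarrow> block \<mu> n (R j) (b j) (s j))))"

definition h1 :: "'a::euclidean_space measure \<Rightarrow> nat \<Rightarrow> ('a \<Rightarrow> real) set" where
  "h1 \<mu> n = {h. h \<in> borel_measurable \<mu> \<and> (\<exists>b R. h1_decomposition \<mu> n h b R)}"

section \<open>Distributions\<close>

fun iter_partial :: "'a::euclidean_space list \<Rightarrow> ('a \<Rightarrow> real) \<Rightarrow> 'a \<Rightarrow> real" where
  "iter_partial [] f = f"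
| "iter_partial (b # bs) f = (\<lambda>x. frechet_derivative (iter_partial bs f) (at x) b)"

definition C_k :: "enat \<Rightarrow> ('a::euclidean_space \<Rightarrow> real) \<Rightarrow> bool" where
  "C_k m f \<longleftrightarrow>
     (\<forall>bs. set bs \<subseteq> Basis \<and> enat (length bs) \<le> m \<longrightarrow>
        continuous_on UNIV (iter_partial bs f) \<and>
        (enat (length bs) < m \<longrightarrow> (\<forall>x. iter_partial bs f differentiable at x)))"

definition test_functions :: "enat \<Rightarrow> ('a::euclidean_space \<Rightarrow> real) set" where
  "test_functions m = {\<phi>. C_k m \<phi> \<and> (\<exists>K. compact K \<and> (\<forall>y. y \<notin> K \<longrightarrow> \<phi> y = 0))}"

text \<open>Continuous linear functionals on the compactly supported \<open>C\<^sup>m\<close> functions: all distributions for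
  \<open>m = \<infinity>\<close>, distributions of order at most \<open>m\<close> for finite \<open>m\<close>. Values outside
  \<open>test_functions m\<close> are irrelevant.\<close>

definition distribution_on :: "enat \<Rightarrow> (('a::euclidean_space \<Rightarrow> real) \<Rightarrow> real) \<Rightarrow> bool" where
  "distribution_on m T \<longleftrightarrow>
     (\<forall>\<phi>\<in>test_functions m. \<forall>\<psi>\<in>test_functions m. \<forall>s t.
        T (\<lambda>y. s * \<phi> y + t * \<psi> y) = s * T \<phi> + t * T \<psi>) \<and>
     (\<forall>K. compact K \<longrightarrow> (\<exists>C. \<exists>k::nat. enat k \<le> m \<and>
        (\<forall>\<phi>\<in>test_functions m. \<forall>A.
           (\<forall>y. y \<notin> K \<longrightarrow> \<phi> y = 0) \<and>
           (\<forall>bs y. set bs \<subseteq> Basis \<and> length bs \<le> k \<longrightarrow> \<bar>iter_partial bs \<phi> y\<bar> \<le> A)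
           \<longrightarrow> \<bar>T \<phi>\<bar> \<le> C * A)))"

definition regular_distribution ::
  "'a::euclidean_space measure \<Rightarrow> ('a \<Rightarrow> real) \<Rightarrow> ('a \<Rightarrow> real) \<Rightarrow> real" where
  "regular_distribution \<mu> g \<phi> = (LINT y|\<mu>. g y * \<phi> y)"

definition sums_distribution ::
  "'a::euclidean_space measure \<Rightarrow> (nat \<Rightarrow> 'a \<Rightarrow> real) \<Rightarrow> (('a \<Rightarrow> real) \<Rightarrow> real) \<Rightarrow> bool" where
  "sums_distribution \<mu> g U \<longleftrightarrow>
     (\<forall>j. loc_integrable \<mu> (g j)) \<and> distribution_on \<infinity> U \<and>
     (\<forall>\<phi>\<in>test_functions \<infinity>. (\<lambda>j. regular_distribution \<mu> (g j) \<phi>) sums U \<phi>)"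

section \<open>Amalgam Orlicz spaces and the local maximal function\<close>

text \<open>The Orlicz function is given on \<open>[0,\<infinity>)\<close> and extended by the value \<open>\<infinity>\<close> at \<open>\<infinity>\<close>.\<close>

definition ext_orlicz :: "(real \<Rightarrow> real) \<Rightarrow> ennreal \<Rightarrow> ennreal" where
  "ext_orlicz wp t = (if t = \<infinity> then \<infinity> else ennreal (wp (enn2real t)))"

definition orlicz_norm ::
  "'a::euclidean_space measure \<Rightarrow> (real \<Rightarrow> real) \<Rightarrow> 'a set \<Rightarrow> ('a \<Rightarrow> ennreal) \<Rightarrow> ennreal" where
  "orlicz_norm \<mu> wp E g =
     (INF k\<in>{k::real. 0 < k \<and> (\<integral>\<^sup>+x\<in>E. ext_orlicz wp (g x / ennreal k) \<partial>\<mu>) \<le> 1}. ennreal k)"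

definition int_lattice :: "'a::euclidean_space set" where
  "int_lattice = {j. \<forall>b\<in>Basis. j \<bullet> b \<in> \<int>}"

definition orlicz_amalgam ::
  "'a::euclidean_space measure \<Rightarrow> (real \<Rightarrow> real) \<Rightarrow> ('a \<Rightarrow> ennreal) set" where
  "orlicz_amalgam \<mu> wp =
     {g. g \<in> borel_measurable \<mu> \<and>
         (\<Sum>\<^sub>\<infinity>j\<in>int_lattice. orlicz_norm \<mu> wp (cube_set j 1) g) < \<infinity>}"

definition gradient :: "('a::euclidean_space \<Rightarrow> real) \<Rightarrow> 'a \<Rightarrow> 'a" where
  "gradient \<phi> y = (\<Sum>b\<in>Basis. iter_partial [b] \<phi> y *\<^sub>R b)"

text \<open>At \<open>y = x\<close> the upper bounds \<open>|y - x|\<^sup>-\<^sup>n\<close> and \<open>|y - x|\<^sup>-\<^sup>n\<^sup>-\<^sup>1\<close> are infinite, i.e. void.\<close>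

definition F_class :: "'a::euclidean_space measure \<Rightarrow> nat \<Rightarrow> 'a \<Rightarrow> ('a \<Rightarrow> real) set" where
  "F_class \<mu> n x =
     {\<phi>. C_k 1 \<phi> \<and> integrable \<mu> \<phi> \<and> (LINT y|\<mu>. \<bar>\<phi> y\<bar>) \<le> 1 \<and> (\<forall>y. 0 \<le> \<phi> y) \<and>
         (\<forall>y. y \<noteq> x \<longrightarrow> \<phi> y \<le> 1 / norm (y - x) ^ n \<and>
                         norm (gradient \<phi> y) \<le> 1 / norm (y - x) ^ (n + 1))}"

definition F_loc :: "'a::euclidean_space measure \<Rightarrow> nat \<Rightarrow> 'a \<Rightarrow> ('a \<Rightarrow> real) set" where
  "F_loc \<mu> n x = {\<phi> \<in> F_class \<mu> n x. \<forall>y. y \<notin> cube_set x 1 \<longrightarrow> \<phi> y = 0}"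

definition local_maximal ::
  "'a::euclidean_space measure \<Rightarrow> nat \<Rightarrow> (('a \<Rightarrow> real) \<Rightarrow> real) \<Rightarrow> 'a \<Rightarrow> ennreal" where
  "local_maximal \<mu> n T x = (SUP \<phi>\<in>F_loc \<mu> n x. ennreal \<bar>T \<phi>\<bar>)"

text \<open>For a locally integrable \<open>g\<close>, \<open>local_maximal \<mu> n (regular_distribution \<mu> g)\<close> is the local
  maximal function of \<open>g\<close>. As products are in general only distributions, the Hardy space has to
  contain distributions as well: those of order at most 1, whose unique extension \<open>T'\<close> to
  compactly supported \<open>C\<^sup>1\<close> functions can be tested against the \<open>C\<^sup>1\<close> functions in \<open>F_loc\<close>.\<close>

definition h_wp_star ::
  "'a::euclidean_space measure \<Rightarrow> nat \<Rightarrow> (real \<Rightarrow> real) \<Rightarrow> (('a \<Rightarrow> real) \<Rightarrow> real) set" where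
  "h_wp_star \<mu> n wp =
     {T. distribution_on \<infinity> T \<and>
         (\<exists>T'. distribution_on 1 T' \<and> (\<forall>\<phi>\<in>test_functions \<infinity>. T' \<phi> = T \<phi>) \<and>
               local_maximal \<mu> n T' \<in> orlicz_amalgam \<mu> wp)}"

definition L1_plus_h_wp_star ::
  "'a::euclidean_space measure \<Rightarrow> nat \<Rightarrow> (real \<Rightarrow> real) \<Rightarrow> (('a \<Rightarrow> real) \<Rightarrow> real) set" where
  "L1_plus_h_wp_star \<mu> n wp =
     {T. \<exists>g H. integrable \<mu> g \<and> H \<in> h_wp_star \<mu> n wp \<and>
           (\<forall>\<phi>\<in>test_functions \<infinity>. T \<phi> = regular_distribution \<mu> g \<phi> + H \<phi>)}"

end

theory Submission
  imports Defs
begin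

text \<open>
  Every cube is assigned the mean \<open>F\<^sub>Q\<close> of \<open>f\<close> over its first doubling dilate by a power of \<open>\<rho>\<close>. These numbers
  control the oscillation of \<open>f\<close> and differ by at most \<open>C S\<^sub>Q\<^sub>,\<^sub>R\<close> on nested cubes. Hence
  \<open>\<Sum>\<^sub>j (f - f\<^sub>R\<^sub>j) b\<^sub>j\<close> converges in \<open>L\<^sup>1\<close>, and so does the part of \<open>\<Sum>\<^sub>j f\<^sub>R\<^sub>j b\<^sub>j\<close> coming from cubes of side
  larger than 1, where the means are bounded. On small cubes the cancellation of \<open>b\<^sub>j\<close> gains a factor \<open>\<ell>(R\<^sub>j)\<close>
  against \<open>C\<^sup>1\<close> test functions, which beats the logarithmic growth of the means and gives a distribution of
  order 1.

  For its local maximal function let \<open>G(x)\<close> be the supremum of \<open>|F\<^sub>Q|\<close> over good doubling cubes containing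
  \<open>x\<close>. A John--Nirenberg argument with the Vitali covering lemma makes \<open>exp (c G)\<close> uniformly integrable over unit
  cubes. As \<open>|f\<^sub>R\<^sub>j|\<close> is at most a constant multiple of \<open>(k + 1)(G + 1)\<close> on \<open>2\<^sup>k\<^sup>+\<^sup>1R\<^sub>j\<close>, the maximal function is at
  most \<open>C (G + 1) \<Phi>\<close> with \<open>\<Phi>\<close> in \<open>L\<^sup>1\<close>, and the elementary inequality \<open>\<wp>(s t) \<le> s + (e\<^sup>t - 1)\<close> puts this
  product into the amalgam space.

  The sum does not depend on the decomposition because it is the limit of \<open>\<integral> f\<^sub>N h \<phi> d\<mu>\<close> for the truncations \<open>f\<^sub>N\<close>
  of \<open>f\<close>.
\<close>

section \<open>Cubes\<close>

text \<open>The measure is not doubling, so means over nearby cubes of similar size need not be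
  comparable. Only doubling cubes have comparable means, and moving between them costs the sum of
  the densities of the cubes in between. The factor 1/S in the size of an atom is there to pay for
  this: what is lost when a mean is moved from R down to the cube of an atom is regained from the
  normalisation. Two features of the definitions stand in the way. The tilde operation climbs by
  powers of 2 while doubling is meant with respect to \<rho>, so nothing bounds the densities
  between Q and tilde Q; the numbers F_Q avoid this, but then have to be shown to stay within a
  constant of the means over tilde Q that occur in the product. Moreover rbmo is normalised by
  \<eta>-dilates and atoms by doubles, which a covering argument reconciles. The factor k + 1 in the
  bound by G is affordable because the cancellation of b_j gives the decay 2^-k on the k-th annulus.
  Since G is taken at the point where the maximal function is evaluated, the unbounded means
  separate from the blocks, and one function G serves all blocks at once.\<close>

lemma inner_One [simp]: "b \<in> Basis \<Longrightarrow> One \<bullet> b = 1"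
  by (simp add: inner_sum_left inner_Basis sum.delta')

text \<open>Cubes are the closed balls of the sup norm, with radius \<open>l / 2\<close>; the
  symmetry and inclusion rules below are those of a norm.\<close>

lemma mem_cube_set: "x \<in> cube_set y l \<longleftrightarrow> (\<forall>b\<in>Basis. \<bar>(x - y) \<bullet> b\<bar> \<le> l / 2)"
  unfolding cube_set_def mem_box
proof (intro ball_cong refl)
  fix b :: 'a assume "b \<in> Basis"
  then have "(y - (l/2) *\<^sub>R One) \<bullet> b = y \<bullet> b - l/2" "(y + (l/2) *\<^sub>R One) \<bullet> b = y \<bullet> b + l/2"
    "(x - y) \<bullet> b = x \<bullet> b - y \<bullet> b" by (simp_all add: inner_diff_left inner_add_left)
  then show "((y - (l/2) *\<^sub>R One) \<bullet> b \<le> x \<bullet> b \<and> x \<bullet> b \<le> (y + (l/2) *\<^sub>R One) \<bullet> b) = (\<bar>(x - y) \<bullet> b\<bar> \<le> l / 2)"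
    by arith
qed

lemma center_mem_cube_set: "0 \<le> l \<Longrightarrow> x \<in> cube_set x l"
  by (simp add: mem_cube_set)

lemma mem_cube_set_commute: "x \<in> cube_set y l \<longleftrightarrow> y \<in> cube_set x l"
  by (simp add: mem_cube_set inner_diff_left abs_minus_commute)

lemma mem_cube_set_trans: "x \<in> cube_set y l \<Longrightarrow> y \<in> cube_set z r \<Longrightarrow> l + r \<le> t \<Longrightarrow> x \<in> cube_set z t"
  unfolding mem_cube_set
proof safe
  fix b :: 'a assume "b \<in> Basis"
    and *: "\<forall>b\<in>Basis. \<bar>(x - y) \<bullet> b\<bar> \<le> l / 2" "\<forall>b\<in>Basis. \<bar>(y - z) \<bullet> b\<bar> \<le> r / 2" "l + r \<le> t"
  then have "\<bar>(x - y) \<bullet> b\<bar> \<le> l / 2" "\<bar>(y - z) \<bullet> b\<bar> \<le> r / 2" by auto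
  moreover have "(x - z) \<bullet> b = (x - y) \<bullet> b + (y - z) \<bullet> b" by (simp add: inner_diff_left)
  ultimately show "\<bar>(x - z) \<bullet> b\<bar> \<le> t / 2" using *(3) by linarith
qed

lemma cube_set_subset: "y \<in> cube_set z r \<Longrightarrow> l + r \<le> t \<Longrightarrow> cube_set y l \<subseteq> cube_set z t"
  using mem_cube_set_trans by blast

lemma cube_set_mono: "l \<le> r \<Longrightarrow> cube_set x l \<subseteq> cube_set x r"
  unfolding mem_cube_set subset_iff by fastforce

lemma cube_set_subsetD:
  fixes x :: "'a::euclidean_space"
  assumes "cube_set x l \<subseteq> cube_set y r" "0 \<le> l"
  shows "x \<in> cube_set y r" "l \<le> r"
proof -
  show "x \<in> cube_set y r" using assms center_mem_cube_set by blast
  obtain b :: 'a where b: "b \<in> Basis" using nonempty_Basis by blast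
  \<comment> \<open>Two opposite corners on the main diagonal are \<open>l\<close> apart in every
    coordinate, which bounds \<open>l\<close> by \<open>r\<close>.\<close>
  have "x + (l/2) *\<^sub>R One \<in> cube_set x l" "x - (l/2) *\<^sub>R One \<in> cube_set x l"
    using assms(2) by (simp_all add: mem_cube_set)
  then have "x + (l/2) *\<^sub>R One \<in> cube_set y r" "x - (l/2) *\<^sub>R One \<in> cube_set y r"
    using assms(1) by auto
  then have "\<bar>(x + (l/2) *\<^sub>R One - y) \<bullet> b\<bar> \<le> r/2" "\<bar>(x - (l/2) *\<^sub>R One - y) \<bullet> b\<bar> \<le> r/2"
    using b by (simp_all add: mem_cube_set)
  then have "\<bar>x \<bullet> b + l/2 - y \<bullet> b\<bar> \<le> r/2" "\<bar>x \<bullet> b - l/2 - y \<bullet> b\<bar> \<le> r/2"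
    using b by (simp_all add: inner_diff_left inner_add_left)
  then show "l \<le> r" by arith
qed

lemma compact_cube_set: "compact (cube_set x l)"
  by (simp add: cube_set_def compact_cbox)

lemma cube_set_borel [measurable]: "cube_set x l \<in> sets borel"
  by (simp add: cube_set_def)

lemma norm_diff_ge_cube_set:
  assumes "x \<notin> cube_set y t" "z \<in> cube_set y s"
  shows "(t - s) / 2 \<le> norm (x - z)"
proof -
  obtain b where b: "b \<in> Basis" "\<bar>(x - y) \<bullet> b\<bar> > t / 2" using assms(1) by (auto simp: mem_cube_set)
  have "\<bar>(z - y) \<bullet> b\<bar> \<le> s / 2" using assms(2) b by (auto simp: mem_cube_set)
  moreover have "(x - y) \<bullet> b = (x - z) \<bullet> b + (z - y) \<bullet> b" by (simp add: inner_diff_left)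
  moreover have "\<bar>(x - z) \<bullet> b\<bar> \<le> norm (x - z)" using b by (simp add: Basis_le_norm)
  ultimately have "t / 2 < norm (x - z) + s / 2"
    using b(2) abs_triangle_ineq[of "(x - z) \<bullet> b" "(z - y) \<bullet> b"] by linarith
  then show ?thesis by argo
qed

lemma norm_diff_le_cube_set:
  fixes x :: "'a::euclidean_space"
  assumes "x \<in> cube_set y l"
  shows "norm (x - y) \<le> real DIM('a) * l / 2"
proof -
  have "norm (x - y) \<le> (\<Sum>b\<in>Basis. \<bar>(x - y) \<bullet> b\<bar>)" by (rule norm_le_l1)
  also have "\<dots> \<le> (\<Sum>b\<in>(Basis::'a set). l / 2)" using assms by (intro sum_mono) (auto simp: mem_cube_set)
  finally show ?thesis by simp
qed

lemma cube_set_subset_cball: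
  "cube_set (x::'a::euclidean_space) l \<subseteq> cball x (real DIM('a) * l / 2)"
  using norm_diff_le_cube_set by (auto simp: dist_norm norm_minus_commute)

lemma cball_subset_cube_set: "cball x r \<subseteq> cube_set x (2 * r)"
proof
  fix y assume "y \<in> cball x r"
  then have "norm (y - x) \<le> r" by (simp add: dist_norm norm_minus_commute)
  then show "y \<in> cube_set x (2 * r)" unfolding mem_cube_set
    by (metis Basis_le_norm nonzero_mult_div_cancel_left order_trans zero_neq_numeral)
qed

text \<open>The point is that \<open>Z\<close> depends neither on the centre nor on the side of the cube.\<close>

lemma unit_cube_net:
  assumes "0 < \<delta>"
  obtains Z :: "'a::euclidean_space set" where "finite Z"
    "\<And>x l. 0 \<le> l \<Longrightarrow> cube_set x l \<subseteq> (\<Union>z\<in>Z. cube_set (x + l *\<^sub>R z) (\<delta> * l))"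
proof -
  obtain Z :: "'a set" where Z: "finite Z" "cube_set 0 1 \<subseteq> (\<Union>z\<in>Z. ball z (\<delta>/2))"
    using compact_cube_set[of "0::'a" 1] assms unfolding compact_eq_totally_bounded by (meson half_gt_zero)
  have "y \<in> (\<Union>z\<in>Z. cube_set (x + l *\<^sub>R z) (\<delta> * l))" if "0 \<le> l" "y \<in> cube_set x l" for x y l
  proof (cases "l = 0")
    case True
    then have "y = x" using norm_diff_le_cube_set[OF that(2)] by simp
    moreover have "Z \<noteq> {}" using Z(2) center_mem_cube_set[of 1 "0::'a"] by auto
    ultimately show ?thesis using True by (auto simp: mem_cube_set)
  next
    case False
    with that have l: "l > 0" by simp
    have "(1/l) *\<^sub>R (y - x) \<in> cube_set 0 1" unfolding mem_cube_set
    proof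
      fix b :: 'a assume "b \<in> Basis"
      then have "\<bar>(y - x) \<bullet> b\<bar> \<le> l/2" using that by (auto simp: mem_cube_set)
      moreover have "((1 / l) *\<^sub>R (y - x) - 0) \<bullet> b = ((y - x) \<bullet> b) / l" by simp
      ultimately show "\<bar>((1 / l) *\<^sub>R (y - x) - 0) \<bullet> b\<bar> \<le> 1 / 2" using l by (simp only: abs_divide) (simp add: field_simps)
    qed
    then obtain z where z: "z \<in> Z" "(1/l) *\<^sub>R (y - x) \<in> ball z (\<delta>/2)" using Z by blast
    then have *: "(1/l) *\<^sub>R (y - x) \<in> cube_set z \<delta>" using cball_subset_cube_set[of z "\<delta>/2"] by fastforce
    have "y \<in> cube_set (x + l *\<^sub>R z) (\<delta> * l)" unfolding mem_cube_set
    proof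
      fix b :: 'a assume "b \<in> Basis"
      then have "\<bar>((1/l) *\<^sub>R (y - x) - z) \<bullet> b\<bar> \<le> \<delta>/2" using * by (auto simp: mem_cube_set)
      moreover have "(y - (x + l *\<^sub>R z)) \<bullet> b = l * (((1/l) *\<^sub>R (y - x) - z) \<bullet> b)"
        using l by (simp add: inner_diff_left inner_add_left field_simps)
      ultimately show "\<bar>(y - (x + l *\<^sub>R z)) \<bullet> b\<bar> \<le> \<delta> * l / 2" using l by (simp add: abs_mult field_simps)
    qed
    then show ?thesis using z by auto
  qed
  then show ?thesis using that[of Z] Z(1) by blast
qed

section \<open>Densities at dyadic scales\<close>

locale poly_growth =
  fixes \<mu> :: "'a::euclidean_space measure" and n :: nat and C0 :: real
  assumes growth: "growth_measure n C0 \<mu>"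
begin

lemma sets_eq [measurable_cong, simp]: "sets \<mu> = sets borel"
  using growth by (simp add: growth_measure_def)

lemma space_eq [simp]: "space \<mu> = UNIV"
  using sets_eq_imp_space_eq[OF sets_eq] by simp

lemma emeasure_cball_finite: "emeasure \<mu> (cball x r) < \<infinity>"
proof -
  have "emeasure \<mu> (cball x r) \<le> emeasure \<mu> (ball x (\<bar>r\<bar> + 1))" by (intro emeasure_mono) auto
  also have "\<dots> \<le> ennreal (C0 * (\<bar>r\<bar> + 1) ^ n)" using growth by (simp add: growth_measure_def)
  finally show ?thesis by (simp add: le_less_trans)
qed

lemma emeasure_bounded_finite:
  assumes "bounded A" shows "emeasure \<mu> A < \<infinity>"
proof (cases "A \<in> sets \<mu>")
  case True
  obtain r :: real where "A \<subseteq> cball 0 r" using assms by (metis bounded_any_center mem_cball subsetI)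
  then have "emeasure \<mu> A \<le> emeasure \<mu> (cball 0 r)" by (intro emeasure_mono) auto
  then show ?thesis using emeasure_cball_finite le_less_trans by blast
qed (simp add: emeasure_notin_sets)

definition m :: "'a \<Rightarrow> real \<Rightarrow> real" where "m x l = measure \<mu> (cube_set x l)"

abbreviation S :: "'a set" where "S \<equiv> supp_measure \<mu>"

lemma emeasure_cube: "emeasure \<mu> (cube_set x l) = ennreal (m x l)"
  unfolding m_def using emeasure_bounded_finite[OF compact_imp_bounded[OF compact_cube_set]]
  by (simp add: emeasure_eq_ennreal_measure less_top)

lemma m_nonneg [simp]: "0 \<le> m x l" by (simp add: m_def)

lemma m_mono: "cube_set x l \<subseteq> cube_set y r \<Longrightarrow> m x l \<le> m y r"
  using emeasure_mono[of "cube_set x l" "cube_set y r" \<mu>] by (simp add: emeasure_cube)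

lemma m_mono_side: "l \<le> r \<Longrightarrow> m x l \<le> m x r"
  by (intro m_mono cube_set_mono)

lemma m_pos: assumes "x \<in> S" "0 < l" shows "0 < m x l"
proof -
  have "0 < emeasure \<mu> (ball x (l/2))" using assms by (simp add: supp_measure_def)
  also have "\<dots> \<le> emeasure \<mu> (cube_set x l)"
    using cball_subset_cube_set[of x "l/2"] by (intro emeasure_mono) auto
  finally show ?thesis by (simp add: emeasure_cube)
qed

lemma C0_pos: assumes "x \<in> S" shows "0 < C0"
proof -
  have "0 < emeasure \<mu> (cube_set x 1)" using m_pos[OF assms, of 1] by (simp add: emeasure_cube)
  also have "\<dots> \<le> ennreal (C0 * 1 ^ n)" using growth assms unfolding growth_measure_def by (metis zero_less_one)
  finally show ?thesis by simp
qed

lemma m_le: assumes "x \<in> S" "0 < l" shows "m x l \<le> C0 * l ^ n"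
proof -
  have "emeasure \<mu> (cube_set x l) \<le> ennreal (C0 * l ^ n)" using growth assms by (simp add: growth_measure_def)
  then show ?thesis using C0_pos[OF assms(1)] assms by (simp add: emeasure_cube)
qed

text \<open>The complement of the support is a union of null balls, and by the Lindelof property
  countably many of them already cover it. Pointwise estimates may therefore assume that the point
  is an admissible centre.\<close>

lemma AE_supp: "AE x in \<mu>. x \<in> S"
proof -
  define F where "F = {ball x r | x r. 0 < r \<and> emeasure \<mu> (ball x r) = 0}"
  have "\<And>A. A \<in> F \<Longrightarrow> open A" by (auto simp: F_def)
  from Lindelof[OF this] obtain F' where F': "F' \<subseteq> F" "countable F'" "\<Union>F' = \<Union>F" by metis
  have "emeasure \<mu> (\<Union>F') = 0"
  proof -
    have "F' \<subseteq> null_sets \<mu>" using F'(1) by (auto simp: F_def null_sets_def)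
    then show ?thesis using null_sets_UN'[OF F'(2), of id \<mu>] by (auto simp: null_sets_def)
  qed
  moreover have "\<Union>F' \<in> sets \<mu>" using F'(1) by (auto simp: F_def intro!: borel_open open_Union)
  ultimately have "\<Union>F' \<in> null_sets \<mu>" by (simp add: null_sets_def)
  moreover have "{x \<in> space \<mu>. x \<notin> S} \<subseteq> \<Union>F'"
  proof
    fix x assume "x \<in> {x \<in> space \<mu>. x \<notin> S}"
    then obtain r where r: "r > 0" "emeasure \<mu> (ball x r) = 0" by (auto simp: supp_measure_def)
    then have "ball x r \<in> F" by (auto simp: F_def)
    moreover have "x \<in> ball x r" using r by simp
    ultimately show "x \<in> \<Union>F'" unfolding F'(3) by blast
  qed
  ultimately show ?thesis by (rule AE_I')
qed

section \<open>Sums of densities over the grid of powers of 2\<close>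

definition scales :: "real \<Rightarrow> real \<Rightarrow> int set" where
  "scales s t = {k. s \<le> 2 powi k \<and> 2 powi k \<le> t}"

text \<open>Up to constants, \<open>1 + D x s t\<close> is the coefficient \<open>S\<close> of cubes of sides \<open>s \<le> t\<close>; summing over a fixed
  grid of scales makes it additive in the range of scales.\<close>

definition D :: "'a \<Rightarrow> real \<Rightarrow> real \<Rightarrow> real" where
  "D x s t = (\<Sum>k\<in>scales s t. m x (2 powi k) / (2 powi k) ^ n)"

lemma scales_iff: "0 < s \<Longrightarrow> 0 < t \<Longrightarrow> k \<in> scales s t \<longleftrightarrow> k \<in> {\<lceil>log 2 s\<rceil>..\<lfloor>log 2 t\<rfloor>}"
  unfolding scales_def
  by (auto simp: ceiling_le_iff le_floor_iff log_le_iff le_log_iff powr_real_of_int' powr_real_of_int)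

lemma finite_scales: "0 < s \<Longrightarrow> finite (scales s t)"
proof (cases "0 < t")
  case True
  assume "0 < s"
  with True have "scales s t = {\<lceil>log 2 s\<rceil>..\<lfloor>log 2 t\<rfloor>}" using scales_iff by blast
  then show ?thesis by simp
next
  case False
  then have "scales s t = {}" unfolding scales_def
    by (metis (mono_tags, lifting) Collect_empty_eq dual_order.trans not_less zero_less_numeral zero_less_power_int)
  then show ?thesis by simp
qed

lemma card_scales: assumes "0 < s" "s \<le> t" shows "real (card (scales s t)) \<le> 1 + log 2 (t / s)"
proof -
  have e: "scales s t = {\<lceil>log 2 s\<rceil>..\<lfloor>log 2 t\<rfloor>}" using scales_iff assms by fastforce
  have "log 2 s \<le> log 2 t" using assms by simp
  moreover have "real (card (scales s t)) = real (nat (\<lfloor>log 2 t\<rfloor> - \<lceil>log 2 s\<rceil> + 1))" unfolding e by (simp add: algebra_simps)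
  moreover have "log 2 (t/s) = log 2 t - log 2 s" using assms by (simp add: log_divide)
  ultimately show ?thesis by linarith
qed

lemma D_nonneg [simp]: "0 \<le> D x s t"
  unfolding D_def by (intro sum_nonneg divide_nonneg_nonneg) auto

lemma D_mono: assumes "0 < s'" "s' \<le> s" "t \<le> t'" shows "D x s t \<le> D x s' t'"
  unfolding D_def using assms
  by (intro sum_mono2 finite_scales) (auto simp: scales_def)

text \<open>If \<open>t\<close> is itself a power of 2, its term is counted in both ranges; hence an
  inequality.\<close>

lemma D_split: assumes "0 < s" "s \<le> t" shows "D x s u \<le> D x s t + D x t u"
proof -
  have "D x s u \<le> (\<Sum>k\<in>scales s t \<union> scales t u. m x (2 powi k) / (2 powi k) ^ n)"
    unfolding D_def using assms by (intro sum_mono2 finite_UnI finite_scales) (auto simp: scales_def)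
  also have "\<dots> \<le> D x s t + D x t u"
    unfolding D_def using assms by (subst sum.union_inter[symmetric]) (auto intro!: finite_scales sum_nonneg)
  finally show ?thesis .
qed

text \<open>Every density is at most \<open>C0\<close>, so the sum is at most \<open>C0\<close>
  times the number of scales. This bound is used between cubes of comparable side.\<close>

lemma D_le_log: assumes "x \<in> S" "0 < s" "s \<le> t" shows "D x s t \<le> C0 * (1 + log 2 (t / s))"
proof -
  have "D x s t \<le> (\<Sum>k\<in>scales s t. C0)"
    unfolding D_def using m_le[OF assms(1)] by (intro sum_mono) (simp add: divide_le_eq)
  also have "\<dots> = card (scales s t) * C0" by simp
  also have "\<dots> \<le> C0 * (1 + log 2 (t / s))"
    using mult_left_mono[OF card_scales[OF assms(2,3)], of C0] C0_pos[OF assms(1)] by (simp add: mult.commute)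
  finally show ?thesis .
qed

text \<open>For a scale 2^k >= s the cube at \<open>x\<close> fits into the cube of side 4 * 2^k at
  \<open>y\<close>, as 2^k + 2 s <= 4 * 2^k. The factor \<open>4 ^ n\<close> is the change of
  normalisation.\<close>

lemma D_shift:
  assumes "y \<in> cube_set x (2 * s)" "0 < s"
  shows "D x s t \<le> 4 ^ n * D y (4 * s) (4 * t)"
proof -
  have "D x s t \<le> (\<Sum>k\<in>scales s t. 4^n * (m y (2 powi (k+2)) / (2 powi (k+2)) ^ n))"
    unfolding D_def
  proof (rule sum_mono)
    fix k assume k: "k \<in> scales s t"
    have e: "(2::real) powi (k+2) = 4 * 2 powi k" by (simp add: power_int_add)
    have "cube_set x (2 powi k) \<subseteq> cube_set y (2 powi (k+2))"
    proof (rule cube_set_subset)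
      show "x \<in> cube_set y (2 * s)" using assms mem_cube_set_commute by blast
      have "s \<le> 2 powi k" "0 < (2::real) powi k" using k by (simp_all add: scales_def)
      then show "2 powi k + 2 * s \<le> 2 powi (k+2)" unfolding e by linarith
    qed
    then have "m x (2 powi k) \<le> m y (2 powi (k+2))" by (rule m_mono)
    then have "m x (2 powi k) / (2 powi k) ^ n \<le> m y (2 powi (k+2)) / (2 powi k) ^ n" by (simp add: divide_right_mono)
    also have "\<dots> = 4^n * (m y (2 powi (k+2)) / (2 powi (k+2)) ^ n)" unfolding e by (simp add: power_mult_distrib)
    finally show "m x (2 powi k) / (2 powi k) ^ n \<le> 4^n * (m y (2 powi (k+2)) / (2 powi (k+2)) ^ n)" .
  qed
  also have "\<dots> = 4^n * (\<Sum>k\<in>(\<lambda>k. k + 2) ` scales s t. m y (2 powi k) / (2 powi k) ^ n)"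
    by (subst sum.reindex) (auto simp: inj_on_def sum_distrib_left)
  also have "\<dots> \<le> 4^n * D y (4 * s) (4 * t)"
    unfolding D_def using assms
    by (intro mult_left_mono sum_mono2 finite_scales) (auto simp: scales_def power_int_add)
  finally show ?thesis .
qed

text \<open>As long as the growth factor stays above \<open>b > \<alpha>\<^sup>n\<close> the densities increase geometrically, so that the
  sum is dominated by its last term, and this cannot go on forever.\<close>

lemma exists_doubling_scale:
  assumes "1 < \<alpha>" "\<alpha> ^ n < b"
  obtains K where "0 \<le> K" and "\<And>x l. x \<in> S \<Longrightarrow> 0 < l \<Longrightarrow>
     \<exists>J. m x (\<alpha> * (\<alpha> ^ J * l)) \<le> b * m x (\<alpha> ^ J * l) \<and>
       (\<forall>j<J. b * m x (\<alpha> ^ j * l) < m x (\<alpha> * (\<alpha> ^ j * l))) \<and> D x l (\<alpha> ^ J * l) \<le> K"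
proof -
  \<comment> \<open>One step by the factor \<alpha> shrinks the previous bound by
    \<open>\<alpha> ^ n / b < 1\<close> and adds at most \<open>c\<close> times the new density,
    \<open>1 + log 2 \<alpha>\<close> bounding the number of new scales. \<open>K\<close> is a value
    that this recursion preserves; the maximum with 1 serves the base case.\<close>
  define c where "c = (1 + log 2 \<alpha>) * \<alpha> ^ n"
  define K where "K = max 1 (c / (1 - \<alpha> ^ n / b))"
  have b: "b > 0" using assms by (meson less_trans zero_less_one zero_less_power)
  have q: "\<alpha> ^ n / b < 1" using assms b by simp
  have c: "K * (\<alpha> ^ n / b) + c \<le> K"
  proof -
    have "c / (1 - \<alpha> ^ n / b) \<le> K" by (simp add: K_def)
    then have "c \<le> K * (1 - \<alpha> ^ n / b)" using q by (simp add: pos_divide_le_eq)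
    then show ?thesis by (simp add: algebra_simps)
  qed
  have K1: "K \<ge> 1" by (simp add: K_def)
  have step: "D x l (\<alpha> ^ J * l) \<le> K * (m x (\<alpha> ^ J * l) / (\<alpha> ^ J * l) ^ n)"
    if "x \<in> S" "0 < l" "\<forall>j<J. b * m x (\<alpha> ^ j * l) < m x (\<alpha> * (\<alpha> ^ j * l))" for x l J
    using that(3)
  proof (induction J)
    case 0
    have "D x l l \<le> m x l / l ^ n"
    \<comment> \<open>Only \<open>l\<close> itself can be a scale here, so the sum is empty or
      consists of the density of the initial cube.\<close>
    proof (cases "scales l l = {}")
      case False
      then obtain k where k: "2 powi k = l" by (auto simp: scales_def)
      have "2 powi j = (2::real) powi k \<longleftrightarrow> j = k" for j k :: int
        using power_int_strict_increasing[of j k "2::real"] power_int_strict_increasing[of k j "2::real"]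
        by (cases j k rule: linorder_cases) auto
      then have "scales l l = {k}" using k by (auto simp: scales_def)
      then show ?thesis using k by (simp add: D_def)
    qed (simp add: D_def that less_imp_le)
    also have "\<dots> \<le> K * (m x l / l ^ n)" using mult_right_mono[OF K1, of "m x l / l ^ n"] that by simp
    finally show ?case by simp
  next
    case (Suc J)
    define t where "t = \<alpha> ^ J * l"
    have t: "0 < t" using assms that by (simp add: t_def)
    have lt: "l \<le> t" using assms that by (simp add: t_def)
    have nd: "b * m x t < m x (\<alpha> * t)" using Suc.prems by (simp add: t_def)
    define w where "w = m x (\<alpha> * t) / (\<alpha> * t) ^ n"
    have w: "m x (\<alpha> * t) / t ^ n = \<alpha> ^ n * w" using assms t by (simp add: power_mult_distrib w_def)
    have "D x l (\<alpha> * t) \<le> D x l t + D x t (\<alpha> * t)" by (rule D_split[OF that(2) lt])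
    also have "D x l t \<le> K * (m x t / t ^ n)" using Suc by (simp add: t_def)
    also have "\<dots> \<le> K * (m x (\<alpha> * t) / b / t ^ n)" using nd t b K1
      by (intro mult_left_mono divide_right_mono) (auto simp: field_simps)
    also have "\<dots> = K * (m x (\<alpha> * t) / t ^ n / b)" by simp
    also have "\<dots> = K * (\<alpha> ^ n / b) * w" unfolding w by simp
    also have "D x t (\<alpha> * t) \<le> (\<Sum>k\<in>scales t (\<alpha> * t). m x (\<alpha> * t) / t ^ n)" unfolding D_def
      using t by (intro sum_mono frac_le m_mono_side power_mono) (auto simp: scales_def)
    also have "\<dots> = card (scales t (\<alpha> * t)) * (m x (\<alpha> * t) / t ^ n)" by simp
    also have "\<dots> \<le> (1 + log 2 \<alpha>) * (m x (\<alpha> * t) / t ^ n)"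
      using card_scales[of t "\<alpha> * t"] t assms by (intro mult_right_mono) auto
    also have "\<dots> = c * w" unfolding w by (simp add: c_def)
    finally have "D x l (\<alpha> * t) \<le> (K * (\<alpha> ^ n / b) + c) * w" by (simp add: distrib_right)
    also have "\<dots> \<le> K * w" using c t assms by (intro mult_right_mono) (auto simp: w_def)
    finally show ?case by (simp add: t_def w_def mult.assoc)
  qed
  have main: "\<exists>J. m x (\<alpha> * (\<alpha> ^ J * l)) \<le> b * m x (\<alpha> ^ J * l) \<and>
       (\<forall>j<J. b * m x (\<alpha> ^ j * l) < m x (\<alpha> * (\<alpha> ^ j * l))) \<and> D x l (\<alpha> ^ J * l) \<le> K * \<bar>C0\<bar>"
    if xl: "x \<in> S" "0 < l" for x l
  proof -
    \<comment> \<open>If no step were doubling, the mass would grow at least like b^j, against the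
      bound of order (\<alpha>^n)^j given by polynomial growth.\<close>
    have "\<exists>J. m x (\<alpha> * (\<alpha> ^ J * l)) \<le> b * m x (\<alpha> ^ J * l)"
    proof (rule ccontr)
      assume "\<not> ?thesis"
      then have nd: "b * m x (\<alpha> ^ j * l) < m x (\<alpha> * (\<alpha> ^ j * l))" for j using not_less by blast
      have g: "b ^ j * m x l \<le> m x (\<alpha> ^ j * l)" for j
      proof (induction j)
        case (Suc j)
        have "b ^ Suc j * m x l \<le> b * m x (\<alpha> ^ j * l)" using Suc b by (simp add: mult.assoc)
        also have "\<dots> \<le> m x (\<alpha> ^ Suc j * l)" using nd[of j] by (simp add: mult.assoc)
        finally show ?case .
      qed simp
      have "(b / \<alpha> ^ n) ^ j \<le> C0 * l ^ n / m x l" for j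
      proof -
        have "b ^ j * m x l \<le> C0 * (\<alpha> ^ j * l) ^ n" using g[of j] m_le[OF xl(1), of "\<alpha> ^ j * l"] xl assms
          by (meson mult_pos_pos order_trans zero_less_one less_trans zero_less_power)
        then show ?thesis using m_pos[OF xl] assms
          by (simp add: power_divide field_simps power_mult_distrib flip: power_mult)
      qed
      moreover have "1 < b / \<alpha> ^ n" using assms by (simp add: less_divide_eq)
      ultimately show False by (metis not_le real_arch_pow)
    qed
    then obtain J where J: "m x (\<alpha> * (\<alpha> ^ J * l)) \<le> b * m x (\<alpha> ^ J * l)"
      "\<forall>j<J. b * m x (\<alpha> ^ j * l) < m x (\<alpha> * (\<alpha> ^ j * l))"
      using exists_least_iff[of "\<lambda>J. m x (\<alpha> * (\<alpha> ^ J * l)) \<le> b * m x (\<alpha> ^ J * l)"] by (auto simp: not_le)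
    have p: "0 < \<alpha> ^ J * l" using assms xl by simp
    have "D x l (\<alpha> ^ J * l) \<le> K * (m x (\<alpha> ^ J * l) / (\<alpha> ^ J * l) ^ n)" by (rule step[OF xl J(2)])
    also have "\<dots> \<le> K * \<bar>C0\<bar>" using m_le[OF xl(1) p] p K1 C0_pos[OF xl(1)]
      by (intro mult_left_mono) (simp_all add: divide_le_eq)
    finally show ?thesis using J by blast
  qed
  have "0 \<le> K * \<bar>C0\<bar>" using K1 by simp
  then show ?thesis using that main by blast
qed

end

section \<open>The coefficients S and nested doubling cubes\<close>

text \<open>Enlarging the outer cube only adds terms. This reduces lower bounds for S with respect
  to a larger cube or the full space to a bounded cube of convenient side.\<close>

lemma S_coef_mono: "side R \<le> side R' \<Longrightarrow> S_coef \<mu> n Q R \<le> S_coef \<mu> n Q R'"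
proof -
  assume "side R \<le> side R'"
  then have "N_coef Q R \<le> N_coef Q R'"
    unfolding N_coef_def by (intro Inf_superset_mono) (auto intro: order_trans)
  then show ?thesis unfolding S_coef_def
    by (intro add_left_mono suminf_le) (auto intro: order_trans)
qed

context poly_growth
begin

lemma S_coef_Cube:
  assumes l: "0 < l" and N: "1 \<le> N" "r \<le> 2 ^ N * l" "\<And>k. 1 \<le> k \<Longrightarrow> k < N \<Longrightarrow> 2 ^ k * l < r"
  shows "S_coef \<mu> n (Cube x l) (Cube y r) = ennreal (1 + (\<Sum>k=1..N. m x (2 ^ k * l) / (2 ^ k * l) ^ n))"
proof -
  have "{enat k | k. 0 < k \<and> side (Cube y r) \<le> side (dilate (2 ^ k) (Cube x l))} = {enat k | k. 0 < k \<and> r \<le> 2 ^ k * l}"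
    using l by (simp add: ennreal_le_iff)
  moreover have "Inf {enat k | k. 0 < k \<and> r \<le> 2 ^ k * l} = enat N"
  proof (rule Inf_eqI)
    show "enat N \<le> i" if i: "i \<in> {enat k |k. 0 < k \<and> r \<le> 2 ^ k * l}" for i
    proof -
      obtain k where "i = enat k" "0 < k" "r \<le> 2 ^ k * l" using i by blast
      then show ?thesis using N(3)[of k] by (cases "k < N") auto
    qed
  next
    fix y assume "\<And>i. i \<in> {enat k |k. 0 < k \<and> r \<le> 2 ^ k * l} \<Longrightarrow> y \<le> i"
    then show "y \<le> enat N" using N by fastforce
  qed
  ultimately have NN: "N_coef (Cube x l) (Cube y r) = enat N" unfolding N_coef_def by simp
  have "S_coef \<mu> n (Cube x l) (Cube y r)
      = 1 + (\<Sum>k. if 1 \<le> k \<and> k \<le> N then emeasure \<mu> (cube_set x (2 ^ k * l)) / ennreal (2 ^ k * l) ^ n else 0)"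
    unfolding S_coef_def NN enat_ord_simps dilate.simps cset.simps side.simps ..
  also have "(\<Sum>k. if 1 \<le> k \<and> k \<le> N then emeasure \<mu> (cube_set x (2 ^ k * l)) / ennreal (2 ^ k * l) ^ n else 0)
     = (\<Sum>k=1..N. emeasure \<mu> (cube_set x (2 ^ k * l)) / ennreal (2 ^ k * l) ^ n)"
    by (subst suminf_finite[of "{1..N}"]) auto
  also have "\<dots> = (\<Sum>k=1..N. ennreal (m x (2 ^ k * l) / (2 ^ k * l) ^ n))"
    using l by (intro sum.cong refl) (simp add: emeasure_cube ennreal_power divide_ennreal)
  also have "\<dots> = ennreal (\<Sum>k=1..N. m x (2 ^ k * l) / (2 ^ k * l) ^ n)"
    using l by (intro sum_ennreal) simp
  also have "1 + \<dots> = ennreal (1 + (\<Sum>k=1..N. m x (2 ^ k * l) / (2 ^ k * l) ^ n))"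
    using l by (subst ennreal_plus) (auto intro!: sum_nonneg)
  finally show ?thesis .
qed

text \<open>S runs over the scales \<open>2 ^ k * l\<close> attached to the cube, D over fixed
  powers of 2. Rounding \<open>l\<close> up to a power of 2 moves one grid onto the other by a
  factor less than 2, which changes a density by at most \<open>2 ^ n\<close>; the few scales lost
  at the ends cost multiples of \<open>C0\<close>.\<close>

lemma S_coef_real:
  assumes "x \<in> S" and l: "0 < l" and "l \<le> r"
  shows "\<exists>s\<ge>1. S_coef \<mu> n (Cube x l) (Cube y r) = ennreal s \<and>
           s \<le> 1 + 2 ^ n * D x l r + 2 * C0 \<and> D x l r \<le> 2 ^ n * s + C0"
proof -
  define g where "g t = m x t / t ^ n" for t :: real
  have g0: "0 \<le> g t" "g t \<le> C0" if "0 < t" for t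
    using m_le[OF assms(1) that] that by (auto simp: g_def divide_le_eq)
  have g2: "g s \<le> 2 ^ n * g t" if "0 < s" "s \<le> t" "t \<le> 2 * s" for s t
  proof -
    have "g s = 2 ^ n * (m x s / (2 * s) ^ n)" using that by (simp add: g_def power_mult_distrib)
    also have "\<dots> \<le> 2 ^ n * g t" unfolding g_def using that
      by (intro mult_left_mono frac_le m_mono_side power_mono) auto
    finally show ?thesis .
  qed
  obtain N0 where N0: "r / l < 2 ^ N0" using real_arch_pow[of 2 "r/l"] by auto
  define N where "N = (LEAST k. 1 \<le> k \<and> r \<le> 2 ^ k * l)"
  have ex: "1 \<le> Suc N0 \<and> r \<le> 2 ^ Suc N0 * l"
  proof -
    have "r < 2 ^ N0 * l" using N0 l by (simp add: pos_divide_less_eq)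
    also have "\<dots> \<le> 2 ^ Suc N0 * l" using l by simp
    finally show ?thesis by simp
  qed
  have N: "1 \<le> N" "r \<le> 2 ^ N * l" using LeastI[of "\<lambda>k. 1 \<le> k \<and> r \<le> 2 ^ k * l", OF ex] by (auto simp: N_def)
  have Nm: "2 ^ k * l < r" if "1 \<le> k" "k < N" for k
    using not_less_Least[of k "\<lambda>k. 1 \<le> k \<and> r \<le> 2 ^ k * l"] that by (auto simp: N_def not_le)
  define s where "s = 1 + (\<Sum>k=1..N. g (2 ^ k * l))"
  have Se: "S_coef \<mu> n (Cube x l) (Cube y r) = ennreal s"
    unfolding s_def g_def by (rule S_coef_Cube[OF l N Nm])
  have s1: "s \<ge> 1" unfolding s_def using g0 l by (simp add: sum_nonneg)
  define e where "e = \<lceil>log 2 l\<rceil>"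
  have e: "l \<le> 2 powi e" "2 powi e < 2 * l"
  proof -
    have "2 powi e = (2::real) powr e" by (simp add: powr_real_of_int')
    moreover have "log 2 l \<le> e" "e < log 2 l + 1" unfolding e_def by linarith+
    moreover have "2 powr (log 2 l + 1) = 2 * l" using l by (simp add: powr_add)
    ultimately show "l \<le> 2 powi e" "2 powi e < 2 * l" using l
      by (auto simp: log_le_iff less_log_iff) (metis one_less_numeral_iff powr_less_cancel_iff semiring_norm(76))
  qed
  have pe: "(2::real) powi (e + int k) = 2 ^ k * 2 powi e" for k by (simp add: power_int_add)
  have Dg: "D x l r = (\<Sum>k\<in>scales l r. g (2 powi k))" by (simp add: D_def g_def)
  \<comment> \<open>After rounding, the two largest scales may exceed \<open>r\<close> and leave the
    range of D; each of them is bounded by \<open>C0\<close>.\<close>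
  have "(\<Sum>k=1..N. g (2 ^ k * l)) \<le> (\<Sum>k\<in>{1..N} - {N-1,N}. g (2 ^ k * l)) + 2 * C0"
  proof -
    have "(\<Sum>k=1..N. g (2 ^ k * l)) = (\<Sum>k\<in>{1..N} - {N-1,N}. g (2 ^ k * l)) + (\<Sum>k\<in>{1..N} \<inter> {N-1,N}. g (2 ^ k * l))"
      by (subst sum.union_disjoint[symmetric]) (auto intro!: sum.cong)
    also have "(\<Sum>k\<in>{1..N} \<inter> {N-1,N}. g (2 ^ k * l)) \<le> card ({1..N} \<inter> {N-1,N}) * C0"
      using l by (intro sum_bounded_above g0) simp
    also have "\<dots> \<le> 2 * C0"
    proof (rule mult_right_mono)
      have "card ({1..N} \<inter> {N-1,N}) \<le> card {N-1,N}" by (intro card_mono) auto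
      also have "\<dots> \<le> 2" using card_insert_le_m1[of 2 "{N}" "N-1"] by simp
      finally show "real (card ({1..N} \<inter> {N-1,N})) \<le> 2" by simp
    qed (use C0_pos[OF assms(1)] in simp)
    finally show ?thesis by simp
  qed
  also have "(\<Sum>k\<in>{1..N} - {N-1,N}. g (2 ^ k * l)) \<le> (\<Sum>k\<in>{1..N} - {N-1,N}. 2 ^ n * g (2 powi (e + int k)))"
  proof (intro sum_mono g2)
    fix k assume "k \<in> {1..N} - {N - 1, N}"
    show "0 < 2 ^ k * l" "2 ^ k * l \<le> 2 powi (e + int k)" "2 powi (e + int k) \<le> 2 * (2 ^ k * l)"
      unfolding pe using e l by auto
  qed
  also have "\<dots> = 2 ^ n * (\<Sum>k\<in>(\<lambda>k. e + int k) ` ({1..N} - {N-1,N}). g (2 powi k))"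
    by (subst sum.reindex) (auto simp: inj_on_def sum_distrib_left)
  also have "\<dots> \<le> 2 ^ n * D x l r" unfolding Dg
  proof (intro mult_left_mono sum_mono2 finite_scales l)
    show "(\<lambda>k. e + int k) ` ({1..N} - {N-1,N}) \<subseteq> scales l r"
    proof
      fix j assume "j \<in> (\<lambda>k. e + int k) ` ({1..N} - {N-1,N})"
      then obtain k where k: "k \<in> {1..N}" "k \<noteq> N" "k \<noteq> N - 1" and j: "j = e + int k" by blast
      have "1 * 2 powi e \<le> 2 ^ k * (2::real) powi e" by (intro mult_right_mono) auto
      then have "l \<le> 2 ^ k * 2 powi e" using e by linarith
      moreover have "2 ^ k * 2 powi e \<le> 2 ^ Suc k * l" using e by simp
      moreover have "2 ^ Suc k * l < r" using Nm[of "Suc k"] k by auto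
      ultimately show "j \<in> scales l r" unfolding j scales_def mem_Collect_eq pe by linarith
    qed
  qed (simp_all add: g0(1))
  finally have up: "s \<le> 1 + 2 ^ n * D x l r + 2 * C0" unfolding s_def by simp
  have sub: "scales l r \<subseteq> (\<lambda>k. e + int k) ` {0..N}"
  proof
    fix j assume j: "j \<in> scales l r"
    then have j': "l \<le> 2 powi j" "2 powi j \<le> r" by (auto simp: scales_def)
    have "e \<le> j" unfolding e_def using j'(1) l
      by (simp add: ceiling_le_iff log_le_iff powr_real_of_int')
    then obtain k where k: "j = e + int k" by (metis zle_iff_zadd)
    have "2 ^ k * l \<le> 2 ^ k * 2 powi e" using e by (intro mult_left_mono) auto
    also have "\<dots> \<le> 2 ^ N * l" using j'(2) N(2) unfolding k pe by linarith
    finally have "2 ^ k * l \<le> 2 ^ N * l" .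
    then have "k \<le> N" using l by simp
    then show "j \<in> (\<lambda>k. e + int k) ` {0..N}" using k by auto
  qed
  have "D x l r \<le> (\<Sum>j\<in>(\<lambda>k. e + int k) ` {0..N}. g (2 powi j))"
    unfolding Dg by (intro sum_mono2 sub) (simp_all add: g0(1))
  also have "\<dots> = (\<Sum>k\<in>{0..N}. g (2 powi (e + int k)))" by (subst sum.reindex) (auto simp: inj_on_def)
  also have "\<dots> = (\<Sum>k\<in>{0..<N}. g (2 powi (e + int k))) + g (2 powi (e + int N))"
    by (simp only: atLeast0AtMost lessThan_Suc_atMost[symmetric] sum.lessThan_Suc atLeast0LessThan)
  \<comment> \<open>The rounded scale is now compared with the next scale
    \<open>2 ^ Suc k * l\<close>, so that the sum starts at index 1 as in S; only the top term is
    left over.\<close>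
  also have "\<dots> \<le> (\<Sum>k\<in>{0..<N}. 2 ^ n * g (2 ^ Suc k * l)) + C0"
  proof (intro add_mono sum_mono g2 g0)
    fix k assume "k \<in> {0..<N}"
    show "2 powi (e + int k) \<le> 2 ^ Suc k * l" "2 ^ Suc k * l \<le> 2 * 2 powi (e + int k)"
      unfolding pe using e by auto
  qed auto
  also have "(\<Sum>k\<in>{0..<N}. 2 ^ n * g (2 ^ Suc k * l)) = 2 ^ n * (\<Sum>k=1..N. g (2 ^ k * l))"
    unfolding sum_distrib_left[symmetric] using sum.shift_bounds_Suc_ivl[of "\<lambda>k. g (2 ^ k * l)" 0 N]
    by (simp add: atLeastLessThanSuc_atLeastAtMost)
  finally have "D x l r \<le> 2 ^ n * (s - 1) + C0" by (simp add: s_def)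
  then have "D x l r \<le> 2 ^ n * s + C0" by (simp add: right_diff_distrib) (smt (verit) zero_less_power)
  with up s1 Se show ?thesis by blast
qed

definition dbl :: "real \<Rightarrow> real \<Rightarrow> 'a \<Rightarrow> real \<Rightarrow> bool" where
  "dbl \<alpha> b x l \<longleftrightarrow> m x (\<alpha> * l) \<le> b * m x l"

lemma doubling_Cube_iff: "0 \<le> b \<Longrightarrow> doubling \<mu> \<alpha> b (Cube x l) \<longleftrightarrow> dbl \<alpha> b x l"
  by (simp add: doubling_def dbl_def emeasure_cube flip: ennreal_mult)

end

section \<open>Controlling numbers for a function in rbmo\<close>

locale rbmo_function = poly_growth +
  fixes \<eta> \<rho> \<beta> :: real and f :: "'a \<Rightarrow> real"
  assumes eta: "1 < \<eta>" "\<eta> \<le> \<rho>" and dconst: "doubling_constant \<mu> n \<rho> \<beta>"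
    and f_rbmo: "f \<in> rbmo \<mu> n \<eta> \<rho> \<beta>"
begin

definition Cf :: real where "Cf = (SOME C. 0 \<le> C \<and> rbmo_bound \<mu> n \<eta> \<rho> \<beta> f C)"

lemma Cf: "0 \<le> Cf" "rbmo_bound \<mu> n \<eta> \<rho> \<beta> f Cf"
  unfolding Cf_def using someI_ex[of "\<lambda>C. 0 \<le> C \<and> rbmo_bound \<mu> n \<eta> \<rho> \<beta> f C"] f_rbmo
  by (auto simp: rbmo_def)

lemma rho_beta: "1 < \<rho>" "\<rho> ^ n < \<beta>" "1 < \<beta>"
proof -
  show "1 < \<rho>" "\<rho> ^ n < \<beta>" using eta dconst by (auto simp: doubling_constant_def)
  then show "1 < \<beta>" using one_le_power[of \<rho> n] by linarith
qed

lemma f_meas [measurable]: "f \<in> borel_measurable \<mu>"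
  using f_rbmo by (simp add: rbmo_def loc_integrable_def)

lemma f_int: "set_integrable \<mu> (cube_set x l) f"
  using f_rbmo compact_cube_set by (auto simp: rbmo_def loc_integrable_def)

section \<open>Means and oscillations over bounded cubes\<close>

definition avg :: "'a \<Rightarrow> real \<Rightarrow> real" where "avg x l = mean \<mu> f (Cube x l)"

definition osc :: "real \<Rightarrow> 'a \<Rightarrow> real \<Rightarrow> real" where
  "osc c x l = (LINT y:cube_set x l|\<mu>. \<bar>f y - c\<bar>)"

lemma const_int: "set_integrable \<mu> (cube_set x l) (\<lambda>_. c::real)"
  unfolding set_integrable_def using emeasure_cube[of x l]
  by (intro integrable_scaleR_left integrable_real_indicator) auto

lemma osc_int: "set_integrable \<mu> (cube_set x l) (\<lambda>y. \<bar>f y - c\<bar>)"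
  by (intro set_integrable_abs set_integral_diff f_int const_int)

lemma osc_nonneg: "0 \<le> osc c x l"
  unfolding osc_def set_lebesgue_integral_def by (intro integral_nonneg_AE AE_I2) (auto simp: indicator_def)

lemma osc_nn: "(\<integral>\<^sup>+y\<in>cube_set x l. ennreal \<bar>f y - c\<bar> \<partial>\<mu>) = ennreal (osc c x l)"
proof -
  have "(\<integral>\<^sup>+y\<in>cube_set x l. ennreal \<bar>f y - c\<bar> \<partial>\<mu>) = (\<integral>\<^sup>+y. ennreal (indicator (cube_set x l) y *\<^sub>R \<bar>f y - c\<bar>) \<partial>\<mu>)"
    by (intro nn_integral_cong) (auto simp: indicator_def)
  also have "\<dots> = ennreal (osc c x l)" unfolding osc_def set_lebesgue_integral_def
    using osc_int[of x l c] by (intro nn_integral_eq_integral) (auto simp: set_integrable_def)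
  finally show ?thesis .
qed

lemma osc_mono: "cube_set x l \<subseteq> cube_set y r \<Longrightarrow> osc c x l \<le> osc c y r"
proof -
  assume "cube_set x l \<subseteq> cube_set y r"
  then have "ennreal (osc c x l) \<le> ennreal (osc c y r)"
    unfolding osc_nn[symmetric] by (intro nn_integral_mono) (auto simp: indicator_def)
  then show ?thesis using osc_nonneg by simp
qed

lemma osc_triangle: "osc c x l \<le> osc d x l + \<bar>d - c\<bar> * m x l"
proof -
  have "osc c x l \<le> (LINT y:cube_set x l|\<mu>. \<bar>f y - d\<bar> + \<bar>d - c\<bar>)"
    unfolding osc_def by (intro set_integral_mono set_integral_add osc_int const_int) auto
  also have "\<dots> = osc d x l + \<bar>d - c\<bar> * m x l" unfolding osc_def
    using const_int emeasure_cube[of x l]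
    by (subst set_integral_add) (auto intro: osc_int simp: m_def set_lebesgue_integral_def)
  finally show ?thesis .
qed

lemma avg_diff: assumes "x \<in> S" "0 < l" shows "\<bar>avg x l - c\<bar> * m x l \<le> osc c x l"
proof -
  have mp: "0 < m x l" using m_pos assms by simp
  have "(LINT y:cube_set x l|\<mu>. f y - c) = (avg x l - c) * m x l"
    using const_int emeasure_cube[of x l] mp
    by (subst set_integral_diff)
       (auto intro: f_int simp: avg_def mean_def m_def set_lebesgue_integral_def left_diff_distrib)
  moreover have "\<bar>LINT y:cube_set x l|\<mu>. f y - c\<bar> \<le> osc c x l"
    unfolding osc_def set_lebesgue_integral_def
    by (rule order_trans[OF integral_abs_bound]) (simp add: abs_mult)
  ultimately show ?thesis using mp by (simp add: abs_mult)
qed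

definition tside :: "'a \<Rightarrow> real \<Rightarrow> real" where
  "tside x l = 2 ^ (LEAST N. dbl \<rho> \<beta> x (2 ^ N * l)) * l"

lemma tilde_Cube: "tilde \<mu> \<rho> \<beta> (Cube x l) = Cube x (tside x l)"
  using rho_beta by (simp add: tilde_def tside_def doubling_Cube_iff)

lemma tside:
  assumes "x \<in> S" "0 < l"
  shows "dbl \<rho> \<beta> x (tside x l)" "l \<le> tside x l"
proof -
  have "\<exists>N. dbl \<rho> \<beta> x (2 ^ N * l)"
  proof -
    have "is_cube \<mu> (Cube x l)" using assms by simp
    then obtain N where "doubling \<mu> \<rho> \<beta> (dilate (2 ^ N) (Cube x l))"
      using dconst unfolding doubling_constant_def by blast
    then show ?thesis using rho_beta by (auto simp: doubling_Cube_iff)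
  qed
  then show "dbl \<rho> \<beta> x (tside x l)" unfolding tside_def by (rule LeastI_ex)
  show "l \<le> tside x l" using assms by (simp add: tside_def)
qed

lemma tside_dbl: "dbl \<rho> \<beta> x l \<Longrightarrow> tside x l = l"
  unfolding tside_def by (subst Least_equality[of _ 0]) auto

text \<open>Dyadic dilates below the first doubling one have the same first doubling dilate. In
  \<open>avg_tside_F\<close> this lets the oscillation condition at an intermediate cube speak about
  the mean attached to the original cube.\<close>

lemma tside_dyadic:
  assumes "x \<in> S" "0 < l" "2 ^ k * l \<le> tside x l"
  shows "tside x (2 ^ k * l) = tside x l"
proof -
  define N where "N = (LEAST N. dbl \<rho> \<beta> x (2 ^ N * l))"
  have tN: "tside x l = 2 ^ N * l" by (simp add: tside_def N_def)
  then have kN: "k \<le> N" using assms by simp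
  have "(LEAST j. dbl \<rho> \<beta> x (2 ^ j * (2 ^ k * l))) = N - k"
  proof (rule Least_equality)
    show "dbl \<rho> \<beta> x (2 ^ (N - k) * (2 ^ k * l))"
      using tside(1)[OF assms(1,2)] kN by (simp add: tN mult.assoc[symmetric] flip: power_add)
    show "N - k \<le> j" if "dbl \<rho> \<beta> x (2 ^ j * (2 ^ k * l))" for j
    proof -
      have "dbl \<rho> \<beta> x (2 ^ (j + k) * l)" using that by (simp add: power_add mult.assoc)
      then have "N \<le> j + k" unfolding N_def by (rule Least_le)
      then show ?thesis by simp
    qed
  qed
  then show ?thesis using kN by (simp add: tside_def[of x "2 ^ k * l"] tN mult.assoc[symmetric] flip: power_add)
qed

lemma rbmo_small:
  assumes "x \<in> S" "0 < l" "l \<le> 1"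
  shows "osc (avg x (tside x l)) x l \<le> Cf * m x (\<eta> * l)"
proof -
  have "(\<integral>\<^sup>+y\<in>cset (Cube x l). ennreal \<bar>f y - mean \<mu> f (tilde \<mu> \<rho> \<beta> (Cube x l))\<bar> \<partial>\<mu>)
      / emeasure \<mu> (cset (dilate \<eta> (Cube x l))) \<le> ennreal Cf"
  proof -
    have "is_cube \<mu> (Cube x l) \<and> side (Cube x l) \<le> 1" using assms ennreal_leI[of l 1] by simp
    then show ?thesis using Cf(2) unfolding rbmo_bound_def by blast
  qed
  then have "ennreal (osc (avg x (tside x l)) x l) / ennreal (m x (\<eta> * l)) \<le> ennreal Cf"
    by (simp add: tilde_Cube osc_nn emeasure_cube avg_def)
  then show ?thesis using m_pos[of x "\<eta> * l"] assms eta osc_nonneg Cf(1)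
    by (simp add: divide_ennreal pos_divide_le_eq)
qed

lemma rbmo_large:
  assumes "x \<in> S" "1 < l"
  shows "osc 0 x l \<le> Cf * m x (\<eta> * l)"
proof -
  have "is_cube \<mu> (Cube x l) \<and> 1 < side (Cube x l)"
    using assms by (simp flip: ennreal_1 add: ennreal_less_iff)
  then have "(\<integral>\<^sup>+y\<in>cset (Cube x l). ennreal \<bar>f y\<bar> \<partial>\<mu>)
      / emeasure \<mu> (cset (dilate \<eta> (Cube x l))) \<le> ennreal Cf"
    using Cf(2) unfolding rbmo_bound_def by blast
  then have "ennreal (osc 0 x l) / ennreal (m x (\<eta> * l)) \<le> ennreal Cf"
    using osc_nn[of 0 x l] by (simp add: emeasure_cube)
  then show ?thesis using m_pos[of x "\<eta> * l"] assms eta osc_nonneg Cf(1)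
    by (simp add: divide_ennreal pos_divide_le_eq)
qed

lemma dbl_eta: "dbl \<rho> \<beta> x l \<Longrightarrow> 0 \<le> l \<Longrightarrow> m x (\<eta> * l) \<le> \<beta> * m x l"
  using m_mono_side[of "\<eta> * l" "\<rho> * l" x] eta by (simp add: dbl_def mult_right_mono)

lemma avg_large:
  assumes "x \<in> S" "1 < l" "dbl \<rho> \<beta> x l" shows "\<bar>avg x l\<bar> \<le> Cf * \<beta>"
proof -
  have "\<bar>avg x l - 0\<bar> * m x l \<le> Cf * m x (\<eta> * l)" using avg_diff[of x l 0] rbmo_large[of x l] assms by linarith
  also have "\<dots> \<le> Cf * (\<beta> * m x l)" using dbl_eta[of x l] assms Cf by (intro mult_left_mono) auto
  finally show ?thesis using m_pos[of x l] assms by (simp add: mult.assoc[symmetric])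
qed

text \<open>For side at most 1 a doubling cube is its own tilde cube. On larger cubes rbmo controls
  only the size of \<open>f\<close>, and replacing 0 by the mean costs a factor 2.\<close>

lemma osc_avg:
  assumes "x \<in> S" "0 < l" "dbl \<rho> \<beta> x l" shows "osc (avg x l) x l \<le> 2 * Cf * \<beta> * m x l"
proof (cases "l \<le> 1")
  case True
  have "osc (avg x l) x l \<le> Cf * m x (\<eta> * l)" using rbmo_small[OF assms(1,2) True] tside_dbl[OF assms(3)] by simp
  also have "\<dots> \<le> Cf * (\<beta> * m x l)" using dbl_eta[of x l] assms Cf by (intro mult_left_mono) auto
  also have "\<dots> \<le> 2 * Cf * \<beta> * m x l" using Cf rho_beta by simp
  finally show ?thesis .
next
  case False
  have "osc (avg x l) x l \<le> osc 0 x l + \<bar>avg x l\<bar> * m x l" using osc_triangle[of "avg x l" x l 0] by simp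
  also have "\<dots> \<le> 2 * osc 0 x l" using avg_diff[OF assms(1,2), of 0] by simp
  also have "\<dots> \<le> 2 * (Cf * m x (\<eta> * l))" using rbmo_large[of x l] assms False by simp
  also have "\<dots> \<le> 2 * (Cf * (\<beta> * m x l))" using dbl_eta[of x l] assms Cf by (intro mult_left_mono) auto
  finally show ?thesis by simp
qed

text \<open>The rbmo condition compares means only when the smaller cube has side at most 1.
  Otherwise both cubes are large, and each mean is bounded by \<open>Cf * \<beta>\<close>.\<close>

lemma avg_nested:
  obtains K where "0 \<le> K" and "\<And>x y l r. x \<in> S \<Longrightarrow> y \<in> S \<Longrightarrow> 0 < l \<Longrightarrow> cube_set x l \<subseteq> cube_set y r \<Longrightarrow>
     dbl \<rho> \<beta> x l \<Longrightarrow> dbl \<rho> \<beta> y r \<Longrightarrow> \<bar>avg x l - avg y r\<bar> \<le> K * (1 + D x l r)"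
proof -
  define K1 where "K1 = Cf * (1 + 2 ^ n + 2 * \<bar>C0\<bar>)"
  have K1: "0 \<le> K1" using Cf by (simp add: K1_def)
  show ?thesis
  proof (rule that[of "K1 + 2 * Cf * \<beta>"])
    fix x y l r assume a: "x \<in> S" "y \<in> S" "0 < l" "cube_set x l \<subseteq> cube_set y r" "dbl \<rho> \<beta> x l" "dbl \<rho> \<beta> y r"
    have lr: "l \<le> r" using cube_set_subsetD[OF a(4)] a by simp
    show "\<bar>avg x l - avg y r\<bar> \<le> (K1 + 2 * Cf * \<beta>) * (1 + D x l r)"
    proof (cases "l \<le> 1")
      case True
      obtain s where s: "s \<ge> 1" "S_coef \<mu> n (Cube x l) (Cube y r) = ennreal s"
         "s \<le> 1 + 2 ^ n * D x l r + 2 * C0" using S_coef_real[OF a(1,3) lr] by blast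
      have "ennreal \<bar>mean \<mu> f (Cube x l) - mean \<mu> f (Cube y r)\<bar> \<le> ennreal Cf * S_coef \<mu> n (Cube x l) (Cube y r)"
      proof -
        have "is_cube \<mu> (Cube x l) \<and> is_cube \<mu> (Cube y r) \<and> doubling \<mu> \<rho> \<beta> (Cube x l) \<and> doubling \<mu> \<rho> \<beta> (Cube y r) \<and>
          cset (Cube x l) \<subseteq> cset (Cube y r) \<and> side (Cube x l) \<le> 1"
          using a lr True rho_beta ennreal_leI[of l 1] by (simp add: doubling_Cube_iff)
        then show ?thesis using Cf(2) unfolding rbmo_bound_def by blast
      qed
      then have "\<bar>avg x l - avg y r\<bar> \<le> Cf * s" using s Cf(1) by (simp add: avg_def flip: ennreal_mult)
      also have "\<dots> \<le> Cf * ((1 + 2 ^ n + 2 * \<bar>C0\<bar>) * (1 + D x l r))"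
      proof (intro mult_left_mono Cf order_trans[OF s(3)])
        have "0 \<le> \<bar>C0\<bar> * D x l r" by simp
        moreover have "C0 \<le> \<bar>C0\<bar>" by simp
        ultimately show "1 + 2 ^ n * D x l r + 2 * C0 \<le> (1 + 2 ^ n + 2 * \<bar>C0\<bar>) * (1 + D x l r)"
          using D_nonneg[of x l r] zero_le_power[of "2::real" n]
          by (simp only: distrib_left distrib_right mult_1 mult_1_right) linarith
      qed
      also have "\<dots> = K1 * (1 + D x l r)" by (simp add: K1_def)
      also have "\<dots> \<le> (K1 + 2 * Cf * \<beta>) * (1 + D x l r)"
        using Cf rho_beta by (intro mult_right_mono) auto
      finally show ?thesis .
    next
      case False
      then have "\<bar>avg x l\<bar> \<le> Cf * \<beta>" "\<bar>avg y r\<bar> \<le> Cf * \<beta>" using avg_large a lr by auto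
      then have "\<bar>avg x l - avg y r\<bar> \<le> 2 * Cf * \<beta>" by linarith
      also have "\<dots> \<le> (K1 + 2 * Cf * \<beta>) * (1 + D x l r)"
        using K1 Cf rho_beta mult_mono[of "2 * Cf * \<beta>" "K1 + 2 * Cf * \<beta>" 1 "1 + D x l r"] by simp
      finally show ?thesis .
    qed
  next
    have "0 \<le> 2 * Cf * \<beta>" using Cf rho_beta by simp
    then show "0 \<le> K1 + 2 * Cf * \<beta>" using K1 by linarith
  qed
qed

text \<open>Dyadic dilates need not be compatible with \<open>\<rho>\<close>-doubling when \<open>\<rho>\<close> is not a power of 2, so the controlling
  number of a cube is the mean over its first doubling dilate by a power of \<open>\<rho>\<close> rather than of 2.\<close>

definition hl :: "'a \<Rightarrow> real \<Rightarrow> real" where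
  "hl x l = \<rho> ^ (LEAST J. dbl \<rho> \<beta> x (\<rho> ^ J * l)) * l"

definition F :: "'a \<Rightarrow> real \<Rightarrow> real" where "F x l = avg x (hl x l)"

text \<open>The gain over \<open>tside\<close> is the bound on the densities between a cube and its
  chosen doubling dilate.\<close>

lemma hl:
  obtains K where "0 \<le> K" and "\<And>x l. x \<in> S \<Longrightarrow> 0 < l \<Longrightarrow> l \<le> hl x l \<and> dbl \<rho> \<beta> x (hl x l) \<and> D x l (hl x l) \<le> K"
proof -
  obtain K where K: "0 \<le> K" "\<And>x l. x \<in> S \<Longrightarrow> 0 < l \<Longrightarrow>
     \<exists>J. m x (\<rho> * (\<rho> ^ J * l)) \<le> \<beta> * m x (\<rho> ^ J * l) \<and>
       (\<forall>j<J. \<beta> * m x (\<rho> ^ j * l) < m x (\<rho> * (\<rho> ^ j * l))) \<and> D x l (\<rho> ^ J * l) \<le> K"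
    using that by (rule exists_doubling_scale[OF rho_beta(1,2)])
  show ?thesis
  proof (rule that[OF K(1)])
    fix x l assume a: "x \<in> S" "0 < (l::real)"
    obtain J where J: "dbl \<rho> \<beta> x (\<rho> ^ J * l)" "\<forall>j<J. \<not> dbl \<rho> \<beta> x (\<rho> ^ j * l)" "D x l (\<rho> ^ J * l) \<le> K"
      using K(2)[OF a] unfolding dbl_def not_le by blast
    have "(LEAST J. dbl \<rho> \<beta> x (\<rho> ^ J * l)) = J" proof (rule Least_equality)
      show "J \<le> i" if "dbl \<rho> \<beta> x (\<rho> ^ i * l)" for i using J(2) that not_less by blast
    qed (rule J(1))
    then have e: "hl x l = \<rho> ^ J * l" by (simp add: hl_def)
    have "1 * l \<le> \<rho> ^ J * l" using a rho_beta one_le_power[of \<rho> J] by (intro mult_right_mono) auto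
    then show "l \<le> hl x l \<and> dbl \<rho> \<beta> x (hl x l) \<and> D x l (hl x l) \<le> K"
      using J(1,3) unfolding e by simp
  qed
qed

text \<open>Each step that is not doubling multiplies the mass by more than \<beta>, so
  \<open>k\<close> of them would contradict a growth by at most b < \<beta>^k up to the side
  \<open>r\<close>.\<close>

lemma hl_le:
  assumes x: "x \<in> S" "0 < l" and M: "\<rho> ^ k * l \<le> r" "m x r \<le> b * m x l" "b < \<beta> ^ k"
  shows "hl x l \<le> \<rho> ^ k * l"
proof -
  define J where "J = (LEAST J. dbl \<rho> \<beta> x (\<rho> ^ J * l))"
  have g: "\<beta> ^ j * m x l \<le> m x (\<rho> ^ j * l)" if "j \<le> J" for j
    using that
  proof (induction j)
    case (Suc j)
    have "\<not> dbl \<rho> \<beta> x (\<rho> ^ j * l)" using not_less_Least[of j "\<lambda>J. dbl \<rho> \<beta> x (\<rho> ^ J * l)"] Suc by (simp add: J_def)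
    then have "\<beta> * m x (\<rho> ^ j * l) \<le> m x (\<rho> ^ Suc j * l)" by (simp add: dbl_def mult.assoc)
    moreover have "\<beta> * (\<beta> ^ j * m x l) \<le> \<beta> * m x (\<rho> ^ j * l)" using Suc rho_beta by simp
    ultimately show ?case by (simp add: mult.assoc)
  qed simp
  have "J \<le> k"
  proof (rule ccontr)
    assume "\<not> J \<le> k"
    then have "\<beta> ^ k * m x l \<le> m x (\<rho> ^ k * l)" using g by simp
    also have "\<dots> \<le> m x r" by (rule m_mono_side[OF M(1)])
    also have "\<dots> < \<beta> ^ k * m x l" using M m_pos[OF x] by (meson le_less_trans mult_strict_right_mono)
    finally show False by simp
  qed
  then show ?thesis using x rho_beta unfolding hl_def J_def[symmetric] by (intro mult_right_mono power_increasing) auto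
qed

text \<open>Measuring both cubes from a common lower scale makes the comparison available without
  knowing which of them is larger.\<close>

lemma avg_concentric:
  obtains K where "0 \<le> K" and "\<And>x l r s B. x \<in> S \<Longrightarrow> 0 < l \<Longrightarrow> l \<le> r \<Longrightarrow> l \<le> s \<Longrightarrow>
     dbl \<rho> \<beta> x r \<Longrightarrow> dbl \<rho> \<beta> x s \<Longrightarrow> D x l r \<le> B \<Longrightarrow> D x l s \<le> B \<Longrightarrow> \<bar>avg x r - avg x s\<bar> \<le> K * (1 + B)"
proof -
  obtain K where K: "0 \<le> K" "\<And>x y l r. x \<in> S \<Longrightarrow> y \<in> S \<Longrightarrow> 0 < l \<Longrightarrow> cube_set x l \<subseteq> cube_set y r \<Longrightarrow>
     dbl \<rho> \<beta> x l \<Longrightarrow> dbl \<rho> \<beta> y r \<Longrightarrow> \<bar>avg x l - avg y r\<bar> \<le> K * (1 + D x l r)" using that by (rule avg_nested)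
  have main: "\<bar>avg x r - avg x s\<bar> \<le> K * (1 + B)" if "x \<in> S" "0 < l" "l \<le> r" "r \<le> s"
     "dbl \<rho> \<beta> x r" "dbl \<rho> \<beta> x s" "D x l s \<le> B" for x l r s B
  proof -
    have "\<bar>avg x r - avg x s\<bar> \<le> K * (1 + D x r s)" using that by (intro K(2) cube_set_mono) auto
    also have "\<dots> \<le> K * (1 + B)" using that K(1) D_mono[of l r s s x] by (intro mult_left_mono) auto
    finally show ?thesis .
  qed
  show ?thesis
  proof (rule that[OF K(1)])
    fix x l r s B assume a: "x \<in> S" "0 < l" "l \<le> r" "l \<le> s" "dbl \<rho> \<beta> x r" "dbl \<rho> \<beta> x s" "D x l r \<le> B" "D x l s \<le> B"
    show "\<bar>avg x r - avg x s\<bar> \<le> K * (1 + B)"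
      using main[of x l r s B] main[of x l s r B] a by (cases "r \<le> s") (auto simp: abs_minus_commute)
  qed
qed

text \<open>Provides a dilation by a power of 2, compatible with tilde, whose doubling constant
  \<open>b\<close> still forces a \<rho>-doubling cube within \<open>k\<close> steps. Rounding
  \<rho>^k up to a power of 2 costs a factor at most 2, hence \<open>2 ^ n\<close> in the threshold,
  whereas \<beta>^k exceeds (\<rho>^n)^k by as large a factor as desired.\<close>

lemma exists_intermediate_base:
  obtains k M b where "1 \<le> k" "\<rho> ^ k \<le> 2 ^ M" "(2 ^ M) ^ n < b" "b < \<beta> ^ k"
proof -
  have "1 < \<beta> / \<rho> ^ n" using rho_beta by (simp add: less_divide_eq)
  then obtain k where k: "2 ^ n < (\<beta> / \<rho> ^ n) ^ k" using real_arch_pow by blast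
  then have k1: "1 \<le> k" using one_le_power[of "2::real" n] by (cases k) (auto simp del: one_le_power)
  obtain M0 where M0: "\<rho> ^ k < 2 ^ M0" using real_arch_pow[of 2 "\<rho> ^ k"] by auto
  define M where "M = (LEAST M. \<rho> ^ k \<le> 2 ^ M)"
  have M: "\<rho> ^ k \<le> 2 ^ M" unfolding M_def by (rule LeastI[of "\<lambda>M. \<rho> ^ k \<le> 2 ^ M" M0]) (use M0 in simp)
  have "2 ^ M \<le> 2 * \<rho> ^ k"
  proof (cases M)
    case 0
    have "1 \<le> \<rho> ^ k" by (rule one_le_power) (use rho_beta in simp)
    then show ?thesis unfolding 0 power_0 by linarith
  next
    case (Suc M')
    then have "\<not> \<rho> ^ k \<le> 2 ^ M'" using not_less_Least[of M' "\<lambda>M. \<rho> ^ k \<le> 2 ^ M"] by (simp add: M_def)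
    then show ?thesis using Suc by simp
  qed
  then have "(2 ^ M) ^ n \<le> (2 * \<rho> ^ k) ^ n" by (intro power_mono) auto
  also have "\<dots> = 2 ^ n * (\<rho> ^ n) ^ k" by (simp add: power_mult_distrib power_mult[symmetric] mult.commute)
  also have "\<dots> < \<beta> ^ k" using k rho_beta by (simp add: power_divide pos_less_divide_eq)
  finally obtain b where "(2 ^ M) ^ n < b" "b < \<beta> ^ k" using dense by blast
  then show ?thesis using that k1 M by blast
qed

text \<open>The densities up to tilde Q are not under control, so the two means cannot be compared
  through \<open>avg_nested\<close> alone. An intermediate dyadic dilate P with bounded densities
  helps: if tilde Q lies below P, it is controlled as well; if not, it is also the tilde cube of P,
  and the oscillation condition at P bridges all scales up to it in one step.\<close>

lemma avg_tside_F:
  obtains K where "0 \<le> K" and "\<And>x l. x \<in> S \<Longrightarrow> 0 < l \<Longrightarrow> \<bar>avg x (tside x l) - F x l\<bar> \<le> K"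
proof -
  obtain k M b where kM: "1 \<le> k" "\<rho> ^ k \<le> 2 ^ M" "(2 ^ M) ^ n < b" "b < \<beta> ^ k" by (rule exists_intermediate_base)
  have rM: "\<rho> \<le> 2 ^ M" using kM power_increasing[of 1 k \<rho>] rho_beta by simp
  then have M1: "(1::real) < 2 ^ M" using rho_beta by linarith
  have b0: "0 < b" using kM by (meson less_trans zero_less_numeral zero_less_power)
  obtain K1 where K1: "0 \<le> K1" "\<And>x l. x \<in> S \<Longrightarrow> 0 < l \<Longrightarrow>
     \<exists>J. m x (2^M * ((2^M) ^ J * l)) \<le> b * m x ((2^M) ^ J * l) \<and>
       (\<forall>j<J. b * m x ((2^M) ^ j * l) < m x (2^M * ((2^M) ^ j * l))) \<and> D x l ((2^M) ^ J * l) \<le> K1"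
    using that by (rule exists_doubling_scale[OF M1 kM(3)])
  obtain K2 where K2: "0 \<le> K2" "\<And>x l. x \<in> S \<Longrightarrow> 0 < l \<Longrightarrow> l \<le> hl x l \<and> dbl \<rho> \<beta> x (hl x l) \<and> D x l (hl x l) \<le> K2"
    using that by (rule hl)
  obtain K3 where K3: "0 \<le> K3" "\<And>x l r s B. x \<in> S \<Longrightarrow> 0 < l \<Longrightarrow> l \<le> r \<Longrightarrow> l \<le> s \<Longrightarrow>
     dbl \<rho> \<beta> x r \<Longrightarrow> dbl \<rho> \<beta> x s \<Longrightarrow> D x l r \<le> B \<Longrightarrow> D x l s \<le> B \<Longrightarrow> \<bar>avg x r - avg x s\<bar> \<le> K3 * (1 + B)"
    using that by (rule avg_concentric)
  define K where "K = 2 * Cf * \<beta> + Cf * b + 2 * Cf * \<beta> * b + K3 * (1 + (K1 + K2))"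
  have parts: "0 \<le> 2 * Cf * \<beta>" "0 \<le> Cf * b" "0 \<le> 2 * Cf * \<beta> * b" "0 \<le> K3 * (1 + (K1 + K2))"
    using Cf rho_beta b0 K1 K2 K3 by auto
  show ?thesis
  proof (rule that[of K])
    show "0 \<le> K" using parts by (simp add: K_def)
    fix x l assume a: "x \<in> S" "0 < (l::real)"
    obtain J where J: "m x (2^M * ((2^M) ^ J * l)) \<le> b * m x ((2^M) ^ J * l)" "D x l ((2^M) ^ J * l) \<le> K1"
      using K1(2)[OF a] by blast
    \<comment> \<open>The side of a dilate reached in steps of \<open>2 ^ M\<close>: it lies on the
      dyadic ladder used by tilde, and the densities up to it are bounded.\<close>
    define P where "P = (2^M) ^ J * l"
    have P: "l \<le> P" "0 < P" "m x (2^M * P) \<le> b * m x P" "D x l P \<le> K1" using J a by (auto simp: P_def)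
    have h: "l \<le> hl x l" "dbl \<rho> \<beta> x (hl x l)" "D x l (hl x l) \<le> K2" using K2(2)[OF a] by auto
    have hP: "P \<le> hl x P" "dbl \<rho> \<beta> x (hl x P)" "D x P (hl x P) \<le> K2" using K2(2)[OF a(1) P(2)] by auto
    note t = tside[OF a]
    show "\<bar>avg x (tside x l) - F x l\<bar> \<le> K"
    proof (cases "tside x l \<le> P")
      case True
      have "D x l (tside x l) \<le> K1 + K2" using D_mono[of l l "tside x l" P x] True P K2 a by simp
      moreover have "D x l (hl x l) \<le> K1 + K2" using h K1 by simp
      ultimately have "\<bar>avg x (tside x l) - F x l\<bar> \<le> K3 * (1 + (K1 + K2))" unfolding F_def
        using h t a by (intro K3(2)[of x l]) auto
      then show ?thesis using parts unfolding K_def by linarith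
    next
      case False
      \<comment> \<open>From here on tilde Q is the tilde cube of P, however many scales lie between
        them.\<close>
      have tP: "tside x P = tside x l" unfolding P_def using tside_dyadic[OF a, of "M * J"] False
        by (simp add: P_def power_mult)
      have "\<bar>avg x (hl x P) - F x l\<bar> \<le> K3 * (1 + (K1 + K2))" unfolding F_def
      proof (rule K3(2)[OF a])
        show "D x l (hl x P) \<le> K1 + K2" using D_split[of l P x "hl x P"] P hP a by simp
      qed (use h hP P K1 in auto)
      moreover have "\<bar>avg x (tside x l) - avg x (hl x P)\<bar> \<le> 2 * Cf * \<beta> + Cf * b + 2 * Cf * \<beta> * b"
      proof (cases "P \<le> 1")
        case True
        have mP: "0 < m x P" using m_pos a P by simp
        have "\<bar>avg x P - avg x (tside x l)\<bar> * m x P \<le> Cf * m x (\<eta> * P)"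
          using avg_diff[of x P "avg x (tside x l)"] rbmo_small[of x P] a P True tP by simp
        \<comment> \<open>Since \<eta> <= \<rho> <= 2^M, the \<eta>-dilate of P lies in its
          2^M-dilate, to which the doubling of P applies.\<close>
        also have "\<dots> \<le> Cf * (b * m x P)"
          using m_mono_side[of "\<eta> * P" "2^M * P" x] P eta rM Cf
          by (intro mult_left_mono) (auto intro: order_trans)
        finally have 1: "\<bar>avg x P - avg x (tside x l)\<bar> \<le> Cf * b" using mP by (simp add: mult.assoc[symmetric])
        have le: "hl x P \<le> 2^M * P"
        proof -
          have "\<rho> ^ k * P \<le> 2^M * P" using kM P by simp
          moreover from this have "hl x P \<le> \<rho> ^ k * P" using hl_le[OF a(1) P(2) _ P(3) kM(4)] by blast
          ultimately show ?thesis by simp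
        qed
        have "\<bar>avg x P - avg x (hl x P)\<bar> * m x P \<le> osc (avg x (hl x P)) x (hl x P)"
          using avg_diff[of x P "avg x (hl x P)"] osc_mono[OF cube_set_mono[OF hP(1)], of "avg x (hl x P)" x] a P by simp
        also have "\<dots> \<le> 2 * Cf * \<beta> * m x (hl x P)" using osc_avg[of x "hl x P"] a P hP by simp
        also have "\<dots> \<le> 2 * Cf * \<beta> * (b * m x P)"
          using m_mono_side[OF le, of x] P Cf rho_beta by (intro mult_left_mono) auto
        finally have 2: "\<bar>avg x P - avg x (hl x P)\<bar> \<le> 2 * Cf * \<beta> * b" using mP by (simp add: mult.assoc[symmetric])
        show ?thesis using 1 2 parts by linarith
      next
        case F: False
        \<comment> \<open>Both cubes have side larger than 1 here, where means over doubling cubes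
          are bounded outright.\<close>
        then have "\<bar>avg x (tside x l)\<bar> \<le> Cf * \<beta>" "\<bar>avg x (hl x P)\<bar> \<le> Cf * \<beta>"
          using avg_large[OF a(1) _ t(1)] avg_large[OF a(1) _ hP(2)] False hP by auto
        then show ?thesis using parts by linarith
      qed
      ultimately show ?thesis unfolding K_def by linarith
    qed
  qed
qed

lemma F_large: "x \<in> S \<Longrightarrow> 1 < l \<Longrightarrow> \<bar>F x l\<bar> \<le> Cf * \<beta>"
proof -
  assume "x \<in> S" "1 < l"
  obtain K where "0 \<le> K" "\<And>x l. x \<in> S \<Longrightarrow> 0 < l \<Longrightarrow> l \<le> hl x l \<and> dbl \<rho> \<beta> x (hl x l) \<and> D x l (hl x l) \<le> K"
    using that by (rule hl)
  from this(2)[of x l] \<open>x \<in> S\<close> \<open>1 < l\<close> show ?thesis unfolding F_def by (intro avg_large) auto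
qed

text \<open>The doubling dilates chosen for the two cubes need not be nested. Both are compared with
  a doubling cube around \<open>x\<close> that contains the dilate of the larger cube; by
  \<open>D_shift\<close> the change of centre costs a constant, and only the densities at
  \<open>x\<close> from \<open>l\<close> to \<open>r\<close> remain.\<close>

lemma F_nested:
  obtains K where "0 \<le> K" and "\<And>x y l r. x \<in> S \<Longrightarrow> y \<in> S \<Longrightarrow> 0 < l \<Longrightarrow> l \<le> r \<Longrightarrow> x \<in> cube_set y r \<Longrightarrow>
     \<bar>F x l - F y r\<bar> \<le> K * (1 + D x l r)"
proof -
  obtain K2 where K2: "0 \<le> K2" "\<And>x l. x \<in> S \<Longrightarrow> 0 < l \<Longrightarrow> l \<le> hl x l \<and> dbl \<rho> \<beta> x (hl x l) \<and> D x l (hl x l) \<le> K2"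
    using that by (rule hl)
  obtain K3 where K3: "0 \<le> K3" "\<And>x l r s B. x \<in> S \<Longrightarrow> 0 < l \<Longrightarrow> l \<le> r \<Longrightarrow> l \<le> s \<Longrightarrow>
     dbl \<rho> \<beta> x r \<Longrightarrow> dbl \<rho> \<beta> x s \<Longrightarrow> D x l r \<le> B \<Longrightarrow> D x l s \<le> B \<Longrightarrow> \<bar>avg x r - avg x s\<bar> \<le> K3 * (1 + B)"
    using that by (rule avg_concentric)
  obtain K4 where K4: "0 \<le> K4" "\<And>x y l r. x \<in> S \<Longrightarrow> y \<in> S \<Longrightarrow> 0 < l \<Longrightarrow> cube_set x l \<subseteq> cube_set y r \<Longrightarrow>
     dbl \<rho> \<beta> x l \<Longrightarrow> dbl \<rho> \<beta> y r \<Longrightarrow> \<bar>avg x l - avg y r\<bar> \<le> K4 * (1 + D x l r)" using that by (rule avg_nested)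
  define A where "A = 5 * \<bar>C0\<bar> + 4 ^ n * (K2 + 3 * \<bar>C0\<bar>)"
  define B where "B = 4 ^ n * (K2 + 5 * \<bar>C0\<bar>) + 2 * K2"
  define K where "K = K4 * (1 + A) + K3 * (1 + B)"
  have AB: "0 \<le> A" "0 \<le> B" using K2 by (auto simp: A_def B_def)
  show ?thesis
  proof (rule that[of K])
    show "0 \<le> K" unfolding K_def using AB K3 K4 by auto
    fix x y l r assume a: "x \<in> S" "y \<in> S" "0 < l" "l \<le> r" "x \<in> cube_set y r"
    have r0: "0 < r" using a by simp
    have yx: "y \<in> cube_set x r" using a mem_cube_set_commute by blast
    define s where "s = hl y r"
    \<comment> \<open>Because s >= r, the factor 4 leaves room for the cube of side \<open>s\<close>
      around \<open>y\<close> inside the cube of side \<open>4 * s\<close> around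
      \<open>x\<close>.\<close>
    define t where "t = hl x (4 * s)"
    have s: "r \<le> s" "dbl \<rho> \<beta> y s" "D y r s \<le> K2" using K2(2)[OF a(2) r0] by (auto simp: s_def)
    have s0: "0 < s" using s r0 by simp
    have t: "4 * s \<le> t" "dbl \<rho> \<beta> x t" "D x (4 * s) t \<le> K2" using K2(2)[OF a(1), of "4 * s"] s0 by (auto simp: t_def)
    have C: "C0 = \<bar>C0\<bar>" using C0_pos[OF a(1)] by simp
    have D16: "D y s (16 * s) \<le> 5 * \<bar>C0\<bar>"
    proof -
      have "log 2 (16::real) = 4" using log_pow_cancel[of "2::real" 4] by simp
      then show ?thesis using D_le_log[OF a(2) s0, of "16 * s"] s0 C by simp
    qed
    have D4: "D x t (4 * t) \<le> 3 * \<bar>C0\<bar>"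
    proof -
      have "log 2 (4::real) = 2" using log_pow_cancel[of "2::real" 2] by simp
      then show ?thesis using D_le_log[OF a(1), of t "4 * t"] s0 t C by simp
    qed
    have big: "\<bar>F y r - avg x t\<bar> \<le> K4 * (1 + A)"
    proof -
      have "cube_set y s \<subseteq> cube_set x t" using s s0 t by (intro cube_set_subset[OF yx]) auto
      then have *: "\<bar>F y r - avg x t\<bar> \<le> K4 * (1 + D y s t)" unfolding F_def s_def[symmetric]
        using a s s0 t by (intro K4(2)) auto
      have "D y s t \<le> D y s (16 * s) + D y (16 * s) t" using s0 by (intro D_split) auto
      also have "D y (16 * s) t \<le> 4 ^ n * D x (4 * (16 * s)) (4 * t)"
        using s s0 cube_set_mono[of r "2 * (16 * s)" y] a by (intro D_shift) auto
      also have "D x (4 * (16 * s)) (4 * t) \<le> D x (4 * s) (4 * t)" using s0 by (intro D_mono) auto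
      also have "\<dots> \<le> D x (4 * s) t + D x t (4 * t)" using s0 t by (intro D_split) auto
      also have "\<dots> \<le> K2 + 3 * \<bar>C0\<bar>" using t D4 by simp
      finally have "D y s t \<le> A" using D16 by (simp add: A_def)
      then have "K4 * (1 + D y s t) \<le> K4 * (1 + A)" using K4(1) by (intro mult_left_mono) auto
      then show ?thesis using * by linarith
    qed
    have Dt: "D x l t \<le> D x l r + (4 ^ n * (K2 + 5 * \<bar>C0\<bar>) + K2)"
    proof -
      have "D x l t \<le> D x l r + D x r t" using a by (intro D_split) auto
      also have "D x r t \<le> D x r (4 * s) + D x (4 * s) t" using r0 s by (intro D_split) auto
      also have "D x r (4 * s) \<le> 4 ^ n * D y (4 * r) (4 * (4 * s))"
        using cube_set_mono[of r "2 * r" x] yx r0 by (intro D_shift) auto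
      also have "D y (4 * r) (4 * (4 * s)) \<le> D y r (16 * s)" using r0 by (intro D_mono) auto
      also have "\<dots> \<le> D y r s + D y s (16 * s)" using r0 s by (intro D_split) auto
      also have "\<dots> \<le> K2 + 5 * \<bar>C0\<bar>" using s D16 by simp
      finally show ?thesis using t by simp
    qed
    have h: "l \<le> hl x l" "dbl \<rho> \<beta> x (hl x l)" "D x l (hl x l) \<le> K2" using K2(2)[OF a(1,3)] by auto
    have "\<bar>F x l - avg x t\<bar> \<le> K3 * (1 + (D x l r + B))" unfolding F_def
    proof (rule K3(2)[OF a(1,3)])
      show "D x l t \<le> D x l r + B" using Dt K2(1) by (simp add: B_def)
      have "0 \<le> 4 ^ n * (K2 + 5 * \<bar>C0\<bar>)" using K2 by simp
      then show "D x l (hl x l) \<le> D x l r + B" using h D_nonneg[of x l r] K2(1) unfolding B_def by linarith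
    qed (use h t s a in auto)
    also have "\<dots> \<le> K3 * ((1 + B) * (1 + D x l r))"
      using K3 AB by (intro mult_left_mono) (auto simp: algebra_simps)
    finally have "\<bar>F x l - F y r\<bar> \<le> K4 * (1 + A) + K3 * (1 + B) * (1 + D x l r)" using big by (simp add: mult.assoc)
    also have "K4 * (1 + A) \<le> K4 * (1 + A) * (1 + D x l r)"
      using K4 AB mult_left_mono[of 1 "1 + D x l r" "K4 * (1 + A)"] by simp
    finally show "\<bar>F x l - F y r\<bar> \<le> K * (1 + D x l r)" by (simp add: K_def distrib_right)
  qed
qed

lemma osc_F_eta:
  obtains K where "0 \<le> K" and "\<And>x l. x \<in> S \<Longrightarrow> 0 < l \<Longrightarrow> osc (F x l) x l \<le> K * m x (\<eta> * l)"
proof -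
  obtain K where K: "0 \<le> K" "\<And>x l. x \<in> S \<Longrightarrow> 0 < l \<Longrightarrow> \<bar>avg x (tside x l) - F x l\<bar> \<le> K" using that by (rule avg_tside_F)
  show ?thesis
  proof (rule that[of "Cf + K + Cf * \<beta>"])
    fix x l assume a: "x \<in> S" "0 < (l::real)"
    have mm: "m x l \<le> m x (\<eta> * l)" using eta a by (intro m_mono_side) auto
    \<comment> \<open>The constant about which rbmo controls \<open>f\<close>: the tilde mean for
      side at most 1, and 0 beyond.\<close>
    define d where "d = (if l \<le> 1 then avg x (tside x l) else 0)"
    have d: "osc d x l \<le> Cf * m x (\<eta> * l)" "\<bar>d - F x l\<bar> \<le> K + Cf * \<beta>"
      using rbmo_small[of x l] rbmo_large[of x l] K(2)[OF a] F_large[of x l] a K(1) Cf rho_beta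
      by (auto simp: d_def add_increasing add_increasing2)
    have "osc (F x l) x l \<le> osc d x l + \<bar>d - F x l\<bar> * m x l" by (rule osc_triangle)
    also have "\<dots> \<le> Cf * m x (\<eta> * l) + (K + Cf * \<beta>) * m x (\<eta> * l)"
      using d mm by (intro add_mono mult_mono) auto
    finally show "osc (F x l) x l \<le> (Cf + K + Cf * \<beta>) * m x (\<eta> * l)" by (simp add: algebra_simps)
  qed (use K Cf rho_beta in auto)
qed

text \<open>Atoms are normalised by the mass of the double cube, while \<eta> may exceed 2. The cube
  is therefore covered by boundedly many cubes of side \<open>l / \<eta>\<close> centred in it;
  their \<eta>-dilates have side \<open>l\<close> and lie in its double, and their controlling
  numbers differ from that of the cube by a constant.\<close>

lemma osc_F:
  obtains K where "0 \<le> K" and "\<And>x l. x \<in> S \<Longrightarrow> 0 < l \<Longrightarrow> osc (F x l) x l \<le> K * m x (2 * l)"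
proof -
  obtain K where K: "0 \<le> K" "\<And>x l. x \<in> S \<Longrightarrow> 0 < l \<Longrightarrow> osc (F x l) x l \<le> K * m x (\<eta> * l)" using that by (rule osc_F_eta)
  obtain K2 where K2: "0 \<le> K2" "\<And>x y l r. x \<in> S \<Longrightarrow> y \<in> S \<Longrightarrow> 0 < l \<Longrightarrow> l \<le> r \<Longrightarrow> x \<in> cube_set y r \<Longrightarrow>
     \<bar>F x l - F y r\<bar> \<le> K2 * (1 + D x l r)" using that by (rule F_nested)
  obtain Z :: "'a set" where Z: "finite Z"
    "\<And>x l. 0 \<le> l \<Longrightarrow> cube_set x l \<subseteq> (\<Union>z\<in>Z. cube_set (x + l *\<^sub>R z) (1 / (2 * \<eta>) * l))"
    using unit_cube_net[of "1 / (2 * \<eta>)"] eta by auto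
  define B where "B = K + K2 * (1 + \<bar>C0\<bar> * (1 + log 2 \<eta>))"
  have B0: "0 \<le> B" using K K2 eta by (simp add: B_def)
  show ?thesis
  proof (rule that[of "card Z * B"])
    show "0 \<le> card Z * B" using B0 by simp
    fix x l assume a: "x \<in> S" "0 < (l::real)"
    define c where "c = F x l"
    \<comment> \<open>Cubes have to be centred in the support, so each net cube that meets the
      support inside the given cube is replaced by one centred at such a point. The net cubes have
      side \<open>l / (2 * \<eta>)\<close>, and twice this side makes the recentred cube contain the
      net cube.\<close>
    define Z' where "Z' = {z\<in>Z. cube_set (x + l *\<^sub>R z) (1 / (2 * \<eta>) * l) \<inter> cube_set x l \<inter> S \<noteq> {}}"
    have "\<forall>z\<in>Z'. \<exists>y. y \<in> cube_set (x + l *\<^sub>R z) (1 / (2 * \<eta>) * l) \<and> y \<in> cube_set x l \<and> y \<in> S" by (auto simp: Z'_def)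
    then obtain y where y: "\<And>z. z \<in> Z' \<Longrightarrow> y z \<in> cube_set (x + l *\<^sub>R z) (1 / (2 * \<eta>) * l)"
      "\<And>z. z \<in> Z' \<Longrightarrow> y z \<in> cube_set x l" "\<And>z. z \<in> Z' \<Longrightarrow> y z \<in> S" by metis
    define e where "e = l / \<eta>"
    have e: "0 < e" "e \<le> l" "\<eta> * e = l" "l / e = \<eta>" using a eta by (auto simp: e_def field_simps)
    have small: "osc c (y z) e \<le> B * m x (2 * l)" if z: "z \<in> Z'" for z
    proof -
      have sub: "cube_set (y z) l \<subseteq> cube_set x (2 * l)" using cube_set_subset[OF y(2)[OF z]] by simp
      have "osc c (y z) e \<le> osc (F (y z) e) (y z) e + \<bar>F (y z) e - c\<bar> * m (y z) e" by (rule osc_triangle)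
      also have "osc (F (y z) e) (y z) e \<le> K * m (y z) (\<eta> * e)" using K(2) y(3)[OF z] e by blast
      also have "\<dots> \<le> K * m x (2 * l)" using m_mono[OF sub] K e by (simp add: mult_left_mono)
      also have "\<bar>F (y z) e - c\<bar> * m (y z) e \<le> (K2 * (1 + \<bar>C0\<bar> * (1 + log 2 \<eta>))) * m x (2 * l)"
      proof (intro mult_mono)
        have "\<bar>F (y z) e - c\<bar> \<le> K2 * (1 + D (y z) e l)" unfolding c_def using K2(2) y(2,3)[OF z] a e by blast
        also have "\<dots> \<le> K2 * (1 + \<bar>C0\<bar> * (1 + log 2 \<eta>))"
          using D_le_log[OF y(3)[OF z] e(1,2)] C0_pos[OF a(1)] K2 e by (intro mult_left_mono) auto
        finally show "\<bar>F (y z) e - c\<bar> \<le> K2 * (1 + \<bar>C0\<bar> * (1 + log 2 \<eta>))" .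
        show "m (y z) e \<le> m x (2 * l)" using m_mono[OF sub] m_mono_side[OF e(2), of "y z"] by simp
      qed (use K2 eta in auto)
      finally show ?thesis by (simp add: B_def distrib_right)
    qed
    have cover: "w \<in> (\<Union>z\<in>Z'. cube_set (y z) e)" if w: "w \<in> S" "w \<in> cube_set x l" for w
    proof -
      obtain z where z: "z \<in> Z" "w \<in> cube_set (x + l *\<^sub>R z) (1 / (2 * \<eta>) * l)" using subsetD[OF Z(2)[of l x] w(2)] a(2) by auto
      then have z': "z \<in> Z'" using that by (auto simp: Z'_def)
      have "x + l *\<^sub>R z \<in> cube_set (y z) (1 / (2 * \<eta>) * l)" using y(1)[OF z'] mem_cube_set_commute by blast
      then have "w \<in> cube_set (y z) e" by (rule mem_cube_set_trans[OF z(2)]) (simp add: e_def)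
      then show ?thesis using z' by auto
    qed
    have "ennreal (osc c x l) \<le> (\<integral>\<^sup>+w. (\<Sum>z\<in>Z'. ennreal \<bar>f w - c\<bar> * indicator (cube_set (y z) e) w) \<partial>\<mu>)"
      unfolding osc_nn[symmetric]
    proof (rule nn_integral_mono_AE, use AE_supp in eventually_elim)
      fix w assume w: "w \<in> S"
      show "ennreal \<bar>f w - c\<bar> * indicator (cube_set x l) w \<le> (\<Sum>z\<in>Z'. ennreal \<bar>f w - c\<bar> * indicator (cube_set (y z) e) w)"
      proof (cases "w \<in> cube_set x l")
        case True
        then obtain z where "z \<in> Z'" "w \<in> cube_set (y z) e" using cover w by auto
        then show ?thesis using True Z(1)
          member_le_sum[of z Z' "\<lambda>z. ennreal \<bar>f w - c\<bar> * indicator (cube_set (y z) e) w"] by (simp add: Z'_def)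
      qed simp
    qed
    also have "\<dots> = (\<Sum>z\<in>Z'. \<integral>\<^sup>+w. ennreal \<bar>f w - c\<bar> * indicator (cube_set (y z) e) w \<partial>\<mu>)"
      by (intro nn_integral_sum) measurable
    also have "\<dots> = (\<Sum>z\<in>Z'. ennreal (osc c (y z) e))" by (simp add: osc_nn)
    also have "\<dots> = ennreal (\<Sum>z\<in>Z'. osc c (y z) e)" using osc_nonneg by (intro sum_ennreal)
    finally have "osc c x l \<le> (\<Sum>z\<in>Z'. osc c (y z) e)" using osc_nonneg by (simp add: sum_nonneg)
    also have "\<dots> \<le> card Z' * (B * m x (2 * l))" using sum_bounded_above[of Z', OF small] by simp
    also have "\<dots> \<le> card Z * (B * m x (2 * l))" using card_mono[OF Z(1), of Z'] B0
      by (intro mult_right_mono) (auto simp: Z'_def)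
    finally show "osc (F x l) x l \<le> card Z * B * m x (2 * l)" by (simp add: c_def mult.assoc)
  qed
qed

lemma Whole_bounds:
  assumes "emeasure \<mu> UNIV < \<infinity>"
  shows "(\<integral>\<^sup>+x. ennreal \<bar>f x\<bar> \<partial>\<mu>) \<le> ennreal Cf * emeasure \<mu> UNIV" and "\<bar>mean \<mu> f Whole\<bar> \<le> Cf"
proof -
  have M: "emeasure \<mu> UNIV = ennreal (measure \<mu> UNIV)" using assms by (simp add: emeasure_eq_ennreal_measure)
  have "(\<integral>\<^sup>+x\<in>cset Whole. ennreal \<bar>f x\<bar> \<partial>\<mu>) / emeasure \<mu> (cset (dilate \<eta> Whole)) \<le> ennreal Cf"
  proof -
    have "is_cube \<mu> Whole \<and> 1 < side Whole" using assms by simp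
    then show ?thesis using Cf(2) unfolding rbmo_bound_def by blast
  qed
  then have q: "(\<integral>\<^sup>+x. ennreal \<bar>f x\<bar> \<partial>\<mu>) / ennreal (measure \<mu> UNIV) \<le> ennreal Cf" by (simp add: M)
  show 1: "(\<integral>\<^sup>+x. ennreal \<bar>f x\<bar> \<partial>\<mu>) \<le> ennreal Cf * emeasure \<mu> UNIV"
  proof (cases "measure \<mu> UNIV = 0")
    case True
    then have "AE x in \<mu>. False" using M by (intro AE_I[of _ _ UNIV]) auto
    then have "(\<integral>\<^sup>+x. ennreal \<bar>f x\<bar> \<partial>\<mu>) = (\<integral>\<^sup>+x. 0 \<partial>\<mu>)" by (intro nn_integral_cong_AE) auto
    then show ?thesis by simp
  next
    case False
    then have mp: "0 < measure \<mu> UNIV" using measure_nonneg[of \<mu> UNIV] by linarith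
    have "(\<integral>\<^sup>+x. ennreal \<bar>f x\<bar> \<partial>\<mu>) = (\<integral>\<^sup>+x. ennreal \<bar>f x\<bar> \<partial>\<mu>) / ennreal (measure \<mu> UNIV) * ennreal (measure \<mu> UNIV)"
      using mp by (simp add: ennreal_divide_times ennreal_mult_divide_eq)
    also have "\<dots> \<le> ennreal Cf * ennreal (measure \<mu> UNIV)" by (intro mult_right_mono q) simp
    finally show ?thesis unfolding M .
  qed
  show "\<bar>mean \<mu> f Whole\<bar> \<le> Cf"
  \<comment> \<open>If the total mass is 0, the quotient defining the mean is 0 by
    convention.\<close>
  proof (cases "measure \<mu> UNIV = 0")
    case False
    then have mp: "0 < measure \<mu> UNIV" using measure_nonneg[of \<mu> UNIV] by linarith
    have "ennreal \<bar>LINT x|\<mu>. f x\<bar> \<le> (\<integral>\<^sup>+x. ennreal \<bar>f x\<bar> \<partial>\<mu>)"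
      using integral_norm_bound_ennreal[of \<mu> f] 
      by (cases "integrable \<mu> f") (auto simp: not_integrable_integral_eq)
    also have "\<dots> \<le> ennreal (Cf * measure \<mu> UNIV)" using 1 Cf by (simp add: M ennreal_mult)
    finally have "\<bar>LINT x|\<mu>. f x\<bar> \<le> Cf * measure \<mu> UNIV" using Cf by simp
    then show ?thesis using mp by (simp add: mean_def set_lebesgue_integral_def abs_divide pos_divide_le_eq)
  qed (simp add: mean_def Cf)
qed

end

section \<open>A John--Nirenberg inequality\<close>

text \<open>The Vitali lemma yields a countable family, whereas the sums over disjoint cubes are
  estimated for finite subfamilies; continuity from below connects the two.\<close>

lemma emeasure_countable_UN_le:
  assumes "countable C" "\<And>p. p \<in> C \<Longrightarrow> A p \<in> sets M"
    and "\<And>C'. finite C' \<Longrightarrow> C' \<subseteq> C \<Longrightarrow> (\<Sum>p\<in>C'. emeasure M (A p)) \<le> B"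
  shows "emeasure M (\<Union>p\<in>C. A p) \<le> B"
proof (cases "C = {}")
  case False
  define U where "U i = (\<Union>p\<in>from_nat_into C ` {..i}. A p)" for i
  have sub: "from_nat_into C ` {..i} \<subseteq> C" for i using from_nat_into[OF False] by auto
  have "(\<Union>p\<in>C. A p) = (\<Union>i. U i)"
  proof (intro equalityI subsetI)
    fix x assume "x \<in> (\<Union>p\<in>C. A p)"
    then obtain p where p: "p \<in> C" "x \<in> A p" by blast
    then obtain i where "p = from_nat_into C i" using subset_range_from_nat_into[OF assms(1)] by blast
    then have "x \<in> U i" unfolding U_def using p(2) by blast
    then show "x \<in> (\<Union>i. U i)" by blast
  next
    fix x assume "x \<in> (\<Union>i. U i)"
    then show "x \<in> (\<Union>p\<in>C. A p)" unfolding U_def using sub by blast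
  qed
  moreover have "emeasure M (\<Union>i. U i) = (SUP i. emeasure M (U i))"
  proof (rule SUP_emeasure_incseq[symmetric])
    show "range U \<subseteq> sets M" unfolding U_def using sub assms(2) by (auto intro!: sets.finite_UN)
    show "incseq U" unfolding U_def incseq_def by fastforce
  qed
  moreover have "emeasure M (U i) \<le> B" for i
  proof -
    have "emeasure M (U i) \<le> (\<Sum>p\<in>from_nat_into C ` {..i}. emeasure M (A p))"
      unfolding U_def using sub assms(2) by (intro emeasure_subadditive_finite) auto
    also have "\<dots> \<le> B" using sub by (intro assms(3)) auto
    finally show ?thesis .
  qed
  ultimately show ?thesis by (simp add: SUP_le_iff)
qed simp

context rbmo_function
begin

text \<open>The factor is 4 * 5 * DIM. A cube of side \<open>l\<close> lies in a ball of radius DIM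
  * l / 2, the Vitali enlargement multiplies by 5, and the bound in \<open>emeasure_Eset\<close>
  involves a cube of four times the side. With this value doubling absorbs the inductive bound on an
  enlarged stopped cube.\<close>

definition ag :: real where "ag = 20 * real DIM('a)"

text \<open>A constant larger than \<open>ag ^ n\<close>, as \<open>exists_doubling_scale\<close>
  demands.\<close>

definition bg :: real where "bg = 2 * ag ^ n"

lemma ag: "20 \<le> ag"
  using DIM_positive[where 'a='a] by (simp add: ag_def Suc_le_eq)

text \<open>All estimates on the controlling numbers under one constant, so that it can be chosen
  once and for all.\<close>

definition control :: "real \<Rightarrow> bool" where
  "control K \<longleftrightarrow> 0 \<le> K \<and>
     (\<forall>x\<in>S. \<forall>l>0. osc (F x l) x l \<le> K * m x (2 * l)) \<and>
     (\<forall>x\<in>S. \<forall>y\<in>S. \<forall>l r. 0 < l \<and> l \<le> r \<and> x \<in> cube_set y r \<longrightarrow> \<bar>F x l - F y r\<bar> \<le> K * (1 + D x l r)) \<and>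
     (\<forall>x\<in>S. \<forall>l>1. \<bar>F x l\<bar> \<le> K) \<and>
     (\<forall>x\<in>S. \<forall>l>0. \<bar>avg x (tside x l) - F x l\<bar> \<le> K) \<and>
     (\<forall>x\<in>S. \<forall>l>0. \<exists>r\<ge>l. dbl ag bg x r \<and> D x l r \<le> K)"

lemma ex_control: "\<exists>K. control K"
proof -
  obtain K1 where K1: "0 \<le> K1" "\<And>x l. x \<in> S \<Longrightarrow> 0 < l \<Longrightarrow> osc (F x l) x l \<le> K1 * m x (2 * l)"
    using that by (rule osc_F)
  obtain K2 where K2: "0 \<le> K2" "\<And>x y l r. x \<in> S \<Longrightarrow> y \<in> S \<Longrightarrow> 0 < l \<Longrightarrow> l \<le> r \<Longrightarrow> x \<in> cube_set y r \<Longrightarrow>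
     \<bar>F x l - F y r\<bar> \<le> K2 * (1 + D x l r)" using that by (rule F_nested)
  obtain K3 where K3: "0 \<le> K3" "\<And>x l. x \<in> S \<Longrightarrow> 0 < l \<Longrightarrow> \<bar>avg x (tside x l) - F x l\<bar> \<le> K3"
    using that by (rule avg_tside_F)
  have ag1: "1 < ag" "ag ^ n < bg" using ag by (auto simp: bg_def)
  obtain K4 where K4: "0 \<le> K4" "\<And>x l. x \<in> S \<Longrightarrow> 0 < l \<Longrightarrow>
     \<exists>J. m x (ag * (ag ^ J * l)) \<le> bg * m x (ag ^ J * l) \<and>
       (\<forall>j<J. bg * m x (ag ^ j * l) < m x (ag * (ag ^ j * l))) \<and> D x l (ag ^ J * l) \<le> K4"
    using that by (rule exists_doubling_scale[OF ag1])
  define K where "K = K1 + K2 + K3 + K4 + Cf * \<beta>"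
  have CB: "0 \<le> Cf * \<beta>" using Cf rho_beta by simp
  have le: "K1 \<le> K" "K2 \<le> K" "K3 \<le> K" "K4 \<le> K" "Cf * \<beta> \<le> K" "0 \<le> K"
    unfolding K_def using K1(1) K2(1) K3(1) K4(1) CB by linarith+
  have "control K" unfolding control_def
  proof (intro conjI ballI allI impI)
    show "0 \<le> K" by (rule le)
    show "osc (F x l) x l \<le> K * m x (2 * l)" if "x \<in> S" "0 < l" for x l
      using K1(2)[OF that] mult_right_mono[OF le(1), of "m x (2 * l)"] by simp
    show "\<bar>F x l - F y r\<bar> \<le> K * (1 + D x l r)" if "x \<in> S" "y \<in> S" "0 < l \<and> l \<le> r \<and> x \<in> cube_set y r" for x y l r
    proof -
      have "\<bar>F x l - F y r\<bar> \<le> K2 * (1 + D x l r)" using K2(2) that by blast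
      also have "\<dots> \<le> K * (1 + D x l r)" using le(2) by (intro mult_right_mono) auto
      finally show ?thesis .
    qed
    show "\<bar>F x l\<bar> \<le> K" if "x \<in> S" "1 < l" for x l using F_large[OF that] le(5) by simp
    show "\<bar>avg x (tside x l) - F x l\<bar> \<le> K" if "x \<in> S" "0 < l" for x l using K3(2)[OF that] le(3) by simp
    fix x l assume a: "x \<in> S" "0 < (l::real)"
    obtain J where J: "dbl ag bg x (ag ^ J * l)" "D x l (ag ^ J * l) \<le> K4" using K4(2)[OF a] unfolding dbl_def by blast
    have "1 \<le> ag ^ J" by (rule one_le_power) (use ag in linarith)
    then have "1 * l \<le> ag ^ J * l" using a by (intro mult_right_mono) auto
    then show "\<exists>r\<ge>l. dbl ag bg x r \<and> D x l r \<le> K" using J le(4) by (intro exI[of _ "ag ^ J * l"]) auto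
  qed
  then show ?thesis ..
qed

definition KF :: real where "KF = (SOME K. control K)"

lemma KF:
  shows KF_nonneg: "0 \<le> KF"
    and F_osc: "\<And>x l. x \<in> S \<Longrightarrow> 0 < l \<Longrightarrow> osc (F x l) x l \<le> KF * m x (2 * l)"
    and F_diff: "\<And>x y l r. x \<in> S \<Longrightarrow> y \<in> S \<Longrightarrow> 0 < l \<Longrightarrow> l \<le> r \<Longrightarrow> x \<in> cube_set y r \<Longrightarrow>
       \<bar>F x l - F y r\<bar> \<le> KF * (1 + D x l r)"
    and F_big: "\<And>x l. x \<in> S \<Longrightarrow> 1 < l \<Longrightarrow> \<bar>F x l\<bar> \<le> KF"
    and F_tilde: "\<And>x l. x \<in> S \<Longrightarrow> 0 < l \<Longrightarrow> \<bar>avg x (tside x l) - F x l\<bar> \<le> KF"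
    and good_scale: "\<And>x l. x \<in> S \<Longrightarrow> 0 < l \<Longrightarrow> \<exists>r\<ge>l. dbl ag bg x r \<and> D x l r \<le> KF"
proof -
  have "control KF" unfolding KF_def using ex_control by (rule someI_ex)
  then show "0 \<le> KF"
    and "\<And>x l. x \<in> S \<Longrightarrow> 0 < l \<Longrightarrow> osc (F x l) x l \<le> KF * m x (2 * l)"
    and "\<And>x y l r. x \<in> S \<Longrightarrow> y \<in> S \<Longrightarrow> 0 < l \<Longrightarrow> l \<le> r \<Longrightarrow> x \<in> cube_set y r \<Longrightarrow>
       \<bar>F x l - F y r\<bar> \<le> KF * (1 + D x l r)"
    and "\<And>x l. x \<in> S \<Longrightarrow> 1 < l \<Longrightarrow> \<bar>F x l\<bar> \<le> KF"
    and "\<And>x l. x \<in> S \<Longrightarrow> 0 < l \<Longrightarrow> \<bar>avg x (tside x l) - F x l\<bar> \<le> KF"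
    and "\<And>x l. x \<in> S \<Longrightarrow> 0 < l \<Longrightarrow> \<exists>r\<ge>l. dbl ag bg x r \<and> D x l r \<le> KF"
    unfolding control_def by blast+
qed

section \<open>Stopped cubes and the decay of level sets\<close>

lemma abs_diff_le_osc: "\<bar>a - b\<bar> * m x l \<le> osc a x l + osc b x l"
proof -
  have "ennreal (\<bar>a - b\<bar> * m x l) = (\<integral>\<^sup>+y\<in>cube_set x l. ennreal \<bar>a - b\<bar> \<partial>\<mu>)"
    by (simp add: nn_integral_cmult_indicator emeasure_cube ennreal_mult)
  also have "\<dots> \<le> (\<integral>\<^sup>+y. ennreal \<bar>f y - a\<bar> * indicator (cube_set x l) y + ennreal \<bar>f y - b\<bar> * indicator (cube_set x l) y \<partial>\<mu>)"
    by (intro nn_integral_mono) (auto simp: indicator_def simp flip: ennreal_plus)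
  also have "\<dots> = ennreal (osc a x l) + ennreal (osc b x l)"
    unfolding osc_nn[symmetric] by (intro nn_integral_add) measurable
  finally show ?thesis using osc_nonneg by (simp add: add_nonneg_nonneg flip: ennreal_plus)
qed

lemma osc_disjoint:
  assumes "finite C" "disjoint_family_on (\<lambda>p. cube_set (fst p) (snd p)) C"
    "\<And>p. p \<in> C \<Longrightarrow> cube_set (fst p) (snd p) \<subseteq> cube_set z L"
  shows "(\<Sum>p\<in>C. osc c (fst p) (snd p)) \<le> osc c z L"
proof -
  have "ennreal (\<Sum>p\<in>C. osc c (fst p) (snd p)) = (\<Sum>p\<in>C. ennreal (osc c (fst p) (snd p)))"
    using osc_nonneg by (intro sum_ennreal[symmetric])
  also have "\<dots> = (\<integral>\<^sup>+y. (\<Sum>p\<in>C. ennreal \<bar>f y - c\<bar> * indicator (cube_set (fst p) (snd p)) y) \<partial>\<mu>)"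
    unfolding osc_nn[symmetric] by (intro nn_integral_sum[symmetric]) measurable
  also have "\<dots> \<le> (\<integral>\<^sup>+y\<in>cube_set z L. ennreal \<bar>f y - c\<bar> \<partial>\<mu>)"
  proof (rule nn_integral_mono)
    fix y
    show "(\<Sum>p\<in>C. ennreal \<bar>f y - c\<bar> * indicator (cube_set (fst p) (snd p)) y) \<le> ennreal \<bar>f y - c\<bar> * indicator (cube_set z L) y"
    proof (cases "\<exists>p\<in>C. y \<in> cube_set (fst p) (snd p)")
      case True
      then obtain p where p: "p \<in> C" "y \<in> cube_set (fst p) (snd p)" by blast
      have "(\<Sum>q\<in>C. ennreal \<bar>f y - c\<bar> * indicator (cube_set (fst q) (snd q)) y)
          = (\<Sum>q\<in>C. if q = p then ennreal \<bar>f y - c\<bar> else 0)"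
        using p assms(2) by (intro sum.cong refl) (auto simp: disjoint_family_on_def indicator_def)
      also have "\<dots> = ennreal \<bar>f y - c\<bar>" using p assms(1) by simp
      finally show ?thesis using p assms(3)[OF p(1)] by (auto simp: indicator_def)
    qed (auto simp: indicator_def intro!: sum.neutral)
  qed
  finally show ?thesis using osc_nonneg[of c z L] unfolding osc_nn by simp
qed

text \<open>The uncountable union is taken over interiors, so it is open and hence measurable. Only
  good doubling cubes enter, because the masses of their enlargements have to be bounded.\<close>

definition Eset :: "real \<Rightarrow> 'a \<Rightarrow> real \<Rightarrow> 'a set" where
  "Eset t z L = (\<Union>p\<in>{(x, l). x \<in> S \<and> 0 < l \<and> l \<le> L \<and> dbl ag bg x l \<and> x \<in> cube_set z L \<and> t < \<bar>F x l - F z L\<bar>}.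
     interior (cube_set (fst p) (snd p)))"

lemma open_Eset: "open (Eset t z L)" unfolding Eset_def by (intro open_UN) auto

lemma Eset_sets [measurable]: "Eset t z L \<in> sets borel" by (simp add: open_Eset)

lemma F_concentric: assumes "x \<in> S" "0 < l" "1 \<le> c" shows "\<bar>F x l - F x (c * l)\<bar> \<le> KF * (1 + \<bar>C0\<bar> * (1 + log 2 c))"
proof -
  have "l \<le> c * l" using assms by simp
  then have "\<bar>F x l - F x (c * l)\<bar> \<le> KF * (1 + D x l (c * l))"
    using assms by (intro F_diff) (auto intro: center_mem_cube_set)
  also have "\<dots> \<le> KF * (1 + \<bar>C0\<bar> * (1 + log 2 c))"
    using D_le_log[of x l "c * l"] C0_pos[OF assms(1)] assms \<open>l \<le> c * l\<close> by (intro mult_left_mono KF_nonneg) auto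
  finally show ?thesis .
qed

text \<open>The step width of the level sets: the exceptional cubes are stopped at oscillation \<open>lam0\<close>, and the value
  at a stopped cube and at its Vitali enlargement is at most \<open>lamJN\<close> away from the value at the initial cube.\<close>

definition "C1 = KF * (1 + (\<bar>C0\<bar> * (1 + log 2 ag) + KF))"
definition "C3 = KF * (2 + 2 * \<bar>C0\<bar>)"
text \<open>Origin of the terms: \<open>2 * KF * bg\<close> lets the oscillation on a doubling cube
  be absorbed by half of the jump, \<open>4 * bg * C3\<close> makes the stopped cubes carry at most
  the fraction \<open>1 / (2 * bg)\<close> of the mass, and 1 keeps the value positive.\<close>

definition "lam0 = 2 * KF * bg + 4 * bg * C3 + 1"
definition "lamJN = lam0 + 2 * C1"

lemma lam: "0 \<le> C1" "0 \<le> C3" "0 < lam0" "lam0 \<le> lamJN" "0 < lamJN" "0 < bg"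
proof -
  have l: "0 \<le> log 2 ag" using ag by simp
  show b: "0 < bg" using ag by (simp add: bg_def)
  show 1: "0 \<le> C1" "0 \<le> C3" unfolding C1_def C3_def using KF_nonneg l by auto
  have "0 \<le> 2 * KF * bg" "0 \<le> 4 * bg * C3" using b 1 KF_nonneg by auto
  then show "0 < lam0" unfolding lam0_def by linarith
  then show "lam0 \<le> lamJN" "0 < lamJN" unfolding lamJN_def using 1 by auto
qed

text \<open>At bounded density cost above the stopped cube there is a good cube of side at least
  \<open>ag * l > 2 * l\<close>, whose value is within \<open>lam0\<close> by near-maximality. If
  that cube is already longer than \<open>L\<close>, the densities from \<open>l\<close> to
  \<open>L\<close> are bounded and the two values are directly comparable.\<close>

lemma stopped_cube:
  assumes z: "z \<in> S" "0 < L" and x: "x \<in> S" "0 < l" "l \<le> L" "x \<in> cube_set z L"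
    and max: "\<And>r. 2 * l < r \<Longrightarrow> r \<le> L \<Longrightarrow> dbl ag bg x r \<Longrightarrow> \<bar>F x r - F z L\<bar> \<le> lam0"
  shows "\<bar>F x l - F z L\<bar> \<le> lam0 + C1"
proof -
  have al: "0 < ag * l" "2 * l < ag * l" "l \<le> ag * l" using ag x by auto
  obtain r where r: "ag * l \<le> r" "dbl ag bg x r" "D x (ag * l) r \<le> KF" using good_scale[OF x(1) al(1)] by blast
  have "D x l r \<le> D x l (ag * l) + D x (ag * l) r" using x al by (intro D_split) auto
  also have "D x l (ag * l) \<le> \<bar>C0\<bar> * (1 + log 2 ag)"
    using D_le_log[OF x(1,2) al(3)] C0_pos[OF x(1)] x by simp
  finally have Dr: "D x l r \<le> \<bar>C0\<bar> * (1 + log 2 ag) + KF" using r by simp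
  have lr: "l \<le> r" using al r by linarith
  show ?thesis
  proof (cases "r \<le> L")
    case True
    have "\<bar>F x l - F x r\<bar> \<le> KF * (1 + D x l r)" using x lr by (intro F_diff center_mem_cube_set) auto
    also have "\<dots> \<le> C1" unfolding C1_def using Dr by (intro mult_left_mono KF_nonneg) auto
    finally have "\<bar>F x l - F x r\<bar> \<le> C1" .
    moreover have "\<bar>F x r - F z L\<bar> \<le> lam0" using True r al by (intro max) auto
    ultimately show ?thesis by linarith
  next
    case False
    have "\<bar>F x l - F z L\<bar> \<le> KF * (1 + D x l L)" using x z by (intro F_diff) auto
    also have "\<dots> \<le> C1" unfolding C1_def
      using Dr False D_mono[of l l L r x] x by (intro mult_left_mono KF_nonneg) auto
    finally show ?thesis using lam by linarith
  qed
qed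

text \<open>The supremum of the admissible sides need not be attained; a side above half of it
  serves as well.\<close>

lemma near_maximal:
  assumes P: "P l" and b: "\<forall>r. P r \<longrightarrow> r \<le> (L::real)" and l: "0 < l"
  obtains r where "P r" "l \<le> r" "\<And>r'. 2 * r < r' \<Longrightarrow> \<not> P r'"
proof -
  define T where "T = {r. P r \<and> l \<le> r}"
  have T: "l \<in> T" "bdd_above T" using P b by (auto simp: T_def bdd_above_def)
  have "l \<le> Sup T" using T by (rule cSup_upper)
  then have "Sup T / 2 < Sup T" using l by simp
  then obtain r where r: "r \<in> T" "Sup T / 2 < r" using less_cSup_iff[of T "Sup T / 2"] T by blast
  have "\<not> P r'" if "2 * r < r'" for r'
  proof
    assume "P r'"
    then have "r' \<in> T" using that r l by (auto simp: T_def)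
    then have "r' \<le> Sup T" using T by (intro cSup_upper)
    then show False using that r by linarith
  qed
  then show ?thesis using that r by (auto simp: T_def)
qed

text \<open>On a stopped cube \<open>f\<close> is close to \<open>F x l\<close> on average because
  the cube is doubling, but \<open>F x l\<close> is far from \<open>F z L\<close>; so
  \<open>f\<close> deviates from \<open>F z L\<close> by at least \<open>lam0 / 2\<close> on
  average. The cubes are disjoint and lie in the double of the initial cube, where the total
  oscillation is at most \<open>C3 * m z (4 * L)\<close>.\<close>

lemma sum_stopped:
  assumes z: "z \<in> S" "0 < L" and C: "finite C" "disjoint_family_on (\<lambda>p. cube_set (fst p) (snd p)) C"
    and C': "\<And>x l. (x, l) \<in> C \<Longrightarrow> x \<in> S \<and> 0 < l \<and> l \<le> L \<and> dbl ag bg x l \<and> x \<in> cube_set z L \<and> lam0 < \<bar>F x l - F z L\<bar>"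
  shows "2 * bg * (\<Sum>p\<in>C. m (fst p) (snd p)) \<le> m z (4 * L)"
proof -
  have "osc (F z L) z (2 * L) \<le> C3 * m z (4 * L)"
  proof -
    have "osc (F z L) z (2 * L) \<le> osc (F z (2 * L)) z (2 * L) + \<bar>F z (2 * L) - F z L\<bar> * m z (2 * L)" by (rule osc_triangle)
    also have "\<dots> \<le> KF * m z (4 * L) + KF * (1 + 2 * \<bar>C0\<bar>) * m z (4 * L)"
    proof (intro add_mono mult_mono)
      show "osc (F z (2 * L)) z (2 * L) \<le> KF * m z (4 * L)" using F_osc[of z "2 * L"] z by simp
      show "\<bar>F z (2 * L) - F z L\<bar> \<le> KF * (1 + 2 * \<bar>C0\<bar>)" using F_concentric[OF z, of 2] by (simp add: abs_minus_commute mult.commute)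
      show "m z (2 * L) \<le> m z (4 * L)" using z by (intro m_mono_side) auto
    qed (use KF_nonneg in auto)
    also have "\<dots> = C3 * m z (4 * L)" by (simp add: C3_def algebra_simps)
    finally show ?thesis .
  qed
  moreover have "lam0 / 2 * (\<Sum>p\<in>C. m (fst p) (snd p)) \<le> osc (F z L) z (2 * L)"
  proof -
    have "lam0 / 2 * (\<Sum>p\<in>C. m (fst p) (snd p)) \<le> (\<Sum>p\<in>C. osc (F z L) (fst p) (snd p))"
      unfolding sum_distrib_left
    proof (rule sum_mono)
      fix p assume "p \<in> C"
      then obtain x l where p: "p = (x, l)" "x \<in> S" "0 < l" "dbl ag bg x l" "lam0 < \<bar>F x l - F z L\<bar>"
        using C' by (cases p) auto
      have "lam0 * m x l \<le> \<bar>F x l - F z L\<bar> * m x l" using p by (intro mult_right_mono) auto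
      also have "\<dots> \<le> osc (F x l) x l + osc (F z L) x l" by (rule abs_diff_le_osc)
      also have "osc (F x l) x l \<le> KF * m x (2 * l)" using p by (intro F_osc)
      also have "\<dots> \<le> KF * (bg * m x l)"
        using p m_mono_side[of "2 * l" "ag * l" x] ag by (intro mult_left_mono KF_nonneg) (auto simp: dbl_def)
      also have "\<dots> \<le> lam0 / 2 * m x l"
      proof -
        have "0 \<le> 4 * bg * C3" using lam by simp
        then have "KF * bg \<le> lam0 / 2" unfolding lam0_def by simp
        then show ?thesis using mult_right_mono[of "KF * bg" "lam0 / 2" "m x l"] by (simp add: mult.assoc)
      qed
      finally show "lam0 / 2 * m (fst p) (snd p) \<le> osc (F z L) (fst p) (snd p)" by (simp add: p)
    qed
    also have "\<dots> \<le> osc (F z L) z (2 * L)"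
      using C' by (intro osc_disjoint C cube_set_subset[where r=L]) auto
    finally show ?thesis .
  qed
  ultimately have *: "lam0 / 2 * (\<Sum>p\<in>C. m (fst p) (snd p)) \<le> C3 * m z (4 * L)" by linarith
  show ?thesis
  \<comment> \<open>The final division by \<open>C3\<close> is impossible when it vanishes; the
    stopped cubes then have total mass 0.\<close>
  proof (cases "C3 = 0")
    case True
    have "0 \<le> (\<Sum>p\<in>C. m (fst p) (snd p))" by (intro sum_nonneg) simp
    moreover have "lam0 / 2 * (\<Sum>p\<in>C. m (fst p) (snd p)) \<le> 0" using * True by simp
    ultimately have "(\<Sum>p\<in>C. m (fst p) (snd p)) = 0" using lam(3) by (simp add: mult_le_0_iff)
    then show ?thesis by simp
  next
    case False
    have "4 * bg * C3 \<le> lam0" unfolding lam0_def using KF_nonneg lam by simp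
    then have "4 * bg * C3 / 2 * (\<Sum>p\<in>C. m (fst p) (snd p)) \<le> lam0 / 2 * (\<Sum>p\<in>C. m (fst p) (snd p))"
      by (intro mult_right_mono sum_nonneg) auto
    then have "C3 * (2 * bg * (\<Sum>p\<in>C. m (fst p) (snd p))) \<le> C3 * m z (4 * L)" using * by (simp add: algebra_simps)
    then show ?thesis using False lam(2) by (simp add: mult_le_cancel_left)
  qed
qed

text \<open>Each step of the threshold halves the mass. A point of the next level set lies in a
  level-k set of the Vitali enlargement of some stopped cube. By induction and doubling, the mass of
  the latter set is at most \<open>(1/2) ^ k * bg\<close> times that of the stopped cube, and
  \<open>sum_stopped\<close> bounds the total.\<close>

lemma emeasure_Eset:
  assumes "z \<in> S" "0 < L"
  shows "emeasure \<mu> (Eset (real k * lamJN) z L) \<le> ennreal ((1/2) ^ k * m z (4 * L))"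
  using assms
proof (induction k arbitrary: z L)
  case 0
  have "Eset (real 0 * lamJN) z L \<subseteq> cube_set z (2 * L)" unfolding Eset_def
  proof (rule UN_least, safe)
    fix x l w assume "w \<in> interior (cube_set (fst (x, l)) (snd (x, l)))" "l \<le> L" "x \<in> cube_set z L"
    then show "w \<in> cube_set z (2 * L)" using cube_set_subset[of x z L l "2 * L"] interior_subset[of "cube_set x l"] by auto
  qed
  also have "\<dots> \<subseteq> cube_set z (4 * L)" using 0 by (intro cube_set_mono) auto
  finally have "emeasure \<mu> (Eset (real 0 * lamJN) z L) \<le> emeasure \<mu> (cube_set z (4 * L))" by (intro emeasure_mono) auto
  then show ?case by (simp add: emeasure_cube)
next
  case (Suc k)
  note zL = Suc.prems
  define d where "d = real DIM('a)"
  have d: "1 \<le> d" "ag = 20 * d" using DIM_positive[where 'a='a] by (auto simp: d_def ag_def Suc_le_eq)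
  define \<F> where "\<F> = {(x, l). x \<in> S \<and> 0 < l \<and> l \<le> L \<and> dbl ag bg x l \<and> x \<in> cube_set z L \<and> lam0 < \<bar>F x l - F z L\<bar>}"
  \<comment> \<open>For each centre only those sides are kept that have no admissible side beyond
    their double. The balls of radius \<open>d * l / 2\<close> used for the covering contain the
    cubes.\<close>
  define P where "P = {(x, l). (x, l) \<in> \<F> \<and> (\<forall>r. 2 * l < r \<longrightarrow> (x, r) \<notin> \<F>)}"
  have P_ball: "0 < d * snd p / 2 \<and> d * snd p / 2 \<le> d * L / 2" if "p \<in> P" for p
    using that d by (auto simp: P_def \<F>_def)
  obtain C where C: "countable C" "C \<subseteq> P"
      "pairwise (\<lambda>p q. disjnt (cball (fst p) (d * snd p / 2)) (cball (fst q) (d * snd q / 2))) C"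
      "\<And>p. p \<in> P \<Longrightarrow> \<exists>q. q \<in> C \<and> \<not> disjnt (cball (fst p) (d * snd p / 2)) (cball (fst q) (d * snd q / 2)) \<and>
         cball (fst p) (d * snd p / 2) \<subseteq> ball (fst q) (5 * (d * snd q / 2))"
    using Vitali_covering_lemma_cballs_balls[of P "\<lambda>p. d * snd p / 2" "d * L / 2" fst, OF P_ball] by blast
  have CF: "x \<in> S \<and> 0 < l \<and> l \<le> L \<and> dbl ag bg x l \<and> x \<in> cube_set z L \<and> lam0 < \<bar>F x l - F z L\<bar>"
    if "(x, l) \<in> C" for x l using that C(2) by (auto simp: P_def \<F>_def)
  have disj: "disjoint_family_on (\<lambda>p. cube_set (fst p) (snd p)) C"
    unfolding disjoint_family_on_def
  proof (intro ballI impI)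
    fix p q assume "p \<in> C" "q \<in> C" "p \<noteq> q"
    then have "disjnt (cball (fst p) (d * snd p / 2)) (cball (fst q) (d * snd q / 2))" using C(3) by (auto simp: pairwise_def)
    then show "cube_set (fst p) (snd p) \<inter> cube_set (fst q) (snd q) = {}"
      using cube_set_subset_cball[of "fst p" "snd p"] cube_set_subset_cball[of "fst q" "snd q"]
      unfolding disjnt_def d_def by blast
  qed
  have sub: "Eset (real (Suc k) * lamJN) z L \<subseteq> (\<Union>q\<in>C. Eset (real k * lamJN) (fst q) (5 * d * snd q))"
  proof
    fix y assume "y \<in> Eset (real (Suc k) * lamJN) z L"
    then obtain x l where xl: "x \<in> S" "0 < l" "l \<le> L" "dbl ag bg x l" "x \<in> cube_set z L"
      "real (Suc k) * lamJN < \<bar>F x l - F z L\<bar>" "y \<in> interior (cube_set x l)" by (auto simp: Eset_def)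
    have "lamJN \<le> real (Suc k) * lamJN" using lam by simp
    then have "lam0 < \<bar>F x l - F z L\<bar>" using xl(6) lam(4) by linarith
    then have xlF: "(x, l) \<in> \<F>" using xl by (auto simp: \<F>_def)
    have FL: "\<forall>r. (x, r) \<in> \<F> \<longrightarrow> r \<le> L" by (auto simp: \<F>_def)
    obtain r where r: "(x, r) \<in> \<F>" "l \<le> r" "\<And>r'. 2 * r < r' \<Longrightarrow> (x, r') \<notin> \<F>"
      using that by (rule near_maximal[of "\<lambda>r. (x, r) \<in> \<F>" l L, OF xlF FL xl(2)])
    then have "(x, r) \<in> P" by (auto simp: P_def)
    then obtain w s where ws: "(w, s) \<in> C" "cball x (d * r / 2) \<subseteq> ball w (5 * (d * s / 2))" using C(4)[of "(x, r)"] by force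
    have w: "w \<in> S" "0 < s" "s \<le> L" "w \<in> cube_set z L" using CF[OF ws(1)] by auto
    have "cube_set x r \<subseteq> cball x (d * r / 2)" unfolding d_def by (rule cube_set_subset_cball)
    also have "\<dots> \<subseteq> cball w (5 * (d * s / 2))" using ws(2) by auto
    also have "\<dots> \<subseteq> cube_set w (5 * d * s)" using cball_subset_cube_set[of w "5 * (d * s / 2)"] by (simp add: mult.assoc)
    finally have in5: "x \<in> cube_set w (5 * d * s)" "r \<le> 5 * d * s"
      using cube_set_subsetD[of x r w "5 * d * s"] xl r by auto
    have "(w, s) \<in> P" using C(2) ws by blast
    then have "\<bar>F w s - F z L\<bar> \<le> lam0 + C1"
      using w by (intro stopped_cube zL) (auto simp: P_def \<F>_def not_less)
    moreover have "\<bar>F w s - F w (5 * d * s)\<bar> \<le> C1"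
    proof -
      have "\<bar>F w s - F w (5 * d * s)\<bar> \<le> KF * (1 + \<bar>C0\<bar> * (1 + log 2 (5 * d)))" using w d by (intro F_concentric) auto
      also have "\<dots> \<le> KF * (1 + \<bar>C0\<bar> * (1 + log 2 ag))"
        using d by (intro mult_left_mono add_mono KF_nonneg) auto
      also have "\<dots> \<le> C1" unfolding C1_def using KF_nonneg by (intro mult_left_mono) auto
      finally show ?thesis .
    qed
    \<comment> \<open>One \<open>lamJN\<close> of the threshold pays for the passage from the
      initial cube to the enlarged stopped cube; the other \<open>k\<close> remain for the level set
      there.\<close>
    ultimately have "\<bar>F w (5 * d * s) - F z L\<bar> \<le> lamJN" unfolding lamJN_def by linarith
    then have "real k * lamJN < \<bar>F x l - F w (5 * d * s)\<bar>" using xl(6) by (simp add: distrib_right)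
    then have "y \<in> Eset (real k * lamJN) w (5 * d * s)"
      unfolding Eset_def using xl in5 r by (intro UN_I[of "(x, l)"]) auto
    then show "y \<in> (\<Union>q\<in>C. Eset (real k * lamJN) (fst q) (5 * d * snd q))" using ws(1) by force
  qed
  have "emeasure \<mu> (\<Union>q\<in>C. Eset (real k * lamJN) (fst q) (5 * d * snd q)) \<le> ennreal ((1/2) ^ Suc k * m z (4 * L))"
  proof (rule emeasure_countable_UN_le[OF C(1)])
    show "Eset (real k * lamJN) (fst p) (5 * d * snd p) \<in> sets \<mu>" for p by simp
    fix C' assume C': "finite C'" "C' \<subseteq> C"
    have "(\<Sum>p\<in>C'. emeasure \<mu> (Eset (real k * lamJN) (fst p) (5 * d * snd p)))
        \<le> (\<Sum>p\<in>C'. ennreal ((1/2) ^ k * (bg * m (fst p) (snd p))))"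
    proof (rule sum_mono)
      fix p assume "p \<in> C'"
      then obtain x l where p: "p = (x, l)" "(x, l) \<in> C" using C' by (cases p) auto
      have xl: "x \<in> S" "0 < l" "dbl ag bg x l" using CF[OF p(2)] by auto
      have "emeasure \<mu> (Eset (real k * lamJN) x (5 * d * l)) \<le> ennreal ((1/2) ^ k * m x (4 * (5 * d * l)))"
        using xl d by (intro Suc.IH) auto
      also have "m x (4 * (5 * d * l)) = m x (ag * l)" by (simp add: d mult.assoc)
      also have "ennreal ((1/2) ^ k * m x (ag * l)) \<le> ennreal ((1/2) ^ k * (bg * m x l))"
        using xl(3) by (intro ennreal_leI mult_left_mono) (auto simp: dbl_def)
      finally show "emeasure \<mu> (Eset (real k * lamJN) (fst p) (5 * d * snd p)) \<le> ennreal ((1/2) ^ k * (bg * m (fst p) (snd p)))"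
        by (simp add: p)
    qed
    also have "\<dots> = ennreal (\<Sum>p\<in>C'. (1/2) ^ k * (bg * m (fst p) (snd p)))" using lam by (intro sum_ennreal) auto
    also have "(\<Sum>p\<in>C'. (1/2) ^ k * (bg * m (fst p) (snd p))) = (1/2) ^ Suc k * (2 * bg * (\<Sum>p\<in>C'. m (fst p) (snd p)))"
      by (simp add: sum_distrib_left)
    also have "ennreal \<dots> \<le> ennreal ((1/2) ^ Suc k * m z (4 * L))"
    proof (intro ennreal_leI mult_left_mono sum_stopped[OF zL C'(1)])
      show "disjoint_family_on (\<lambda>p. cube_set (fst p) (snd p)) C'" using disj C'(2) by (rule disjoint_family_on_mono[rotated])
    qed (use CF C'(2) in auto)
    finally show "(\<Sum>p\<in>C'. emeasure \<mu> (Eset (real k * lamJN) (fst p) (5 * d * snd p))) \<le> ennreal ((1/2) ^ Suc k * m z (4 * L))" .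
  qed
  moreover have "(\<Union>q\<in>C. Eset (real k * lamJN) (fst q) (5 * d * snd q)) \<in> sets \<mu>"
    by (simp add: open_Eset open_UN)
  ultimately show ?case using emeasure_mono[OF sub] by (meson order_trans)
qed

text \<open>A maximal function of the controlling numbers; it plays the role of \<open>|f|\<close> itself but needs no
  differentiation theorem.\<close>

definition G :: "'a \<Rightarrow> ennreal" where
  "G x = (SUP p\<in>{(y, l). y \<in> S \<and> 0 < l \<and> dbl ag bg y l \<and> x \<in> interior (cube_set y l)}. ennreal \<bar>F (fst p) (snd p)\<bar>)"

lemma less_G_iff: "t < G x \<longleftrightarrow> (\<exists>y l. y \<in> S \<and> 0 < l \<and> dbl ag bg y l \<and> x \<in> interior (cube_set y l) \<and> t < ennreal \<bar>F y l\<bar>)"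
  by (auto simp: G_def less_SUP_iff)

text \<open>The cubes enter through their interiors, so the set where \<open>G\<close> exceeds a
  value is open.\<close>

lemma G_measurable [measurable]: "G \<in> borel_measurable borel"
proof (rule borel_measurableI_greater)
  fix t
  have "{x. t < G x} = (\<Union>p\<in>{(y, l). y \<in> S \<and> 0 < l \<and> dbl ag bg y l \<and> t < ennreal \<bar>F y l\<bar>}. interior (cube_set (fst p) (snd p)))"
    unfolding less_G_iff by fastforce
  also have "open \<dots>" by (intro open_UN) auto
  finally show "{x \<in> space borel. t < G x} \<in> sets borel" by simp
qed

definition "KG = KF * (1 + (2 * \<bar>C0\<bar> + KF))"

text \<open>An arbitrary cube is enlarged to a good doubling one at bounded density cost. Starting
  from the double puts every point of the original closed cube into the interior.\<close>

lemma F_le_G: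
  assumes "y \<in> S" "0 < r" "x \<in> cube_set y r"
  shows "ennreal \<bar>F y r\<bar> \<le> G x + ennreal KG"
proof -
  obtain l where l: "2 * r \<le> l" "dbl ag bg y l" "D y (2 * r) l \<le> KF" using good_scale[of y "2 * r"] assms by auto
  have "x \<in> interior (cube_set y l)"
  proof -
    have "x \<in> box (y - (l / 2) *\<^sub>R One) (y + (l / 2) *\<^sub>R One)" unfolding mem_box
    proof
      fix b :: 'a assume b: "b \<in> Basis"
      have "\<bar>(x - y) \<bullet> b\<bar> \<le> r / 2" using assms b by (auto simp: mem_cube_set)
      then show "(y - (l / 2) *\<^sub>R One) \<bullet> b < x \<bullet> b \<and> x \<bullet> b < (y + (l / 2) *\<^sub>R One) \<bullet> b"
        unfolding inner_diff_left inner_add_left inner_scaleR_left inner_One[OF b] using l(1) assms(2) by arith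
    qed
    then show ?thesis by (simp add: cube_set_def interior_cbox)
  qed
  then have "ennreal \<bar>F y l\<bar> \<le> G x" unfolding G_def using assms l by (intro SUP_upper2[of "(y, l)"]) auto
  moreover have "\<bar>F y r - F y l\<bar> \<le> KG"
  proof -
    have "\<bar>F y r - F y l\<bar> \<le> KF * (1 + D y r l)" using assms l by (intro F_diff center_mem_cube_set) auto
    also have "D y r l \<le> D y r (2 * r) + D y (2 * r) l" using assms by (intro D_split) auto
    also have "D y r (2 * r) \<le> 2 * \<bar>C0\<bar>" using D_le_log[of y r "2 * r"] assms C0_pos[of y] by simp
    finally have "\<bar>F y r - F y l\<bar> \<le> KF * (1 + (2 * \<bar>C0\<bar> + D y (2 * r) l))" using KF_nonneg by (simp add: mult_left_mono)
    also have "\<dots> \<le> KG" unfolding KG_def using l KF_nonneg by (intro mult_left_mono) auto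
    finally show ?thesis .
  qed
  then have "ennreal \<bar>F y r\<bar> \<le> ennreal (\<bar>F y l\<bar> + KG)" by (intro ennreal_leI) linarith
  then have "ennreal \<bar>F y r\<bar> \<le> ennreal \<bar>F y l\<bar> + ennreal KG"
    using KF_nonneg ennreal_plus[of "\<bar>F y l\<bar>" KG] by (simp add: KG_def)
  ultimately show ?thesis by (meson add_right_mono order_trans)
qed

text \<open>Cubes of side above 1 have values at most \<open>KF\<close>, and so has the cube of side
  4 around \<open>z\<close>. A point of the level set therefore comes from a small cube, and
  subtracting the value at \<open>z\<close> gives a level of \<open>Eset\<close>; this explains the
  offset \<open>2 * KF\<close>.\<close>

lemma emeasure_G_level:
  assumes "z \<in> S" "z \<in> cube_set j 1"
  shows "emeasure \<mu> ({x. ennreal (2 * KF + real k * lamJN) < G x} \<inter> cube_set j 1) \<le> ennreal ((1/2) ^ k * (\<bar>C0\<bar> * 16 ^ n))"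
proof -
  have "{x. ennreal (2 * KF + real k * lamJN) < G x} \<inter> cube_set j 1 \<subseteq> Eset (real k * lamJN) z 4"
  proof safe
    fix x assume x: "ennreal (2 * KF + real k * lamJN) < G x" "x \<in> cube_set j 1"
    obtain y l where yl: "y \<in> S" "0 < l" "dbl ag bg y l" "x \<in> interior (cube_set y l)"
      "ennreal (2 * KF + real k * lamJN) < ennreal \<bar>F y l\<bar>" using x(1) by (auto simp: less_G_iff)
    have kl: "0 \<le> real k * lamJN" using lam by simp
    have big: "2 * KF + real k * lamJN < \<bar>F y l\<bar>" using yl(5) KF_nonneg kl by (subst (asm) ennreal_less_iff) auto
    have l1: "l \<le> 1"
    proof (rule ccontr)
      assume "\<not> l \<le> 1"
      then have "\<bar>F y l\<bar> \<le> KF" using yl by (intro F_big) auto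
      then show False using big kl KF_nonneg by linarith
    qed
    have F4: "\<bar>F z 4\<bar> \<le> KF" using assms by (intro F_big) auto
    have "x \<in> cube_set y l" using yl(4) interior_subset by blast
    then have "y \<in> cube_set x l" using mem_cube_set_commute by blast
    moreover have "x \<in> cube_set z 2" using x(2) assms(2) mem_cube_set_commute[of z j 1] mem_cube_set_trans[of x j 1 z 1 2] by auto
    ultimately have "y \<in> cube_set z 4" using l1 by (intro mem_cube_set_trans[of y x l z 2 4]) auto
    then show "x \<in> Eset (real k * lamJN) z 4" unfolding Eset_def
      using yl l1 big F4 by (intro UN_I[of "(y, l)"]) auto
  qed
  then have "emeasure \<mu> ({x. ennreal (2 * KF + real k * lamJN) < G x} \<inter> cube_set j 1) \<le> emeasure \<mu> (Eset (real k * lamJN) z 4)"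
    by (intro emeasure_mono) auto
  also have "\<dots> \<le> ennreal ((1/2) ^ k * m z (4 * 4))" using assms by (intro emeasure_Eset) auto
  also have "\<dots> \<le> ennreal ((1/2) ^ k * (\<bar>C0\<bar> * 16 ^ n))"
    using m_le[OF assms(1), of 16] C0_pos[OF assms(1)] by (intro ennreal_leI mult_left_mono) auto
  finally show ?thesis .
qed

lemma AE_G_finite: "AE x in \<mu>. x \<in> cube_set j 1 \<longrightarrow> G x < \<infinity>"
proof (cases "cube_set j 1 \<inter> S = {}")
  case True
  show ?thesis using AE_supp by eventually_elim (use True in auto)
next
  case False
  then obtain z where z: "z \<in> S" "z \<in> cube_set j 1" by blast
  define N where "N = {x. G x = \<infinity>} \<inter> cube_set j 1"
  have N: "N \<in> sets \<mu>" unfolding N_def by measurable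
  have le: "emeasure \<mu> N \<le> ennreal ((1/2) ^ k * (\<bar>C0\<bar> * 16 ^ n))" for k
  proof -
    have "emeasure \<mu> N \<le> emeasure \<mu> ({x. ennreal (2 * KF + real k * lamJN) < G x} \<inter> cube_set j 1)"
      unfolding N_def by (intro emeasure_mono) auto
    then show ?thesis using emeasure_G_level[OF z, of k] by (meson order_trans)
  qed
  have "(\<lambda>k. ennreal ((1/2) ^ k * (\<bar>C0\<bar> * 16 ^ n))) \<longlonglongrightarrow> ennreal (0 * (\<bar>C0\<bar> * 16 ^ n))"
    by (intro tendsto_ennrealI tendsto_mult_right LIMSEQ_power_zero) auto
  then have "emeasure \<mu> N \<le> ennreal (0 * (\<bar>C0\<bar> * 16 ^ n))" using le by (intro LIMSEQ_le_const) auto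
  then have "N \<in> null_sets \<mu>" using N by (simp add: null_sets_def)
  from AE_not_in[OF this] show ?thesis
  proof eventually_elim
    fix x assume "x \<notin> N"
    then show "x \<in> cube_set j 1 \<longrightarrow> G x < \<infinity>" unfolding N_def infinity_ennreal_def
      using less_top[of "G x"] by blast
  qed
qed

text \<open>With this exponent one step \<open>lamJN\<close> multiplies the exponential by 3/2 while
  the bound for the level sets shrinks by 1/2; the product 3/4 gives a convergent geometric
  series.\<close>

definition "cG = ln (3/2) / lamJN"

lemma cG_pos: "0 < cG" using lam by (simp add: cG_def)

lemma exp_G_integral:
  obtains K where "0 \<le> K" "\<And>j. (\<integral>\<^sup>+x\<in>cube_set j 1. ennreal (exp (cG * enn2real (G x))) \<partial>\<mu>) \<le> ennreal K"
proof -
  define B where "B = \<bar>C0\<bar> * 16 ^ n"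
  define E where "E = exp (cG * (2 * KF))"
  have B0: "0 \<le> B" by (simp add: B_def)
  define A where "A k = {x. ennreal (2 * KF + real k * lamJN) < G x}" for k :: nat
  have A: "A k \<in> sets borel" for k unfolding A_def by measurable
  have lamc: "cG * lamJN = ln (3/2)" using lam by (simp add: cG_def)
  have pt: "ennreal (exp (cG * enn2real (G x))) \<le> ennreal E * (1 + (\<Sum>k. ennreal ((3/2) ^ Suc k) * indicator (A k) x))"
    if Gx: "G x < \<infinity>" for x
  proof -
    obtain t where t: "G x = ennreal t" "0 \<le> t" using Gx by (cases "G x") auto
    show ?thesis
    proof (cases "t \<le> 2 * KF")
      case True
      have "exp (cG * t) \<le> E" using True cG_pos by (simp add: E_def)
      then have "ennreal (exp (cG * enn2real (G x))) \<le> ennreal E * 1" using t by (simp add: ennreal_leI)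
      also have "\<dots> \<le> ennreal E * (1 + (\<Sum>k. ennreal ((3/2) ^ Suc k) * indicator (A k) x))" by (intro mult_left_mono) auto
      finally show ?thesis .
    next
      case False
      \<comment> \<open>The level with
        \<open>2 * KF + k * lamJN < t <= 2 * KF + (k + 1) * lamJN\<close>. The upper end of this
        interval is why the weights carry the exponent \<open>Suc k\<close>.\<close>
      define k where "k = nat (\<lceil>(t - 2 * KF) / lamJN\<rceil> - 1)"
      have q: "0 < (t - 2 * KF) / lamJN" using False lam by simp
      have k: "real k < (t - 2 * KF) / lamJN" "(t - 2 * KF) / lamJN \<le> real (Suc k)" using q unfolding k_def by linarith+
      then have k': "2 * KF + real k * lamJN < t" "t \<le> 2 * KF + real (Suc k) * lamJN"
        using lam(5) by (simp_all add: pos_less_divide_eq pos_divide_le_eq del: of_nat_Suc)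
      have xA: "x \<in> A k" unfolding A_def mem_Collect_eq t(1) using k'(1) False KF_nonneg by (intro ennreal_lessI) auto
      have "exp (cG * t) \<le> exp (cG * (2 * KF) + real (Suc k) * (cG * lamJN))"
        using k'(2) cG_pos mult_left_mono[of t "2 * KF + real (Suc k) * lamJN" cG] by (simp add: algebra_simps)
      also have "\<dots> = E * (3/2) ^ Suc k" unfolding lamc exp_add exp_of_nat_mult by (simp add: E_def)
      finally have "ennreal (exp (cG * enn2real (G x))) \<le> ennreal E * ennreal ((3/2) ^ Suc k)"
        using t by (simp add: ennreal_leI E_def flip: ennreal_mult del: power_Suc)
      also have "\<dots> \<le> ennreal E * (1 + (\<Sum>k. ennreal ((3/2) ^ Suc k) * indicator (A k) x))"
      proof (intro mult_left_mono)
        have "ennreal ((3/2) ^ Suc k) = (\<Sum>k\<in>{k}. ennreal ((3/2) ^ Suc k) * indicator (A k) x)" using xA by simp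
        also have "\<dots> \<le> (\<Sum>k. ennreal ((3/2) ^ Suc k) * indicator (A k) x)" by (intro sum_le_suminf) auto
        finally show "ennreal ((3/2) ^ Suc k) \<le> 1 + (\<Sum>k. ennreal ((3/2) ^ Suc k) * indicator (A k) x)"
          by (simp add: add_increasing)
      qed simp
      finally show ?thesis .
    qed
  qed
  show ?thesis
  proof (rule that[of "E * (\<bar>C0\<bar> * 2 ^ n + 6 * B)"])
    show "0 \<le> E * (\<bar>C0\<bar> * 2 ^ n + 6 * B)" using B0 by (simp add: E_def)
    fix j :: 'a
    show "(\<integral>\<^sup>+x\<in>cube_set j 1. ennreal (exp (cG * enn2real (G x))) \<partial>\<mu>) \<le> ennreal (E * (\<bar>C0\<bar> * 2 ^ n + 6 * B))"
    proof (cases "cube_set j 1 \<inter> S = {}")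
      case True
      have "(\<integral>\<^sup>+x\<in>cube_set j 1. ennreal (exp (cG * enn2real (G x))) \<partial>\<mu>) = (\<integral>\<^sup>+x. 0 \<partial>\<mu>)"
      proof (rule nn_integral_cong_AE, use AE_supp in eventually_elim)
        fix x assume "x \<in> S"
        then show "ennreal (exp (cG * enn2real (G x))) * indicator (cube_set j 1) x = 0" using True by (auto simp: indicator_def)
      qed
      then show ?thesis by simp
    next
      case False
      then obtain z where z: "z \<in> S" "z \<in> cube_set j 1" by blast
      have sub: "cube_set j 1 \<subseteq> cube_set z 2" using z mem_cube_set_commute by (intro cube_set_subset[of j z 1]) auto
      have "(\<integral>\<^sup>+x\<in>cube_set j 1. ennreal (exp (cG * enn2real (G x))) \<partial>\<mu>)
        \<le> (\<integral>\<^sup>+x. ennreal E * (indicator (cube_set j 1) x + (\<Sum>k. ennreal ((3/2) ^ Suc k) * indicator (A k \<inter> cube_set j 1) x)) \<partial>\<mu>)"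
      proof (rule nn_integral_mono_AE, use AE_G_finite[of j] in eventually_elim)
        fix x assume *: "x \<in> cube_set j 1 \<longrightarrow> G x < \<infinity>"
        show "ennreal (exp (cG * enn2real (G x))) * indicator (cube_set j 1) x
          \<le> ennreal E * (indicator (cube_set j 1) x + (\<Sum>k. ennreal ((3/2) ^ Suc k) * indicator (A k \<inter> cube_set j 1) x))"
          using pt[of x] * by (cases "x \<in> cube_set j 1") (simp_all add: indicator_inter_arith)
      qed
      also have "\<dots> = ennreal E * (emeasure \<mu> (cube_set j 1) + (\<Sum>k. ennreal ((3/2) ^ Suc k) * emeasure \<mu> (A k \<inter> cube_set j 1)))"
        using A by (simp add: nn_integral_cmult nn_integral_add nn_integral_suminf nn_integral_cmult_indicator)
      also have "\<dots> \<le> ennreal E * (ennreal (\<bar>C0\<bar> * 2 ^ n) + (\<Sum>k. ennreal (3/2 * B * (3/4) ^ k)))"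
      proof (intro mult_left_mono add_mono suminf_le)
        have "emeasure \<mu> (cube_set j 1) \<le> emeasure \<mu> (cube_set z 2)" using sub by (intro emeasure_mono) auto
        also have "\<dots> \<le> ennreal (\<bar>C0\<bar> * 2 ^ n)" unfolding emeasure_cube
          using m_le[OF z(1), of 2] C0_pos[OF z(1)] by (intro ennreal_leI) auto
        finally show "emeasure \<mu> (cube_set j 1) \<le> ennreal (\<bar>C0\<bar> * 2 ^ n)" .
        fix k
        have "ennreal ((3/2) ^ Suc k) * emeasure \<mu> (A k \<inter> cube_set j 1) \<le> ennreal ((3/2) ^ Suc k) * ennreal ((1/2) ^ k * B)"
          using emeasure_G_level[OF z, of k] unfolding A_def B_def by (intro mult_left_mono) auto
        also have "\<dots> = ennreal ((3/2) ^ Suc k * ((1/2) ^ k * B))" using B0 by (intro ennreal_mult[symmetric]) auto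
        also have "(3/2) ^ Suc k * ((1/2) ^ k * B) = 3/2 * B * (3/4) ^ k"
          using power_mult_distrib[of "3/2::real" "1/2" k] by simp
        finally show "ennreal ((3/2) ^ Suc k) * emeasure \<mu> (A k \<inter> cube_set j 1) \<le> ennreal (3/2 * B * (3/4) ^ k)" .
      qed auto
      also have "(\<Sum>k. ennreal (3/2 * B * (3/4) ^ k)) = ennreal (6 * B)"
      proof -
        have "(\<lambda>k. (3/4::real) ^ k) sums (1 / (1 - 3/4))" by (rule geometric_sums) simp
        from sums_mult[OF this, of "3/2 * B"] have "(\<lambda>k. 3/2 * B * (3/4) ^ k) sums (6 * B)" by simp
        then show ?thesis using B0 by (intro suminf_ennreal_eq) auto
      qed
      also have "ennreal E * (ennreal (\<bar>C0\<bar> * 2 ^ n) + ennreal (6 * B)) = ennreal (E * (\<bar>C0\<bar> * 2 ^ n + 6 * B))"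
        using B0 by (simp add: E_def flip: ennreal_plus ennreal_mult)
      finally show ?thesis .
    qed
  qed
qed

end

section \<open>Orlicz norms of products\<close>

abbreviation wp_log :: "real \<Rightarrow> real" where "wp_log \<equiv> \<lambda>t. t / ln (exp 1 + t)"

text \<open>If t <= ln (e + u), the logarithm in the denominator absorbs \<open>t\<close> and leaves
  \<open>s\<close>; otherwise \<open>u\<close> itself is below e^t - 1. Taking any u <= s t builds
  the needed monotonicity into the statement.\<close>

lemma wp_log_young:
  assumes "0 \<le> u" "u \<le> s * t" "0 \<le> s" "0 \<le> t"
  shows "wp_log u \<le> s + (exp t - 1)"
proof -
  have "exp 1 \<le> exp 1 + u" using assms by simp
  then have "ln (exp 1) \<le> ln (exp 1 + u)" by (subst ln_le_cancel_iff) (auto simp: add_pos_nonneg assms)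
  then have L: "1 \<le> ln (exp 1 + u)" by simp
  show ?thesis
  proof (cases "t \<le> ln (exp 1 + u)")
    case True
    have "u \<le> s * ln (exp 1 + u)" using assms(2) mult_left_mono[OF True assms(3)] by linarith
    then have "wp_log u \<le> s" using L by (simp add: pos_divide_le_eq)
    moreover have "0 \<le> exp t - 1" using assms by simp
    ultimately show ?thesis by linarith
  next
    case False
    then have "exp (ln (exp 1 + u)) < exp t" by simp
    then have "exp 1 + u < exp t" using assms by (simp add: add_pos_nonneg)
    moreover have "(1::real) \<le> exp 1" by simp
    moreover have "wp_log u \<le> u" using L assms mult_left_mono[OF L, of u] by (simp add: pos_divide_le_eq)
    ultimately show ?thesis using assms by linarith
  qed
qed

text \<open>Convexity of the exponential between 0 and \<open>y\<close>. A small \<theta> in the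
  exponent makes an exponential integral as small as desired.\<close>

lemma exp_scaled_le: assumes "0 \<le> \<theta>" "\<theta> \<le> 1" shows "exp (\<theta> * y) - 1 \<le> \<theta> * exp (y::real)"
proof -
  have "exp ((1 - \<theta>) *\<^sub>R 0 + \<theta> *\<^sub>R y) \<le> (1 - \<theta>) * exp 0 + \<theta> * exp y"
    using exp_convex assms by (intro convex_onD) auto
  then show ?thesis using assms by simp
qed

text \<open>\<open>wp_log_young\<close> is applied with s = \<Phi> / (2 a) and t = \<theta> c W,
  where \<open>a\<close> is slightly larger than the integral of \<Phi>. The first term then
  integrates to at most 1/2, and the second to at most \<theta> B = 1/2 by
  \<open>exp_scaled_le\<close>; solving for the Orlicz parameter gives the constant 4 B / c.\<close>

lemma orlicz_norm_product:
  fixes W :: "'a::euclidean_space \<Rightarrow> real" and \<Phi> g :: "'a \<Rightarrow> ennreal"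
  assumes E[measurable]: "E \<in> sets \<mu>" and W[measurable]: "W \<in> borel_measurable \<mu>" and W0: "\<And>x. 0 \<le> W x"
    and P[measurable]: "\<Phi> \<in> borel_measurable \<mu>"
    and c: "0 < c" and B: "1 \<le> B" and expW: "(\<integral>\<^sup>+x\<in>E. ennreal (exp (c * W x)) \<partial>\<mu>) \<le> ennreal B"
    and g: "AE x in \<mu>. x \<in> E \<longrightarrow> g x \<le> ennreal (W x) * \<Phi> x"
  shows "orlicz_norm \<mu> wp_log E g \<le> ennreal (4 * B / c) * (\<integral>\<^sup>+x\<in>E. \<Phi> x \<partial>\<mu>)"
proof (cases "(\<integral>\<^sup>+x\<in>E. \<Phi> x \<partial>\<mu>) = \<infinity>")
  case True
  then show ?thesis using c B by (simp add: ennreal_mult_top)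
next
  case False
  then obtain a0 where a0: "(\<integral>\<^sup>+x\<in>E. \<Phi> x \<partial>\<mu>) = ennreal a0" "0 \<le> a0" by (cases "\<integral>\<^sup>+x\<in>E. \<Phi> x \<partial>\<mu>") auto
  define \<theta> where "\<theta> = 1 / (2 * B)"
  have th: "0 < \<theta>" "\<theta> \<le> 1" "\<theta> * B = 1/2" using B by (auto simp: \<theta>_def)
  have fin: "AE x in \<mu>. \<Phi> x * indicator E x \<noteq> \<infinity>" using False by (intro nn_integral_noteq_infinite) auto
  \<comment> \<open>A number strictly above the integral keeps the Orlicz parameter positive even
    when the integral is 0.\<close>
  have adm: "orlicz_norm \<mu> wp_log E g \<le> ennreal (4 * B / c * a)" if a: "a0 < a" for a
  proof -
    have ap: "0 < a" using a a0 by simp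
    define k where "k = 4 * B / c * a"
    have k: "0 < k" using ap c B by (simp add: k_def)
    have k2: "k = 2 * a / (\<theta> * c)" using B c by (simp add: k_def \<theta>_def)
    have "(\<integral>\<^sup>+x\<in>E. ext_orlicz wp_log (g x / ennreal k) \<partial>\<mu>)
      \<le> (\<integral>\<^sup>+x. ennreal (1 / (2 * a)) * (\<Phi> x * indicator E x) + ennreal \<theta> * (ennreal (exp (c * W x)) * indicator E x) \<partial>\<mu>)"
    proof (rule nn_integral_mono_AE, use g fin in eventually_elim)
      fix x assume gx: "x \<in> E \<longrightarrow> g x \<le> ennreal (W x) * \<Phi> x" and fx: "\<Phi> x * indicator E x \<noteq> \<infinity>"
      show "ext_orlicz wp_log (g x / ennreal k) * indicator E x
        \<le> ennreal (1 / (2 * a)) * (\<Phi> x * indicator E x) + ennreal \<theta> * (ennreal (exp (c * W x)) * indicator E x)"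
      proof (cases "x \<in> E")
        case True
        then obtain p where p: "\<Phi> x = ennreal p" "0 \<le> p" using fx by (cases "\<Phi> x") auto
        have gle: "g x \<le> ennreal (W x * p)" using gx True p W0 by (simp add: ennreal_mult)
        then have "g x \<noteq> top" by (auto simp: top_unique)
        then obtain q where q: "g x = ennreal q" "0 \<le> q" by (cases "g x") auto
        have qle: "q \<le> W x * p" using gle q p W0 by simp
        have "g x / ennreal k = ennreal (q / k)" using q k by (simp add: divide_ennreal)
        then have e: "ext_orlicz wp_log (g x / ennreal k) = ennreal (wp_log (q / k))"
          using q k by (simp add: ext_orlicz_def)
        have "q / k \<le> (W x * p) / k" using qle k by (simp add: divide_right_mono)
        also have "\<dots> = p / (2 * a) * (\<theta> * (c * W x))" unfolding k2 using th(1) c ap by (simp add: field_simps)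
        finally have "wp_log (q / k) \<le> p / (2 * a) + (exp (\<theta> * (c * W x)) - 1)"
          using q k p ap th c W0 by (intro wp_log_young) auto
        also have "\<dots> \<le> p / (2 * a) + \<theta> * exp (c * W x)" using exp_scaled_le[of \<theta> "c * W x"] th by simp
        finally have "ennreal (wp_log (q / k)) \<le> ennreal (p / (2 * a) + \<theta> * exp (c * W x))" by (rule ennreal_leI)
        also have "\<dots> = ennreal (1 / (2 * a)) * ennreal p + ennreal \<theta> * ennreal (exp (c * W x))"
          using p ap th by (simp add: ennreal_mult[symmetric] flip: ennreal_plus)
        finally show ?thesis using True e p by simp
      qed simp
    qed
    also have "\<dots> = ennreal (1 / (2 * a)) * ennreal a0 + ennreal \<theta> * (\<integral>\<^sup>+x\<in>E. ennreal (exp (c * W x)) \<partial>\<mu>)"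
      by (simp add: nn_integral_add nn_integral_cmult a0)
    also have "\<dots> \<le> ennreal (1 / (2 * a)) * ennreal a + ennreal \<theta> * ennreal B"
      using a expW by (intro add_mono mult_left_mono ennreal_leI) auto
    also have "ennreal (1 / (2 * a)) * ennreal a = ennreal (1 / (2 * a) * a)"
      using ap by (intro ennreal_mult[symmetric]) auto
    also have "ennreal \<theta> * ennreal B = ennreal (\<theta> * B)" using th B by (intro ennreal_mult[symmetric]) auto
    also have "ennreal (1 / (2 * a) * a) + ennreal (\<theta> * B) = ennreal (1 / (2 * a) * a + \<theta> * B)"
      using ap th B by (intro ennreal_plus[symmetric]) auto
    also have "1 / (2 * a) * a + \<theta> * B = 1" using ap th by simp
    also have "ennreal 1 = 1" by simp
    finally have "(\<integral>\<^sup>+x\<in>E. ext_orlicz wp_log (g x / ennreal k) \<partial>\<mu>) \<le> 1" .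
    then have "orlicz_norm \<mu> wp_log E g \<le> ennreal k" unfolding orlicz_norm_def using k by (intro INF_lower) auto
    then show ?thesis by (simp add: k_def)
  qed
  have "orlicz_norm \<mu> wp_log E g \<le> ennreal (4 * B / c * a0)"
  proof (rule ennreal_le_epsilon)
    fix e :: real assume e: "0 < e"
    have "orlicz_norm \<mu> wp_log E g \<le> ennreal (4 * B / c * (a0 + e * c / (4 * B)))" using e c B by (intro adm) simp
    also have "4 * B / c * (a0 + e * c / (4 * B)) = 4 * B / c * a0 + e" using c B by (simp add: field_simps)
    finally show "orlicz_norm \<mu> wp_log E g \<le> ennreal (4 * B / c * a0) + ennreal e"
      using e c B a0 by (simp add: ennreal_plus)
  qed
  also have "\<dots> = ennreal (4 * B / c) * ennreal a0" using a0 c B by (intro ennreal_mult) auto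
  finally show ?thesis using a0 by simp
qed

text \<open>The lattice cubes are closed and share faces, so a point may lie in several of them; in
  each coordinate at most two integers are within distance 1/2.\<close>

lemma card_lattice_cubes:
  fixes x :: "'a::euclidean_space"
  assumes "finite J" "J \<subseteq> int_lattice" "\<And>j. j \<in> J \<Longrightarrow> x \<in> cube_set j 1"
  shows "card J \<le> 2 ^ DIM('a)"
proof -
  define I where "I b = {\<lceil>x \<bullet> b - 1/2\<rceil>..\<lfloor>x \<bullet> b + 1/2\<rfloor>}" for b
  define h :: "'a \<Rightarrow> 'a \<Rightarrow> int" where "h j = (\<lambda>b\<in>Basis. \<lfloor>j \<bullet> b\<rfloor>)" for j
  have fl: "of_int \<lfloor>j \<bullet> b\<rfloor> = j \<bullet> b" if "j \<in> J" "b \<in> Basis" for j b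
  proof -
    have "j \<bullet> b \<in> \<int>" using assms(2) that by (auto simp: int_lattice_def)
    then show ?thesis by (auto elim: Ints_cases)
  qed
  have "inj_on h J"
  proof (rule inj_onI)
    fix i j assume ij: "i \<in> J" "j \<in> J" "h i = h j"
    show "i = j"
    proof (rule euclidean_eqI)
      fix b :: 'a assume b: "b \<in> Basis"
      then have "\<lfloor>i \<bullet> b\<rfloor> = \<lfloor>j \<bullet> b\<rfloor>" using fun_cong[OF ij(3), of b] by (simp add: h_def)
      then show "i \<bullet> b = j \<bullet> b" using fl b ij by metis
    qed
  qed
  moreover have "h ` J \<subseteq> PiE Basis I"
  proof
    fix w assume "w \<in> h ` J"
    then obtain j where j: "j \<in> J" "w = h j" by blast
    have "\<lfloor>j \<bullet> b\<rfloor> \<in> I b" if b: "b \<in> Basis" for b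
    proof -
      have "\<bar>(x - j) \<bullet> b\<bar> \<le> 1/2" using assms(3)[OF j(1)] b by (auto simp: mem_cube_set)
      then have "x \<bullet> b - 1/2 \<le> of_int \<lfloor>j \<bullet> b\<rfloor>" "of_int \<lfloor>j \<bullet> b\<rfloor> \<le> x \<bullet> b + 1/2"
        unfolding fl[OF j(1) b] inner_diff_left by arith+
      then have "\<lceil>x \<bullet> b - 1/2\<rceil> \<le> \<lfloor>j \<bullet> b\<rfloor>" "\<lfloor>j \<bullet> b\<rfloor> \<le> \<lfloor>x \<bullet> b + 1/2\<rfloor>"
        by linarith+
      then show ?thesis by (simp add: I_def)
    qed
    then show "w \<in> PiE Basis I" using j by (auto simp: h_def)
  qed
  ultimately have "card J \<le> card (PiE Basis I)"
    by (intro card_inj_on_le[of h]) (auto intro!: finite_PiE simp: I_def)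
  also have "\<dots> = (\<Prod>b\<in>Basis. card (I b))" by (simp add: card_PiE)
  also have "\<dots> \<le> (\<Prod>b\<in>(Basis::'a set). 2)"
  proof (intro prod_mono conjI)
    fix b :: 'a
    have "\<lfloor>x \<bullet> b + 1/2\<rfloor> - \<lceil>x \<bullet> b - 1/2\<rceil> \<le> 1" by linarith
    then show "card (I b) \<le> 2" by (simp add: I_def)
  qed simp
  finally show ?thesis by simp
qed

text \<open>The exponential bound is uniform over unit cubes, so each local Orlicz norm is at most
  one fixed multiple of the local integral of \<Phi>, and the bounded overlap of the cubes adds
  these up to the global integral.\<close>

lemma orlicz_amalgam_product:
  fixes W :: "'a::euclidean_space \<Rightarrow> real" and \<Phi> g :: "'a \<Rightarrow> ennreal"
  assumes s: "sets \<mu> = sets borel" and g_meas: "g \<in> borel_measurable \<mu>"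
    and W[measurable]: "W \<in> borel_measurable \<mu>" and W0: "\<And>x. 0 \<le> W x"
    and P[measurable]: "\<Phi> \<in> borel_measurable \<mu>" and Pint: "(\<integral>\<^sup>+x. \<Phi> x \<partial>\<mu>) < \<infinity>"
    and c: "0 < c" and B: "1 \<le> B" and expW: "\<And>j. (\<integral>\<^sup>+x\<in>cube_set j 1. ennreal (exp (c * W x)) \<partial>\<mu>) \<le> ennreal B"
    and g: "\<And>j. AE x in \<mu>. x \<in> cube_set j 1 \<longrightarrow> g x \<le> ennreal (W x) * \<Phi> x"
  shows "g \<in> orlicz_amalgam \<mu> wp_log"
proof -
  have [measurable]: "cube_set j 1 \<in> sets \<mu>" for j by (simp add: s)
  define K where "K = ennreal (4 * B / c) * (ennreal (2 ^ DIM('a)) * (\<integral>\<^sup>+x. \<Phi> x \<partial>\<mu>))"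
  have "(\<Sum>\<^sub>\<infinity>j\<in>int_lattice. orlicz_norm \<mu> wp_log (cube_set j 1) g)
      = (SUP J\<in>{J. finite J \<and> J \<subseteq> int_lattice}. \<Sum>j\<in>J. orlicz_norm \<mu> wp_log (cube_set j 1) g)"
    by (rule nonneg_infsum_complete) simp
  also have "\<dots> \<le> K"
  proof (rule SUP_least)
    fix J :: "'a set" assume "J \<in> {J. finite J \<and> J \<subseteq> int_lattice}"
    then have J: "finite J" "J \<subseteq> int_lattice" by auto
    have "(\<Sum>j\<in>J. orlicz_norm \<mu> wp_log (cube_set j 1) g) \<le> (\<Sum>j\<in>J. ennreal (4 * B / c) * (\<integral>\<^sup>+x\<in>cube_set j 1. \<Phi> x \<partial>\<mu>))"
      by (rule sum_mono, rule orlicz_norm_product[OF _ W W0 P c B expW g]) simp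
    also have "\<dots> = ennreal (4 * B / c) * (\<integral>\<^sup>+x. (\<Sum>j\<in>J. \<Phi> x * indicator (cube_set j 1) x) \<partial>\<mu>)"
      by (simp add: sum_distrib_left nn_integral_sum)
    also have "\<dots> \<le> ennreal (4 * B / c) * (\<integral>\<^sup>+x. ennreal (2 ^ DIM('a)) * \<Phi> x \<partial>\<mu>)"
    proof (intro mult_left_mono nn_integral_mono)
      fix x
      have "(\<Sum>j\<in>J. \<Phi> x * indicator (cube_set j 1) x) = \<Phi> x * of_nat (card {j\<in>J. x \<in> cube_set j 1})"
        using J by (simp add: sum_distrib_left[symmetric] indicator_def sum.If_cases Int_def)
      also have "\<dots> \<le> \<Phi> x * of_nat (2 ^ DIM('a))"
      proof (rule mult_left_mono[OF of_nat_mono])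
        show "card {j\<in>J. x \<in> cube_set j 1} \<le> 2 ^ DIM('a)" using J by (intro card_lattice_cubes) auto
      qed simp
      also have "of_nat (2 ^ DIM('a)) = ennreal (2 ^ DIM('a))" by (metis ennreal_of_nat_eq_real_of_nat of_nat_numeral of_nat_power)
      finally show "(\<Sum>j\<in>J. \<Phi> x * indicator (cube_set j 1) x) \<le> ennreal (2 ^ DIM('a)) * \<Phi> x" by (simp add: mult.commute)
    qed simp
    also have "\<dots> = K" by (simp add: K_def nn_integral_cmult)
    finally show "(\<Sum>j\<in>J. orlicz_norm \<mu> wp_log (cube_set j 1) g) \<le> K" .
  qed
  also have "K < \<infinity>" using Pint by (simp add: K_def ennreal_mult_less_top)
  finally show ?thesis using g_meas by (simp add: orlicz_amalgam_def)
qed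

section \<open>Test functions and distributions\<close>

lemma C_k_mono: "C_k m \<phi> \<Longrightarrow> m' \<le> m \<Longrightarrow> C_k m' \<phi>"
  unfolding C_k_def by (meson less_le_trans order_trans)

lemma test_functions_mono: "m' \<le> m \<Longrightarrow> test_functions m \<subseteq> test_functions m'"
  unfolding test_functions_def using C_k_mono by blast

lemma C_k_1_iff:
  "C_k 1 \<phi> \<longleftrightarrow> (\<forall>x. \<phi> differentiable at x) \<and> (\<forall>b\<in>Basis. continuous_on UNIV (iter_partial [b] \<phi>))"
proof
  assume C: "C_k 1 \<phi>"
  have "\<forall>x. iter_partial [] \<phi> differentiable at x"
    using C unfolding C_k_def by (metis empty_set empty_subsetI enat_0 list.size(3) zero_less_one zero_le)
  moreover have "continuous_on UNIV (iter_partial [b] \<phi>)" if "b \<in> Basis" for b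
  proof -
    have "set [b] \<subseteq> Basis \<and> enat (length [b]) \<le> 1" using that by (simp add: one_enat_def)
    then show ?thesis using C unfolding C_k_def by blast
  qed
  ultimately show "(\<forall>x. \<phi> differentiable at x) \<and> (\<forall>b\<in>Basis. continuous_on UNIV (iter_partial [b] \<phi>))" by simp
next
  assume R: "(\<forall>x. \<phi> differentiable at x) \<and> (\<forall>b\<in>Basis. continuous_on UNIV (iter_partial [b] \<phi>))"
  show "C_k 1 \<phi>" unfolding C_k_def
  proof (intro allI impI)
    fix bs :: "'a list" assume bs: "set bs \<subseteq> Basis \<and> enat (length bs) \<le> 1"
    then have "length bs \<le> 1" by (simp add: one_enat_def)
    then consider "bs = []" | b where "bs = [b]" by (cases bs) auto
    then show "continuous_on UNIV (iter_partial bs \<phi>) \<and> (enat (length bs) < 1 \<longrightarrow> (\<forall>x. iter_partial bs \<phi> differentiable at x))"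
    proof cases
      case 1
      then show ?thesis using R differentiable_imp_continuous_on[of \<phi> UNIV] by (simp add: differentiable_on_def)
    next
      case 2
      then show ?thesis using R bs by (auto simp: one_enat_def)
    qed
  qed
qed

lemma C1_D:
  assumes "C_k 1 \<phi>"
  shows C1_differentiable: "\<phi> differentiable at x" and C1_continuous: "continuous_on UNIV \<phi>"
    and C1_partial: "b \<in> Basis \<Longrightarrow> continuous_on UNIV (iter_partial [b] \<phi>)"
proof -
  show "\<phi> differentiable at x" and "b \<in> Basis \<Longrightarrow> continuous_on UNIV (iter_partial [b] \<phi>)"
    using assms by (auto simp: C_k_1_iff)
  show "continuous_on UNIV \<phi>"
    using assms by (intro differentiable_imp_continuous_on) (auto simp: C_k_1_iff differentiable_on_def)
qed

lemma C1_measurable: "C_k 1 \<phi> \<Longrightarrow> \<phi> \<in> borel_measurable borel"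
  by (intro borel_measurable_continuous_onI C1_continuous)

lemma frechet_derivative_gradient:
  assumes "\<phi> differentiable at x"
  shows "frechet_derivative \<phi> (at x) v = gradient \<phi> x \<bullet> v"
proof -
  have lin: "linear (frechet_derivative \<phi> (at x))" using assms by (rule linear_frechet_derivative)
  have "frechet_derivative \<phi> (at x) v = frechet_derivative \<phi> (at x) (\<Sum>b\<in>Basis. (v \<bullet> b) *\<^sub>R b)"
    by (simp add: euclidean_representation)
  also have "\<dots> = (\<Sum>b\<in>Basis. (v \<bullet> b) * frechet_derivative \<phi> (at x) b)"
    by (simp add: linear_sum[OF lin] linear_scale[OF lin])
  also have "\<dots> = gradient \<phi> x \<bullet> v"
    by (simp add: gradient_def inner_sum_left inner_commute[of v] mult.commute)
  finally show ?thesis .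
qed

lemma C1_mvt:
  fixes \<phi> :: "'a::euclidean_space \<Rightarrow> real"
  assumes "C_k 1 \<phi>" "convex A" "\<And>z. z \<in> A \<Longrightarrow> norm (gradient \<phi> z) \<le> B" "x \<in> A" "y \<in> A"
  shows "\<bar>\<phi> x - \<phi> y\<bar> \<le> B * norm (x - y)"
proof -
  have "norm (\<phi> x - \<phi> y) \<le> B * norm (x - y)"
  proof (rule differentiable_bound[OF assms(2) _ _ assms(4,5)])
    fix z assume z: "z \<in> A"
    show "(\<phi> has_derivative frechet_derivative \<phi> (at z)) (at z within A)"
      using C1_differentiable[OF assms(1), of z] by (meson frechet_derivative_works has_derivative_at_withinI)
    show "onorm (frechet_derivative \<phi> (at z)) \<le> B"
    proof (rule onorm_le)
      fix v
      have "norm (frechet_derivative \<phi> (at z) v) = \<bar>gradient \<phi> z \<bullet> v\<bar>"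
        by (simp add: frechet_derivative_gradient[OF C1_differentiable[OF assms(1)]])
      also have "\<dots> \<le> norm (gradient \<phi> z) * norm v" by (rule Cauchy_Schwarz_ineq2)
      also have "\<dots> \<le> B * norm v" using assms(3)[OF z] by (intro mult_right_mono) auto
      finally show "norm (frechet_derivative \<phi> (at z) v) \<le> B * norm v" .
    qed
  qed
  then show ?thesis by simp
qed

text \<open>The seminorm condition of \<open>distribution_on\<close> with k = 1, kept in the same
  shape so that it matches that definition literally.\<close>

abbreviation "C1_bound \<phi> A \<equiv> (\<forall>bs y. set bs \<subseteq> Basis \<and> length bs \<le> 1 \<longrightarrow> \<bar>iter_partial bs \<phi> y\<bar> \<le> A)"

lemma C1_boundD:
  assumes "C1_bound \<phi> A"
  shows "\<bar>\<phi> y\<bar> \<le> A" "b \<in> Basis \<Longrightarrow> \<bar>iter_partial [b] \<phi> y\<bar> \<le> A" "0 \<le> A"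
proof -
  show 1: "\<bar>\<phi> y\<bar> \<le> A" using assms[rule_format, of "[]"] by simp
  show "b \<in> Basis \<Longrightarrow> \<bar>iter_partial [b] \<phi> y\<bar> \<le> A" using assms[rule_format, of "[b]"] by simp
  show "0 \<le> A" using 1 by simp
qed

lemma C1_boundI:
  assumes "\<And>y. \<bar>\<phi> y\<bar> \<le> A" "\<And>b y. b \<in> Basis \<Longrightarrow> \<bar>iter_partial [b] \<phi> y\<bar> \<le> A"
  shows "C1_bound \<phi> A"
proof (intro allI impI)
  fix bs :: "'a list" and y assume bs: "set bs \<subseteq> Basis \<and> length bs \<le> 1"
  then consider "bs = []" | b where "bs = [b]" by (cases bs) auto
  then show "\<bar>iter_partial bs \<phi> y\<bar> \<le> A" using assms bs by cases auto
qed

lemma C1_bound_lipschitz: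
  fixes \<phi> :: "'a::euclidean_space \<Rightarrow> real"
  assumes "C_k 1 \<phi>" "C1_bound \<phi> A"
  shows "\<bar>\<phi> x - \<phi> y\<bar> \<le> real DIM('a) * A * norm (x - y)"
proof (rule C1_mvt[OF assms(1) convex_UNIV])
  fix z
  have "norm (gradient \<phi> z) \<le> (\<Sum>b\<in>Basis. norm (iter_partial [b] \<phi> z *\<^sub>R b))"
    unfolding gradient_def by (rule norm_sum)
  also have "\<dots> \<le> (\<Sum>b\<in>(Basis::'a set). A)"
    using C1_boundD(2)[OF assms(2)] by (intro sum_mono) (auto simp del: iter_partial.simps)
  finally show "norm (gradient \<phi> z) \<le> real DIM('a) * A" by simp
qed auto

lemma partial_zero_outside:
  assumes "compact K" "\<forall>y. y \<notin> K \<longrightarrow> \<phi> y = (0::real)" "y \<notin> K"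
  shows "iter_partial [b] \<phi> y = 0"
proof -
  have "open (- K)" using assms(1) by (simp add: compact_imp_closed open_Compl)
  then have "(\<phi> has_derivative (\<lambda>_. 0)) (at y)"
    using has_derivative_transform_within_open[of "\<lambda>_. 0" "\<lambda>_. 0" y UNIV "- K" \<phi>] assms(2,3) by simp
  then have "frechet_derivative \<phi> (at y) = (\<lambda>_. 0)" by (rule frechet_derivative_at[symmetric])
  then show ?thesis by simp
qed

lemma bounded_continuous_compact_support:
  assumes "continuous_on UNIV g" "compact K" "\<And>y. y \<notin> K \<Longrightarrow> g y = (0::real)"
  obtains A where "\<And>y. \<bar>g y\<bar> \<le> A"
proof -
  have "bounded (g ` K)" using assms by (intro compact_imp_bounded compact_continuous_image) (auto intro: continuous_on_subset)
  then obtain A where A: "\<And>y. y \<in> K \<Longrightarrow> \<bar>g y\<bar> \<le> A" by (auto simp: bounded_iff)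
  have "\<bar>g y\<bar> \<le> max A 0" for y using A[of y] assms(3)[of y] by (cases "y \<in> K") auto
  then show ?thesis using that by blast
qed

lemma test_function_bound:
  assumes "\<phi> \<in> test_functions m" "1 \<le> m"
  obtains A where "C1_bound \<phi> A"
proof -
  have C: "C_k 1 \<phi>" using assms C_k_mono by (auto simp: test_functions_def)
  obtain K where K: "compact K" "\<forall>y. y \<notin> K \<longrightarrow> \<phi> y = 0" using assms by (auto simp: test_functions_def)
  obtain A0 where A0: "\<And>y. \<bar>\<phi> y\<bar> \<le> A0"
    using bounded_continuous_compact_support[OF C1_continuous[OF C] K(1)] K(2) by metis
  have "\<forall>b\<in>Basis. \<exists>A. \<forall>y. \<bar>iter_partial [b] \<phi> y\<bar> \<le> A"
    using bounded_continuous_compact_support[OF C1_partial[OF C] K(1) partial_zero_outside[OF K]] by metis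
  then obtain A1 where A1: "\<And>b y. b \<in> Basis \<Longrightarrow> \<bar>iter_partial [b] \<phi> y\<bar> \<le> A1 b" by metis
  define A where "A = \<bar>A0\<bar> + (\<Sum>b\<in>Basis. \<bar>A1 b\<bar>)"
  have "C1_bound \<phi> A"
  proof (rule C1_boundI)
    show "\<bar>\<phi> y\<bar> \<le> A" for y using A0[of y] sum_nonneg[of Basis "\<lambda>b. \<bar>A1 b\<bar>"] unfolding A_def by linarith
    fix b y :: 'a assume b: "b \<in> Basis"
    have "\<bar>A1 b\<bar> \<le> (\<Sum>b\<in>Basis. \<bar>A1 b\<bar>)" using b by (intro member_le_sum) auto
    then show "\<bar>iter_partial [b] \<phi> y\<bar> \<le> A" using A1[OF b, of y] unfolding A_def by linarith
  qed
  then show ?thesis by (rule that)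
qed

lemma test_function_C1: "\<phi> \<in> test_functions m \<Longrightarrow> 1 \<le> m \<Longrightarrow> C_k 1 \<phi>"
  using C_k_mono by (auto simp: test_functions_def)

text \<open>Summable bounds in terms of first derivatives give convergence and continuity together,
  and order 1 is admissible for every m >= 1. This covers the extension to C^1 functions and the
  distribution proper.\<close>

lemma distribution_suminf:
  fixes L :: "nat \<Rightarrow> ('a::euclidean_space \<Rightarrow> real) \<Rightarrow> real"
  assumes m: "1 \<le> m" and s: "summable s"
    and lin: "\<And>j \<phi> \<psi> a b. \<phi> \<in> test_functions m \<Longrightarrow> \<psi> \<in> test_functions m \<Longrightarrow>
       L j (\<lambda>y. a * \<phi> y + b * \<psi> y) = a * L j \<phi> + b * L j \<psi>"
    and bnd: "\<And>j \<phi> A. \<phi> \<in> test_functions m \<Longrightarrow> C1_bound \<phi> A \<Longrightarrow> \<bar>L j \<phi>\<bar> \<le> K * s j * A"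
  shows "distribution_on m (\<lambda>\<phi>. \<Sum>j. L j \<phi>)" and "\<phi> \<in> test_functions m \<Longrightarrow> summable (\<lambda>j. L j \<phi>)"
proof -
  have sm: "summable (\<lambda>j. \<bar>L j \<phi>\<bar>)" if t: "\<phi> \<in> test_functions m" for \<phi>
  proof -
    obtain A where A: "C1_bound \<phi> A" using that by (rule test_function_bound[OF t m])
    show ?thesis using bnd[OF t A] s
      by (intro summable_comparison_test[of "\<lambda>j. \<bar>L j \<phi>\<bar>" "\<lambda>j. K * s j * A"] summable_mult2 summable_mult) auto
  qed
  have sm': "summable (\<lambda>j. L j \<phi>)" if "\<phi> \<in> test_functions m" for \<phi>
    using sm[OF that] by (rule summable_rabs_cancel)
  show "\<phi> \<in> test_functions m \<Longrightarrow> summable (\<lambda>j. L j \<phi>)" by (rule sm')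
  show "distribution_on m (\<lambda>\<phi>. \<Sum>j. L j \<phi>)" unfolding distribution_on_def
  proof (intro conjI ballI allI impI)
    fix \<phi> \<psi> :: "'a \<Rightarrow> real" and a b assume t: "\<phi> \<in> test_functions m" "\<psi> \<in> test_functions m"
    show "(\<Sum>j. L j (\<lambda>y. a * \<phi> y + b * \<psi> y)) = a * (\<Sum>j. L j \<phi>) + b * (\<Sum>j. L j \<psi>)"
      unfolding lin[OF t] using sm' t by (simp add: suminf_add[symmetric] suminf_mult summable_mult)
  next
    fix Q :: "'a set" assume "compact Q"
    show "\<exists>C k. enat k \<le> m \<and> (\<forall>\<phi>\<in>test_functions m. \<forall>A. (\<forall>y. y \<notin> Q \<longrightarrow> \<phi> y = 0) \<and>
           (\<forall>bs y. set bs \<subseteq> Basis \<and> length bs \<le> k \<longrightarrow> \<bar>iter_partial bs \<phi> y\<bar> \<le> A) \<longrightarrow> \<bar>\<Sum>j. L j \<phi>\<bar> \<le> C * A)"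
    proof (intro exI[of _ "K * suminf s"] exI[of _ 1] conjI ballI allI impI)
      show "enat 1 \<le> m" using m by (simp add: one_enat_def)
      fix \<phi> :: "'a \<Rightarrow> real" and A assume t: "\<phi> \<in> test_functions m"
        and A: "(\<forall>y. y \<notin> Q \<longrightarrow> \<phi> y = 0) \<and> C1_bound \<phi> A"
      have "\<bar>\<Sum>j. L j \<phi>\<bar> \<le> (\<Sum>j. \<bar>L j \<phi>\<bar>)" using sm[OF t] by (rule summable_rabs)
      also have "\<dots> \<le> (\<Sum>j. K * s j * A)" using bnd[OF t] A sm[OF t] s
        by (intro suminf_le summable_mult2 summable_mult) auto
      also have "\<dots> = K * suminf s * A" using s by (simp add: suminf_mult suminf_mult2[symmetric] summable_mult)
      finally show "\<bar>\<Sum>j. L j \<phi>\<bar> \<le> K * suminf s * A" .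
    qed
  qed
qed

lemma distribution_on_mono:
  assumes "distribution_on m T" "m \<le> m'"
  shows "distribution_on m' T"
  unfolding distribution_on_def
proof (intro conjI ballI allI impI)
  have sub: "test_functions m' \<subseteq> test_functions m" by (rule test_functions_mono[OF assms(2)])
  show "T (\<lambda>y. s * \<phi> y + t * \<psi> y) = s * T \<phi> + t * T \<psi>" if "\<phi> \<in> test_functions m'" "\<psi> \<in> test_functions m'" for \<phi> \<psi> s t
    using assms(1) sub that unfolding distribution_on_def by blast
  fix K :: "'a set" assume "compact K"
  then obtain C k where Ck: "enat k \<le> m" "\<forall>\<phi>\<in>test_functions m. \<forall>A.
           (\<forall>y. y \<notin> K \<longrightarrow> \<phi> y = 0) \<and>
           (\<forall>bs y. set bs \<subseteq> Basis \<and> length bs \<le> k \<longrightarrow> \<bar>iter_partial bs \<phi> y\<bar> \<le> A)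
           \<longrightarrow> \<bar>T \<phi>\<bar> \<le> C * A" using assms(1) unfolding distribution_on_def by blast
  have "enat k \<le> m'" using Ck(1) assms(2) by (rule order_trans)
  then show "\<exists>C k. enat k \<le> m' \<and> (\<forall>\<phi>\<in>test_functions m'. \<forall>A. (\<forall>y. y \<notin> K \<longrightarrow> \<phi> y = 0) \<and>
           (\<forall>bs y. set bs \<subseteq> Basis \<and> length bs \<le> k \<longrightarrow> \<bar>iter_partial bs \<phi> y\<bar> \<le> A) \<longrightarrow> \<bar>T \<phi>\<bar> \<le> C * A)"
    using Ck(2) sub by blast
qed

section \<open>Semicontinuity of the local maximal function\<close>

lemma uniform_continuity_compact_support:
  fixes g :: "'a::euclidean_space \<Rightarrow> real"
  assumes "continuous_on UNIV g" "\<And>y. y \<notin> cball x R \<Longrightarrow> g y = 0" "0 < \<epsilon>"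
  shows "\<exists>\<delta>>0. \<forall>y h. norm h < \<delta> \<longrightarrow> \<bar>g (y - h) - g y\<bar> \<le> \<epsilon>"
proof -
  have "uniformly_continuous_on (cball x (R + 1)) g"
    using assms(1) by (intro compact_uniformly_continuous) (auto intro: continuous_on_subset)
  then obtain d where d: "d > 0" "\<And>y y'. y \<in> cball x (R+1) \<Longrightarrow> y' \<in> cball x (R+1) \<Longrightarrow> dist y' y < d \<Longrightarrow> dist (g y') (g y) < \<epsilon>"
    unfolding uniformly_continuous_on_def using assms(3) by metis
  show ?thesis
  proof (intro exI[of _ "min d 1"] conjI allI impI)
    fix y h :: 'a assume h: "norm h < min d 1"
    show "\<bar>g (y - h) - g y\<bar> \<le> \<epsilon>"
    proof (cases "y \<in> cball x (R+1) \<and> y - h \<in> cball x (R+1)")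
      case True
      moreover have "dist (y - h) y < d" using h by (simp add: dist_norm)
      ultimately show ?thesis using d(2)[of y "y - h"] by (simp add: dist_real_def)
    next
      case False
      have "dist x y \<le> dist x (y - h) + norm h" "dist x (y - h) \<le> dist x y + norm h"
        using dist_triangle[of x y "y - h"] dist_triangle[of x "y - h" y] by (simp_all add: dist_norm norm_minus_commute)
      then have "y \<notin> cball x R" "y - h \<notin> cball x R" using False h by auto
      then show ?thesis using assms by simp
    qed
  qed (use d in simp)
qed

lemma C1_lincomb:
  fixes \<phi> \<psi> :: "'a::euclidean_space \<Rightarrow> real"
  assumes "C_k 1 \<phi>" "C_k 1 \<psi>"
  shows "C_k 1 (\<lambda>y. s * \<phi> y + t * \<psi> y)"
    and "iter_partial [b] (\<lambda>y. s * \<phi> y + t * \<psi> y) y = s * iter_partial [b] \<phi> y + t * iter_partial [b] \<psi> y"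
proof -
  have D: "((\<lambda>y. s * \<phi> y + t * \<psi> y) has_derivative (\<lambda>h. s * frechet_derivative \<phi> (at y) h + t * frechet_derivative \<psi> (at y) h)) (at y)" for y
    using C1_differentiable[OF assms(1), of y] C1_differentiable[OF assms(2), of y]
    by (intro derivative_intros) (auto simp: frechet_derivative_works[symmetric])
  show *: "iter_partial [b] (\<lambda>y. s * \<phi> y + t * \<psi> y) y = s * iter_partial [b] \<phi> y + t * iter_partial [b] \<psi> y" for b y
    using frechet_derivative_at[OF D, of y, symmetric] by simp
  show "C_k 1 (\<lambda>y. s * \<phi> y + t * \<psi> y)" unfolding C_k_1_iff
  proof (intro conjI allI ballI)
    show "(\<lambda>y. s * \<phi> y + t * \<psi> y) differentiable at x" for x using D differentiable_def by blast
    fix b :: 'a assume b: "b \<in> Basis"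
    have "iter_partial [b] (\<lambda>y. s * \<phi> y + t * \<psi> y) = (\<lambda>y. s * iter_partial [b] \<phi> y + t * iter_partial [b] \<psi> y)"
      using * by blast
    then show "continuous_on UNIV (iter_partial [b] (\<lambda>y. s * \<phi> y + t * \<psi> y))"
      using C1_partial[OF assms(1) b] C1_partial[OF assms(2) b] by (simp only:) (intro continuous_intros)
  qed
qed

lemma C1_translate:
  fixes \<phi> :: "'a::euclidean_space \<Rightarrow> real"
  assumes "C_k 1 \<phi>"
  shows "C_k 1 (\<lambda>y. \<phi> (y - h))" and "iter_partial [b] (\<lambda>y. \<phi> (y - h)) y = iter_partial [b] \<phi> (y - h)"
proof -
  have D: "((\<lambda>y. \<phi> (y - h)) has_derivative (\<lambda>v. frechet_derivative \<phi> (at (y - h)) v)) (at y)" for y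
  proof -
    have "(\<phi> has_derivative frechet_derivative \<phi> (at (y - h))) (at (y - h))"
      using C1_differentiable[OF assms] frechet_derivative_works by blast
    moreover have "((\<lambda>y. y - h) has_derivative (\<lambda>v. v)) (at y)" by (auto intro!: derivative_eq_intros)
    ultimately show ?thesis using has_derivative_compose[of "\<lambda>y. y - h" "\<lambda>v. v" y UNIV \<phi>] by simp
  qed
  show *: "iter_partial [b] (\<lambda>y. \<phi> (y - h)) y = iter_partial [b] \<phi> (y - h)" for b y
    using frechet_derivative_at[OF D, of y, symmetric] by simp
  show "C_k 1 (\<lambda>y. \<phi> (y - h))" unfolding C_k_1_iff
  proof (intro conjI allI ballI)
    show "(\<lambda>y. \<phi> (y - h)) differentiable at x" for x using D differentiable_def by blast
    fix b :: 'a assume b: "b \<in> Basis"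
    have "iter_partial [b] (\<lambda>y. \<phi> (y - h)) = (\<lambda>y. iter_partial [b] \<phi> (y - h))" using * by blast
    then show "continuous_on UNIV (iter_partial [b] (\<lambda>y. \<phi> (y - h)))"
      using continuous_on_compose2[OF C1_partial[OF assms b], of UNIV "\<lambda>y. y - h"]
      by (simp only:) (simp del: iter_partial.simps add: continuous_on_diff)
  qed
qed

lemma F_loc_test: "\<phi> \<in> F_loc \<mu> n x \<Longrightarrow> \<phi> \<in> test_functions 1"
  using compact_cube_set by (auto simp: F_loc_def F_class_def test_functions_def)

context poly_growth
begin

text \<open>A test function admissible at \<open>x\<close> is translated to a nearby point, and its
  size bounds move along with it. This is a small perturbation in C^1, so T changes little. But
  \<mu> is not translation invariant: the L^1 norm may come to exceed 1, and the translate has to be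
  divided by \<open>1 + \<epsilon> * M\<close>.\<close>

lemma local_maximal_open:
  assumes T: "distribution_on 1 T"
  shows "open {x. t < local_maximal \<mu> n T x}"
proof (rule openI)
  fix x assume "x \<in> {x. t < local_maximal \<mu> n T x}"
  then obtain \<phi> where phi: "\<phi> \<in> F_loc \<mu> n x" and t: "t < ennreal \<bar>T \<phi>\<bar>"
    by (auto simp: local_maximal_def less_SUP_iff)
  have C: "C_k 1 \<phi>" and int: "integrable \<mu> \<phi>" and L1: "(LINT y|\<mu>. \<bar>\<phi> y\<bar>) \<le> 1" and pos: "\<And>y. 0 \<le> \<phi> y"
    and size: "\<And>y. y \<noteq> x \<Longrightarrow> \<phi> y \<le> 1 / norm (y - x) ^ n \<and> norm (gradient \<phi> y) \<le> 1 / norm (y - x) ^ (n + 1)"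
    and supp: "\<And>y. y \<notin> cube_set x 1 \<Longrightarrow> \<phi> y = 0"
    using phi by (auto simp: F_loc_def F_class_def)
  define R where "R = real DIM('a) / 2"
  \<comment> \<open>A ball containing the supports of \<phi> and of its translates by vectors
    shorter than 1, so that a single continuity estimate for T serves all of them.\<close>
  define Q where "Q = cball x (R + 1)"
  have QR: "cube_set x 1 \<subseteq> cball x R" using cube_set_subset_cball[of x 1] by (simp add: R_def)
  obtain C' k where Ck: "enat k \<le> 1" "\<forall>\<psi>\<in>test_functions 1. \<forall>A. (\<forall>y. y \<notin> Q \<longrightarrow> \<psi> y = 0) \<and>
           (\<forall>bs y. set bs \<subseteq> Basis \<and> length bs \<le> k \<longrightarrow> \<bar>iter_partial bs \<psi> y\<bar> \<le> A) \<longrightarrow> \<bar>T \<psi>\<bar> \<le> C' * A"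
    using T unfolding distribution_on_def Q_def by (meson compact_cball)
  define M where "M = measure \<mu> Q"
  \<comment> \<open>The perturbed and renormalised value tends to that of \<phi> as \<epsilon> tends
    to 0, so some positive \<epsilon> still leaves it above the given level.\<close>
  have "((\<lambda>\<epsilon>. (\<bar>T \<phi>\<bar> - \<bar>C'\<bar> * \<epsilon>) / (1 + \<epsilon> * M)) \<longlongrightarrow> (\<bar>T \<phi>\<bar> - \<bar>C'\<bar> * 0) / (1 + 0 * M)) (at_right 0)"
    by (intro tendsto_intros) auto
  moreover obtain \<tau> where \<tau>: "t = ennreal \<tau>" "0 \<le> \<tau>" using t by (cases t) auto
  moreover have "\<tau> < \<bar>T \<phi>\<bar>" using t \<tau> by (simp add: ennreal_less_iff)
  ultimately have "\<forall>\<^sub>F \<epsilon> in at_right 0. \<tau> < (\<bar>T \<phi>\<bar> - \<bar>C'\<bar> * \<epsilon>) / (1 + \<epsilon> * M)" by (intro order_tendstoD) auto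
  then have "\<forall>\<^sub>F \<epsilon> in at_right 0. 0 < \<epsilon> \<and> \<tau> < (\<bar>T \<phi>\<bar> - \<bar>C'\<bar> * \<epsilon>) / (1 + \<epsilon> * M)"
    using eventually_at_right_less[of "0::real"] by eventually_elim auto
  then obtain \<epsilon> where eps: "0 < \<epsilon>" "\<tau> < (\<bar>T \<phi>\<bar> - \<bar>C'\<bar> * \<epsilon>) / (1 + \<epsilon> * M)"
    using eventually_happens'[of "at_right (0::real)"] by (auto simp: trivial_limit_at_right_real)
  have z0: "\<phi> y = 0" if "y \<notin> cball x R" for y using supp QR that by blast
  have z1: "iter_partial [b] \<phi> y = 0" if "y \<notin> cball x R" for b y
    using partial_zero_outside[of "cball x R" \<phi> y b] z0 that by auto
  obtain d0 where d0: "d0 > 0" "\<And>y h. norm h < d0 \<Longrightarrow> \<bar>\<phi> (y - h) - \<phi> y\<bar> \<le> \<epsilon>"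
    using uniform_continuity_compact_support[OF C1_continuous[OF C] z0 eps(1)] by blast
  have "\<forall>b\<in>Basis. \<exists>d>0. \<forall>y h. norm h < d \<longrightarrow> \<bar>iter_partial [b] \<phi> (y - h) - iter_partial [b] \<phi> y\<bar> \<le> \<epsilon>"
    using uniform_continuity_compact_support[OF C1_partial[OF C] z1 eps(1)] by blast
  then obtain d1 where d1: "\<And>b. b \<in> Basis \<Longrightarrow> d1 b > 0"
    "\<And>b y h. b \<in> Basis \<Longrightarrow> norm h < d1 b \<Longrightarrow> \<bar>iter_partial [b] \<phi> (y - h) - iter_partial [b] \<phi> y\<bar> \<le> \<epsilon>" by metis
  define d where "d = min (min d0 1) (Min (d1 ` Basis))"
  have d: "0 < d" "d \<le> d0" "d \<le> 1" "\<And>b. b \<in> Basis \<Longrightarrow> d \<le> d1 b"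
    using d0 d1 by (auto simp: d_def min_le_iff_disj)
  show "\<exists>e>0. ball x e \<subseteq> {x. t < local_maximal \<mu> n T x}"
  proof (intro exI[of _ d] conjI subsetI d(1))
    fix w assume "w \<in> ball x d"
    define h where "h = w - x"
    have h: "norm h < d" "w = x + h" using \<open>w \<in> ball x d\<close> by (auto simp: h_def dist_norm norm_minus_commute)
    define \<phi>h where "\<phi>h y = \<phi> (y - h)" for y
    have Ch: "C_k 1 \<phi>h" and gh: "\<And>b y. iter_partial [b] \<phi>h y = iter_partial [b] \<phi> (y - h)"
      unfolding \<phi>h_def[abs_def] by (rule C1_translate[OF C])+
    have zQ: "\<phi>h y = 0 \<and> \<phi> y = 0" if "y \<notin> Q" for y
    proof -
      have "dist x y \<le> dist x (y - h) + norm h" using dist_triangle[of x y "y - h"] by (simp add: dist_norm norm_minus_commute)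
      then have "y \<notin> cball x R" "y - h \<notin> cball x R" using that h d by (auto simp: Q_def)
      then show ?thesis using z0 by (auto simp: \<phi>h_def)
    qed
    have Qc: "compact Q" by (simp add: Q_def)
    have test: "\<phi> \<in> test_functions 1" "\<phi>h \<in> test_functions 1" using C Ch zQ Qc by (auto simp: test_functions_def)
    define \<psi> where "\<psi> y = 1 * \<phi>h y + (- 1) * \<phi> y" for y
    have Cpsi: "C_k 1 \<psi>" unfolding \<psi>_def by (rule C1_lincomb[OF Ch C])
    have bpsi: "C1_bound \<psi> \<epsilon>"
    proof (rule C1_boundI)
      show "\<bar>\<psi> y\<bar> \<le> \<epsilon>" for y using d0(2)[of h y] h d by (simp add: \<psi>_def \<phi>h_def)
      show "\<bar>iter_partial [b] \<psi> y\<bar> \<le> \<epsilon>" if "b \<in> Basis" for b y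
      proof -
        have "iter_partial [b] \<psi> y = 1 * iter_partial [b] \<phi>h y + (- 1) * iter_partial [b] \<phi> y"
          unfolding \<psi>_def by (rule C1_lincomb[OF Ch C])
        then show ?thesis using d1(2)[OF that, of h y] h d(4)[OF that] unfolding gh by simp
      qed
    qed
    have "k \<le> 1" using Ck(1) by (simp add: one_enat_def)
    moreover have "\<psi> \<in> test_functions 1" using Cpsi zQ Qc by (auto simp: test_functions_def \<psi>_def)
    ultimately have "\<bar>T \<psi>\<bar> \<le> C' * \<epsilon>" using Ck(2) zQ bpsi by (auto simp: \<psi>_def)
    also have "\<dots> \<le> \<bar>C'\<bar> * \<epsilon>" using eps by (intro mult_right_mono) auto
    finally have "\<bar>T \<psi>\<bar> \<le> \<bar>C'\<bar> * \<epsilon>" .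
    moreover have "T \<psi> = 1 * T \<phi>h + (- 1) * T \<phi>"
      using T test unfolding distribution_on_def \<psi>_def[abs_def] by blast
    ultimately have Tge: "\<bar>T \<phi>\<bar> - \<bar>C'\<bar> * \<epsilon> \<le> \<bar>T \<phi>h\<bar>" by linarith
    define c where "c = 1 / (1 + \<epsilon> * M)"
    have M0: "0 \<le> \<epsilon> * M" using eps by (simp add: M_def)
    have c: "0 < c" "c \<le> 1" "c * (1 + \<epsilon> * M) = 1" using M0 by (auto simp: c_def)
    \<comment> \<open>The zero summand gives the function the shape of a linear combination, to
      which \<open>C1_lincomb\<close> and the linearity of T apply.\<close>
    define \<phi>' where "\<phi>' y = c * \<phi>h y + 0 * \<phi>h y" for y
    have Tphi': "T \<phi>' = c * T \<phi>h"
    proof -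
      have "T \<phi>' = c * T \<phi>h + 0 * T \<phi>h" using T test unfolding distribution_on_def \<phi>'_def[abs_def] by blast
      then show ?thesis by simp
    qed
    have [measurable]: "\<phi> \<in> borel_measurable \<mu>" "\<phi>h \<in> borel_measurable \<mu>" 
      using C1_measurable[OF C] C1_measurable[OF Ch] measurable_cong_sets[OF sets_eq refl] by blast+
    have intQ: "integrable \<mu> (indicator Q :: 'a \<Rightarrow> real)"
      unfolding Q_def using emeasure_cball_finite by (intro integrable_real_indicator) auto
    have le: "\<bar>\<phi>h y\<bar> \<le> \<bar>\<phi> y\<bar> + \<epsilon> * indicator Q y" for y
      using d0(2)[of h y] h d zQ[of y] by (cases "y \<in> Q") (auto simp: \<phi>h_def)
    have intmaj: "integrable \<mu> (\<lambda>y. \<bar>\<phi> y\<bar> + \<epsilon> * indicator Q y)" using int intQ by simp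
    have inth: "integrable \<mu> \<phi>h" using le by (intro Bochner_Integration.integrable_bound[OF intmaj]) (auto simp: order_trans[OF le abs_ge_self])
    have L1h: "(LINT y|\<mu>. \<bar>\<phi>h y\<bar>) \<le> 1 + \<epsilon> * M"
    proof -
      have "(LINT y|\<mu>. \<bar>\<phi>h y\<bar>) \<le> (LINT y|\<mu>. \<bar>\<phi> y\<bar> + \<epsilon> * indicator Q y)"
        using inth intmaj le by (intro integral_mono) auto
      also have "\<dots> = (LINT y|\<mu>. \<bar>\<phi> y\<bar>) + \<epsilon> * M" using int intQ by (simp add: M_def)
      finally show ?thesis using L1 by simp
    qed
    have "\<phi>' \<in> F_loc \<mu> n w" unfolding F_loc_def F_class_def mem_Collect_eq
    proof (intro conjI allI impI)
      show "C_k 1 \<phi>'" unfolding \<phi>'_def by (rule C1_lincomb[OF Ch Ch])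
      show "integrable \<mu> \<phi>'" unfolding \<phi>'_def using inth by simp
      show "(LINT y|\<mu>. \<bar>\<phi>' y\<bar>) \<le> 1"
        using mult_left_mono[OF L1h, of c] c by (simp add: \<phi>'_def abs_mult)
      show "0 \<le> \<phi>' y" for y using c pos by (simp add: \<phi>'_def \<phi>h_def)
      fix y
      show "\<phi>' y = 0" if "y \<notin> cube_set w 1"
      proof -
        have "y - h \<notin> cube_set x 1" using that by (auto simp: mem_cube_set h(2) algebra_simps)
        then show ?thesis using supp by (simp add: \<phi>'_def \<phi>h_def)
      qed
      assume yw: "y \<noteq> w"
      then have yh: "y - h \<noteq> x" "norm (y - h - x) = norm (y - w)" using h by (auto simp: algebra_simps)
      have "\<phi>' y \<le> \<phi> (y - h)" using c pos[of "y - h"] by (simp add: \<phi>'_def \<phi>h_def mult_left_le_one_le)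
      then show "\<phi>' y \<le> 1 / norm (y - w) ^ n" using size[OF yh(1)] yh(2) by simp
      have "gradient \<phi>' y = c *\<^sub>R gradient \<phi> (y - h)"
      proof -
        have "iter_partial [b] \<phi>' y = c * iter_partial [b] \<phi> (y - h)" for b
          using C1_lincomb(2)[OF Ch Ch, of b c 0 y] unfolding \<phi>'_def gh by simp
        then show ?thesis unfolding gradient_def by (simp add: scaleR_sum_right del: iter_partial.simps)
      qed
      then have "norm (gradient \<phi>' y) \<le> norm (gradient \<phi> (y - h))" using c by (simp add: mult_left_le_one_le)
      then show "norm (gradient \<phi>' y) \<le> 1 / norm (y - w) ^ (n + 1)" using size[OF yh(1)] yh(2) by simp
    qed
    then have "ennreal \<bar>T \<phi>'\<bar> \<le> local_maximal \<mu> n T w" unfolding local_maximal_def by (rule SUP_upper)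
    moreover have "\<tau> < \<bar>T \<phi>'\<bar>"
    proof -
      have "\<tau> < c * (\<bar>T \<phi>\<bar> - \<bar>C'\<bar> * \<epsilon>)" using eps(2) by (simp add: c_def)
      also have "\<dots> \<le> c * \<bar>T \<phi>h\<bar>" using Tge c by simp
      finally show ?thesis using c by (simp add: Tphi' abs_mult)
    qed
    then have "t < ennreal \<bar>T \<phi>'\<bar>" using \<tau> by (simp add: ennreal_lessI)
    ultimately show "w \<in> {x. t < local_maximal \<mu> n T x}" by simp
  qed
qed

lemma local_maximal_measurable:
  "distribution_on 1 T \<Longrightarrow> local_maximal \<mu> n T \<in> borel_measurable \<mu>"
  using local_maximal_open by (intro borel_measurableI_greater) auto

end

section \<open>Atoms and blocks\<close>

lemma ennreal_recip_le: "0 < y \<Longrightarrow> ennreal y \<le> X \<Longrightarrow> 1 / X \<le> ennreal (1 / y)"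
proof (cases X)
  case (real x)
  assume y: "0 < y" "ennreal y \<le> X"
  then have x: "y \<le> x" using real by simp
  have "1 / X = ennreal (1 / x)" using real x y divide_ennreal[of 1 x] by simp
  also have "\<dots> \<le> ennreal (1 / y)" using x y by (intro ennreal_leI) (simp add: frac_le)
  finally show ?thesis .
qed simp

lemma S_coef_ge_1: "1 \<le> S_coef \<mu> n Q R"
  unfolding S_coef_def by simp

lemma abs_le_suminf_ennreal:
  assumes "f sums x" shows "ennreal \<bar>x\<bar> \<le> (\<Sum>i. ennreal \<bar>f i :: real\<bar>)"
proof (cases "(\<Sum>i. ennreal \<bar>f i\<bar>) = top")
  case False
  then have s: "summable (\<lambda>i. \<bar>f i\<bar>)" by (intro summable_suminf_not_top) auto
  have "\<bar>x\<bar> \<le> (\<Sum>i. \<bar>f i\<bar>)" using summable_rabs[OF s] assms by (simp add: sums_iff)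
  then show ?thesis using s by (simp add: suminf_ennreal2 ennreal_leI)
qed simp

lemma F_loc_nn_integral:
  assumes "\<phi> \<in> F_loc \<mu> n x" shows "(\<integral>\<^sup>+y. ennreal (\<phi> y) \<partial>\<mu>) \<le> 1"
proof -
  have "integrable \<mu> \<phi>" "\<And>y. 0 \<le> \<phi> y" "(LINT y|\<mu>. \<bar>\<phi> y\<bar>) \<le> 1" using assms by (auto simp: F_loc_def F_class_def)
  then show ?thesis using nn_integral_eq_integral[of \<mu> \<phi>] by simp
qed

lemma F_loc_size:
  assumes "\<phi> \<in> F_loc \<mu> n x"
  shows "0 \<le> \<phi> y" "y \<noteq> x \<Longrightarrow> \<phi> y \<le> 1 / norm (y - x) ^ n" "y \<noteq> x \<Longrightarrow> norm (gradient \<phi> y) \<le> 1 / norm (y - x) ^ (n + 1)"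
    "C_k 1 \<phi>" "integrable \<mu> \<phi>"
  using assms by (auto simp: F_loc_def F_class_def)

context poly_growth
begin

text \<open>By \<open>S_coef_real\<close> and S >= 1 this constant satisfies 1 + D <= KA *
  S.\<close>

definition KA :: real where "KA = 1 + 2 ^ n + \<bar>C0\<bar>"

lemma KA_ge_1: "1 \<le> KA" by (simp add: KA_def)

lemma dilate_superset: "is_cube \<mu> Q \<Longrightarrow> cset Q \<subseteq> cset (dilate 2 Q)"
proof (cases Q)
  case (Cube x l)
  assume "is_cube \<mu> Q"
  then show ?thesis using Cube cube_set_mono[of l "2 * l" x] by simp
qed simp

lemma emeasure_cube_finite: "is_cube \<mu> Q \<Longrightarrow> emeasure \<mu> (cset (dilate 2 Q)) < \<infinity>"
  by (cases Q) (auto simp: emeasure_cube)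

lemma cset_sets [measurable]: "cset Q \<in> sets borel"
  by (cases Q) auto

lemma atom_L1:
  assumes "atom \<mu> n R Q a" shows "(\<integral>\<^sup>+x. ennreal \<bar>a x\<bar> \<partial>\<mu>) \<le> 1"
proof -
  define E where "E = emeasure \<mu> (cset (dilate 2 Q))"
  define X where "X = E * S_coef \<mu> n Q R"
  have Q: "is_cube \<mu> Q" and sup: "AE x in \<mu>. x \<notin> cset Q \<longrightarrow> a x = 0" and bd: "AE x in \<mu>. ennreal \<bar>a x\<bar> \<le> 1 / X"
    using assms by (auto simp: atom_def supported_in_def E_def X_def)
  have "(\<integral>\<^sup>+x. ennreal \<bar>a x\<bar> \<partial>\<mu>) \<le> (\<integral>\<^sup>+x. 1 / X * indicator (cset Q) x \<partial>\<mu>)"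
  proof (rule nn_integral_mono_AE, use sup bd in eventually_elim)
    fix x assume "x \<notin> cset Q \<longrightarrow> a x = 0" "ennreal \<bar>a x\<bar> \<le> 1 / X"
    then show "ennreal \<bar>a x\<bar> \<le> 1 / X * indicator (cset Q) x" by (cases "x \<in> cset Q") auto
  qed
  also have "\<dots> = 1 / X * emeasure \<mu> (cset Q)" by (simp add: nn_integral_cmult_indicator)
  also have "\<dots> \<le> 1 / X * E"
    unfolding E_def using dilate_superset[OF Q] by (intro mult_left_mono emeasure_mono) auto
  also have "\<dots> \<le> 1"
  \<comment> \<open>If the double cube has mass 0, the reciprocal is infinite, but its product with
    0 is 0.\<close>
  proof (cases "E = 0")
    case False
    obtain e where e: "E = ennreal e" "0 \<le> e" using emeasure_cube_finite[OF Q] unfolding E_def[symmetric] by (cases E) auto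
    then have e0: "0 < e" using False by (cases "e = 0") auto
    have "E * 1 \<le> X" unfolding X_def using S_coef_ge_1 by (intro mult_left_mono) auto
    then have "1 / X \<le> ennreal (1 / e)" using e e0 by (intro ennreal_recip_le) auto
    then have "1 / X * E \<le> ennreal (1 / e) * ennreal e" unfolding e(1) by (intro mult_right_mono) auto
    also have "\<dots> = 1" using e0 by (simp add: ennreal_mult[symmetric])
    finally show ?thesis .
  qed simp
  finally show ?thesis .
qed

text \<open>Trades S for the density sum up to a free scale \<open>t\<close>, which is possible
  because S grows with the outer cube. The freedom covers the full space and allows large cubes to
  be charged only up to a convenient scale.\<close>

lemma atom_bound:
  assumes "atom \<mu> n R (Cube x l) a" "l \<le> t" "ennreal t \<le> side R"
  shows "AE w in \<mu>. ennreal \<bar>a w\<bar> \<le> ennreal (KA / (m x (2 * l) * (1 + D x l t))) * indicator (cube_set x l) w"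
proof -
  have x: "x \<in> S" "0 < l" and sup: "AE w in \<mu>. w \<notin> cube_set x l \<longrightarrow> a w = 0"
    and bd: "AE w in \<mu>. ennreal \<bar>a w\<bar> \<le> 1 / (emeasure \<mu> (cube_set x (2 * l)) * S_coef \<mu> n (Cube x l) R)"
    using assms by (auto simp: atom_def supported_in_def)
  obtain s where s: "s \<ge> 1" "S_coef \<mu> n (Cube x l) (Cube x t) = ennreal s" "D x l t \<le> 2 ^ n * s + C0"
    using S_coef_real[OF x assms(2)] by blast
  have mp: "0 < m x (2 * l)" using m_pos x by simp
  have "ennreal s \<le> S_coef \<mu> n (Cube x l) R" unfolding s(2)[symmetric] by (rule S_coef_mono) (use assms in simp)
  then have "ennreal (m x (2 * l)) * ennreal s \<le> emeasure \<mu> (cube_set x (2 * l)) * S_coef \<mu> n (Cube x l) R"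
    unfolding emeasure_cube by (intro mult_left_mono) auto
  then have "ennreal (m x (2 * l) * s) \<le> emeasure \<mu> (cube_set x (2 * l)) * S_coef \<mu> n (Cube x l) R"
    using s by (simp add: ennreal_mult)
  then have "1 / (emeasure \<mu> (cube_set x (2 * l)) * S_coef \<mu> n (Cube x l) R) \<le> ennreal (1 / (m x (2 * l) * s))"
    using mp s by (intro ennreal_recip_le) auto
  also have "\<dots> \<le> ennreal (KA / (m x (2 * l) * (1 + D x l t)))"
  proof (rule ennreal_leI)
    have "1 + D x l t \<le> 1 * s + 2 ^ n * s + \<bar>C0\<bar> * s"
      using s mult_left_mono[of 1 s "\<bar>C0\<bar>"] by simp
    then have "1 + D x l t \<le> KA * s" by (simp add: KA_def distrib_right)
    then have "m x (2 * l) * (1 + D x l t) \<le> m x (2 * l) * (KA * s)" using mp by (intro mult_left_mono) auto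
    then show "1 / (m x (2 * l) * s) \<le> KA / (m x (2 * l) * (1 + D x l t))"
    proof -
      have p: "0 < m x (2 * l) * (1 + D x l t)" "0 < m x (2 * l) * s"
        using mp s(1) add_pos_nonneg[OF zero_less_one D_nonneg[of x l t]] by auto
      have "m x (2 * l) * (1 + D x l t) * 1 \<le> KA * (m x (2 * l) * s)"
        using \<open>m x (2 * l) * (1 + D x l t) \<le> m x (2 * l) * (KA * s)\<close> by (simp add: mult_ac)
      then have "1 * (m x (2 * l) * (1 + D x l t)) \<le> KA * (m x (2 * l) * s)" by simp
      then show ?thesis using p by (simp only: pos_divide_le_eq times_divide_eq_left pos_le_divide_eq)
    qed
  qed
  finally have le: "1 / (emeasure \<mu> (cube_set x (2 * l)) * S_coef \<mu> n (Cube x l) R) \<le> ennreal (KA / (m x (2 * l) * (1 + D x l t)))" .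
  show ?thesis using sup bd
    by eventually_elim (use le in \<open>auto simp: indicator_def intro: order_trans\<close>)
qed

lemma block_representation:
  assumes "block \<mu> n R b s"
  obtains c a Q where "\<And>i::nat. atom \<mu> n R (Q i) (a i)"
    "AE x in \<mu>. ennreal \<bar>b x\<bar> \<le> (\<Sum>i. ennreal \<bar>c i\<bar> * ennreal \<bar>a i x\<bar>)"
    "(\<Sum>i. ennreal \<bar>c i\<bar>) = ennreal s" "0 \<le> s"
proof -
  obtain c a Q where r: "\<And>i. atom \<mu> n R (Q i) (a i)" "AE x in \<mu>. (\<lambda>i. c i * a i x) sums b x" "(\<lambda>i. \<bar>c i :: real\<bar>) sums s"
    using assms by (auto simp: block_def)
  have 1: "AE x in \<mu>. ennreal \<bar>b x\<bar> \<le> (\<Sum>i. ennreal \<bar>c i\<bar> * ennreal \<bar>a i x\<bar>)"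
    using r(2)
  proof eventually_elim
    fix x assume "(\<lambda>i. c i * a i x) sums b x"
    from abs_le_suminf_ennreal[OF this]
    show "ennreal \<bar>b x\<bar> \<le> (\<Sum>i. ennreal \<bar>c i\<bar> * ennreal \<bar>a i x\<bar>)" by (simp add: abs_mult ennreal_mult)
  qed
  have 2: "(\<Sum>i. ennreal \<bar>c i\<bar>) = ennreal s" using r(3) by (intro suminf_ennreal_eq) auto
  have 3: "0 \<le> s" by (rule sums_le[OF _ sums_zero r(3)]) simp
  show ?thesis by (rule that[OF r(1) 1 2 3])
qed

text \<open>With a non-negative weight the integral passes through the series of atoms, so a uniform
  estimate for single atoms is enough.\<close>

lemma block_nn_integral_le:
  assumes "block \<mu> n R b s" and w[measurable]: "w \<in> borel_measurable \<mu>" and K: "0 \<le> K"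
    and atoms: "\<And>Q a. atom \<mu> n R Q a \<Longrightarrow> (\<integral>\<^sup>+x. ennreal \<bar>a x\<bar> * w x \<partial>\<mu>) \<le> ennreal K"
  shows "(\<integral>\<^sup>+x. ennreal \<bar>b x\<bar> * w x \<partial>\<mu>) \<le> ennreal (K * s)"
proof -
  obtain c a Q where r: "\<And>i::nat. atom \<mu> n R (Q i) (a i)"
    "AE x in \<mu>. ennreal \<bar>b x\<bar> \<le> (\<Sum>i. ennreal \<bar>c i\<bar> * ennreal \<bar>a i x\<bar>)"
    "(\<Sum>i. ennreal \<bar>c i\<bar>) = ennreal s" "0 \<le> s" using that by (rule block_representation[OF assms(1)])
  have [measurable]: "a i \<in> borel_measurable \<mu>" for i using r(1) by (auto simp: atom_def)
  have "(\<integral>\<^sup>+x. ennreal \<bar>b x\<bar> * w x \<partial>\<mu>) \<le> (\<integral>\<^sup>+x. (\<Sum>i. ennreal \<bar>c i\<bar> * (ennreal \<bar>a i x\<bar> * w x)) \<partial>\<mu>)"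
  proof (rule nn_integral_mono_AE, use r(2) in eventually_elim)
    fix x assume "ennreal \<bar>b x\<bar> \<le> (\<Sum>i. ennreal \<bar>c i\<bar> * ennreal \<bar>a i x\<bar>)"
    then have "ennreal \<bar>b x\<bar> * w x \<le> (\<Sum>i. ennreal \<bar>c i\<bar> * ennreal \<bar>a i x\<bar>) * w x" by (rule mult_right_mono) simp
    then show "ennreal \<bar>b x\<bar> * w x \<le> (\<Sum>i. ennreal \<bar>c i\<bar> * (ennreal \<bar>a i x\<bar> * w x))" by (simp add: mult.assoc[symmetric])
  qed
  also have "\<dots> = (\<Sum>i. ennreal \<bar>c i\<bar> * (\<integral>\<^sup>+x. ennreal \<bar>a i x\<bar> * w x \<partial>\<mu>))"
    by (simp add: nn_integral_suminf nn_integral_cmult)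
  also have "\<dots> \<le> (\<Sum>i. ennreal \<bar>c i\<bar> * ennreal K)"
    using atoms[OF r(1)] by (intro suminf_le mult_left_mono) auto
  also have "\<dots> = ennreal (K * s)" using r(3,4) K by (simp add: ennreal_mult mult.commute)
  finally show ?thesis .
qed

lemma block_L1:
  assumes "block \<mu> n R b s"
  shows "(\<integral>\<^sup>+x. ennreal \<bar>b x\<bar> \<partial>\<mu>) \<le> ennreal s" "integrable \<mu> b" "0 \<le> s"
proof -
  show 1: "(\<integral>\<^sup>+x. ennreal \<bar>b x\<bar> \<partial>\<mu>) \<le> ennreal s"
    using block_nn_integral_le[OF assms, of "\<lambda>_. 1" 1] atom_L1 by simp
  have "b \<in> borel_measurable \<mu>" using assms by (simp add: block_def loc_integrable_def)
  then show "integrable \<mu> b" using 1 by (intro integrableI_bounded) (auto intro: le_less_trans)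
  show "0 \<le> s"
  proof (rule block_representation[OF assms])
    fix c and a :: "nat \<Rightarrow> 'a \<Rightarrow> real" and Q :: "nat \<Rightarrow> 'a cube" assume "0 \<le> s"
    then show "0 \<le> s" .
  qed
qed

section \<open>The maximal function of a block near its cube\<close>

lemma sup_norm_radius:
  fixes w x :: 'a
  obtains t where "0 \<le> t" "\<And>l. w \<in> cube_set x l \<longleftrightarrow> t \<le> l" "\<And>z l. z \<in> cube_set x l \<Longrightarrow> (t - l) / 2 \<le> norm (z - w)"
proof -
  define t where "t = 2 * Max ((\<lambda>b. \<bar>(w - x) \<bullet> b\<bar>) ` Basis)"
  have t: "w \<in> cube_set x l \<longleftrightarrow> t \<le> l" for l
  proof -
    have "t \<le> l \<longleftrightarrow> Max ((\<lambda>b. \<bar>(w - x) \<bullet> b\<bar>) ` Basis) \<le> l / 2" by (auto simp: t_def)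
    also have "\<dots> \<longleftrightarrow> w \<in> cube_set x l" unfolding mem_cube_set by (subst Max_le_iff) auto
    finally show ?thesis ..
  qed
  obtain b :: 'a where "b \<in> Basis" using nonempty_Basis by blast
  then have "\<bar>(w - x) \<bullet> b\<bar> \<le> t / 2" unfolding t_def by simp
  then have t0: "0 \<le> t" using abs_ge_zero[of "(w - x) \<bullet> b"] by linarith
  have tn: "(t - l) / 2 \<le> norm (z - w)" if z: "z \<in> cube_set x l" for z l
  proof (rule field_le_epsilon)
    fix e :: real assume "0 < e"
    then have "w \<notin> cube_set x (t - e)" using t by simp
    from norm_diff_ge_cube_set[OF this z] show "(t - l) / 2 \<le> norm (z - w) + e"
      using \<open>0 < e\<close> by (simp add: norm_minus_commute)
  qed
  show ?thesis by (rule that[OF t0 t tn])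
qed

text \<open>Majorant for the maximal function of an atom on the double of R. On the double of the
  small cube it is the sup bound of the atom, since \<phi> has L^1 norm at most 1; further out it is
  the mass of the atom times |z - w|^-n, with indicators of full cubes in place of annuli.\<close>

definition vnear :: "'a \<Rightarrow> real \<Rightarrow> real \<Rightarrow> 'a \<Rightarrow> ennreal" where
  "vnear x l r w = ennreal (KA / (m x (2 * l) * (1 + D x l r))) * indicator (cube_set x (2 * l)) w +
     (\<Sum>k\<in>scales l (8 * r). ennreal (KA * 8 ^ n / (1 + D x l r) / (2 powi k) ^ n) * indicator (cube_set x (2 powi k)) w)"

lemma vnear_measurable [measurable]: "vnear x l r \<in> borel_measurable borel"
  unfolding vnear_def by measurable

text \<open>The contributions of the annuli add up to the density sum from \<open>l\<close> to
  \<open>8 * r\<close>, and the denominator \<open>1 + D x l r\<close> cancels it up to a constant.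
  This is where the factor 1/S in the size of an atom is spent.\<close>

lemma vnear_integral:
  assumes "x \<in> S" "0 < l" "l \<le> r"
  shows "(\<integral>\<^sup>+w. vnear x l r w \<partial>\<mu>) \<le> ennreal (KA + KA * 8 ^ n * (1 + 4 * \<bar>C0\<bar>))"
proof -
  define d where "d = 1 + D x l r"
  have d: "1 \<le> d" by (simp add: d_def)
  have mp: "0 < m x (2 * l)" using m_pos assms by simp
  have K: "0 \<le> KA" using KA_ge_1 by simp
  have "(\<integral>\<^sup>+w. vnear x l r w \<partial>\<mu>) = ennreal (KA / (m x (2 * l) * d)) * ennreal (m x (2 * l)) +
      (\<Sum>k\<in>scales l (8 * r). ennreal (KA * 8 ^ n / d / (2 powi k) ^ n) * ennreal (m x (2 powi k)))"
    unfolding vnear_def d_def[symmetric]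
    by (simp add: nn_integral_add nn_integral_sum nn_integral_cmult_indicator emeasure_cube)
  also have "\<dots> = ennreal (KA / d) + (\<Sum>k\<in>scales l (8 * r). ennreal (KA * 8 ^ n / d * (m x (2 powi k) / (2 powi k) ^ n)))"
    using mp d K by (intro arg_cong2[where f="(+)"] sum.cong refl) (simp_all add: ennreal_mult[symmetric])
  also have "\<dots> = ennreal (KA / d + KA * 8 ^ n / d * D x l (8 * r))"
    using d K by (simp add: D_def sum_distrib_left sum_nonneg)
  also have "\<dots> \<le> ennreal (KA + KA * 8 ^ n * (1 + 4 * \<bar>C0\<bar>))"
  proof (intro ennreal_leI add_mono)
    show "KA / d \<le> KA" using K d by (simp add: divide_le_eq mult_le_cancel_left1)
    have "log 2 (8::real) = 3" using log_pow_cancel[of "2::real" 3] by simp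
    then have "D x r (8 * r) \<le> 4 * \<bar>C0\<bar>"
      using D_le_log[of x r "8 * r"] assms C0_pos[of x] by simp
    then have "D x l (8 * r) \<le> D x l r + 4 * \<bar>C0\<bar>" using D_split[of l r x "8 * r"] assms by simp
    also have "\<dots> \<le> d * (1 + 4 * \<bar>C0\<bar>)" by (simp add: d_def algebra_simps)
    finally have "KA * 8 ^ n / d * D x l (8 * r) \<le> KA * 8 ^ n / d * (d * (1 + 4 * \<bar>C0\<bar>))"
      using K d by (intro mult_left_mono) auto
    then show "KA * 8 ^ n / d * D x l (8 * r) \<le> KA * 8 ^ n * (1 + 4 * \<bar>C0\<bar>)" using d by simp
  qed
  finally show ?thesis .
qed

lemma atom_maximal_near:
  assumes a: "atom \<mu> n (Cube y r) (Cube x l) a" and w: "w \<in> cube_set y (2 * r)" and phi: "\<phi> \<in> F_loc \<mu> n w"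
  shows "(\<integral>\<^sup>+z. ennreal \<bar>a z\<bar> * ennreal (\<phi> z) \<partial>\<mu>) \<le> vnear x l r w"
proof -
  have x: "x \<in> S" "0 < l" and sub: "cube_set x l \<subseteq> cube_set y r" using a by (auto simp: atom_def)
  have lr: "l \<le> r" "x \<in> cube_set y r" using cube_set_subsetD[OF sub] x by auto
  have mp: "0 < m x (2 * l)" "m x l \<le> m x (2 * l)" using m_pos x by (auto intro: m_mono_side)
  define A where "A = KA / (m x (2 * l) * (1 + D x l r))"
  have A0: "0 \<le> A" using KA_ge_1 by (simp add: A_def)
  have bd: "AE z in \<mu>. ennreal \<bar>a z\<bar> \<le> ennreal A * indicator (cube_set x l) z"
    unfolding A_def by (rule atom_bound[OF a lr(1)]) simp
  have [measurable]: "\<phi> \<in> borel_measurable \<mu>" using F_loc_size(5)[OF phi] by simp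
  show ?thesis
  proof (cases "w \<in> cube_set x (2 * l)")
    case True
    have "(\<integral>\<^sup>+z. ennreal \<bar>a z\<bar> * ennreal (\<phi> z) \<partial>\<mu>) \<le> (\<integral>\<^sup>+z. ennreal A * ennreal (\<phi> z) \<partial>\<mu>)"
    proof (rule nn_integral_mono_AE, use bd in eventually_elim)
      fix z assume "ennreal \<bar>a z\<bar> \<le> ennreal A * indicator (cube_set x l) z"
      also have "\<dots> \<le> ennreal A * 1" by (intro mult_left_mono) (auto simp: indicator_def)
      finally show "ennreal \<bar>a z\<bar> * ennreal (\<phi> z) \<le> ennreal A * ennreal (\<phi> z)" by (intro mult_right_mono) auto
    qed
    also have "\<dots> = ennreal A * (\<integral>\<^sup>+z. ennreal (\<phi> z) \<partial>\<mu>)" by (simp add: nn_integral_cmult)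
    also have "\<dots> \<le> ennreal A * 1" using F_loc_nn_integral[OF phi] by (intro mult_left_mono) auto
    also have "\<dots> \<le> vnear x l r w" using True by (simp add: vnear_def A_def)
    finally show ?thesis .
  next
    case False
    obtain t where t: "\<And>l. w \<in> cube_set x l \<longleftrightarrow> t \<le> l" "\<And>z l. z \<in> cube_set x l \<Longrightarrow> (t - l) / 2 \<le> norm (z - w)"
      using sup_norm_radius[of w x] by metis
    have t2: "2 * l < t" using False t by simp
    have "w \<in> cube_set x (3 * r)" using mem_cube_set_trans[OF w, of x r "3 * r"] lr mem_cube_set_commute by force
    then have t3: "t \<le> 3 * r" using t by simp
    \<comment> \<open>The scale of \<open>w\<close> as seen from \<open>x\<close>, rounded up to a
      power of 2. As \<open>w\<close> lies in the double of R, t <= 3 r, and the rounded value stays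
      below 8 r.\<close>
    define k where "k = \<lceil>log 2 t\<rceil>"
    have k: "t \<le> 2 powi k" "2 powi k < 2 * t"
    proof -
      have tp: "0 < t" using t2 x by simp
      have "2 powi k = (2::real) powr k" by (simp add: powr_real_of_int')
      moreover have "log 2 t \<le> k" "k < log 2 t + 1" unfolding k_def by linarith+
      moreover have "2 powr (log 2 t + 1) = 2 * t" using tp by (simp add: powr_add)
      ultimately show "t \<le> 2 powi k" "2 powi k < 2 * t" using tp
        by (auto simp: log_le_iff) (metis one_less_numeral_iff powr_less_cancel_iff semiring_norm(76))
    qed
    have p0: "0 < (2::real) powi k" by simp
    have kin: "k \<in> scales l (8 * r)" using k t2 t3 x by (simp add: scales_def)
    define B :: real where "B = 8 ^ n / (2 powi k) ^ n"
    have phiB: "\<phi> z \<le> B" if z: "z \<in> cube_set x l" for z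
    proof -
      have "(t - l) / 2 \<le> norm (z - w)" by (rule t(2)[OF z])
      \<comment> \<open>From 2 l < t it follows that (t - l) / 2 > t / 4, and the rounded scale is
        below 2 t; this is the origin of \<open>8 ^ n\<close> in \<open>vnear\<close>.\<close>
      then have "t / 4 \<le> norm (z - w)" using t2 by argo
      then have nz: "2 powi k / 8 \<le> norm (z - w)" using k(2) by argo
      have "0 < norm (z - w)" using nz p0 by argo
      then have "z \<noteq> w" by auto
      then have "\<phi> z \<le> 1 / norm (z - w) ^ n" by (rule F_loc_size(2)[OF phi])
      also have "\<dots> \<le> 1 / (2 powi k / 8) ^ n" using nz p0 by (intro frac_le power_mono zero_less_power) auto
      also have "\<dots> = B" by (simp add: B_def power_divide)
      finally show ?thesis .
    qed
    have B0: "0 \<le> B" by (simp add: B_def)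
    have "(\<integral>\<^sup>+z. ennreal \<bar>a z\<bar> * ennreal (\<phi> z) \<partial>\<mu>) \<le> (\<integral>\<^sup>+z. ennreal (A * B) * indicator (cube_set x l) z \<partial>\<mu>)"
    proof (rule nn_integral_mono_AE, use bd in eventually_elim)
      fix z assume az: "ennreal \<bar>a z\<bar> \<le> ennreal A * indicator (cube_set x l) z"
      show "ennreal \<bar>a z\<bar> * ennreal (\<phi> z) \<le> ennreal (A * B) * indicator (cube_set x l) z"
      proof (cases "z \<in> cube_set x l")
        case True
        then have "ennreal \<bar>a z\<bar> * ennreal (\<phi> z) \<le> ennreal A * ennreal B"
          using az phiB by (intro mult_mono) (auto intro: ennreal_leI)
        then show ?thesis using True A0 B0 by (simp add: ennreal_mult)
      next
        case False
        then have "ennreal \<bar>a z\<bar> = 0" using az by simp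
        then show ?thesis by (simp only: mult_zero_left zero_le)
      qed
    qed
    also have "\<dots> = ennreal (A * B * m x l)" using A0 B0 by (simp add: nn_integral_cmult_indicator emeasure_cube ennreal_mult[symmetric])
    also have "\<dots> \<le> ennreal (A * B * m x (2 * l))" using mp A0 B0 by (intro ennreal_leI mult_left_mono) auto
    also have "A * B * m x (2 * l) = KA * 8 ^ n / (1 + D x l r) / (2 powi k) ^ n"
      using mp by (simp add: A_def B_def)
    also have "ennreal \<dots> = ennreal (KA * 8 ^ n / (1 + D x l r) / (2 powi k) ^ n) * indicator (cube_set x (2 powi k)) w"
      using t(1) k(1) by simp
    also have "\<dots> \<le> (\<Sum>k\<in>scales l (8 * r). ennreal (KA * 8 ^ n / (1 + D x l r) / (2 powi k) ^ n) * indicator (cube_set x (2 powi k)) w)"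
      using kin by (intro member_le_sum finite_scales x) auto
    also have "\<dots> \<le> vnear x l r w" by (simp add: vnear_def)
    finally show ?thesis .
  qed
qed

lemma block_maximal_near:
  obtains K where "0 \<le> K" "\<And>y r b s. block \<mu> n (Cube y r) b s \<Longrightarrow> \<exists>u\<in>borel_measurable \<mu>. (\<integral>\<^sup>+w. u w \<partial>\<mu>) \<le> ennreal (K * s) \<and>
     (\<forall>w\<in>cube_set y (2 * r). \<forall>\<phi>\<in>F_loc \<mu> n w. ennreal \<bar>LINT z|\<mu>. b z * \<phi> z\<bar> \<le> u w)"
proof
  define K where "K = KA + KA * 8 ^ n * (1 + 4 * \<bar>C0\<bar>)"
  show K0: "0 \<le> K" using KA_ge_1 by (simp add: K_def)
  fix y :: 'a and r b s assume b: "block \<mu> n (Cube y r) b s"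
  obtain c a Q where rep: "\<And>i::nat. atom \<mu> n (Cube y r) (Q i) (a i)"
    "AE x in \<mu>. ennreal \<bar>b x\<bar> \<le> (\<Sum>i. ennreal \<bar>c i\<bar> * ennreal \<bar>a i x\<bar>)"
    "(\<Sum>i. ennreal \<bar>c i\<bar>) = ennreal s" "0 \<le> s" using that by (rule block_representation[OF b])
  have [measurable]: "a i \<in> borel_measurable \<mu>" for i using rep(1) by (auto simp: atom_def)
  \<comment> \<open>A bounded cube does not contain the full space, so all atoms of the block live
    on bounded cubes.\<close>
  have "\<forall>i. \<exists>x l. Q i = Cube x l"
  proof
    fix i
    have "cset (Q i) \<subseteq> cube_set y r" using rep(1)[of i] by (simp add: atom_def)
    moreover have "\<not> UNIV \<subseteq> cube_set y r"
      using compact_imp_bounded[OF compact_cube_set[of y r]] not_bounded_UNIV bounded_subset by blast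
    ultimately show "\<exists>x l. Q i = Cube x l" by (cases "Q i") auto
  qed
  then obtain x l where Q: "\<And>i. Q i = Cube (x i) (l i)" by metis
  have xl: "x i \<in> S" "0 < l i" "l i \<le> r" for i
    using rep(1)[of i] cube_set_subsetD[of "x i" "l i" y r] by (auto simp: Q atom_def)
  define u where "u w = (\<Sum>i. ennreal \<bar>c i\<bar> * vnear (x i) (l i) r w)" for w
  have "(\<integral>\<^sup>+w. u w \<partial>\<mu>) = (\<Sum>i. ennreal \<bar>c i\<bar> * (\<integral>\<^sup>+w. vnear (x i) (l i) r w \<partial>\<mu>))"
    unfolding u_def by (simp add: nn_integral_suminf nn_integral_cmult)
  also have "\<dots> \<le> (\<Sum>i. ennreal \<bar>c i\<bar> * ennreal K)"
    unfolding K_def using xl by (intro suminf_le mult_left_mono vnear_integral) auto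
  also have "\<dots> = ennreal (K * s)" using rep(3,4) K0 by (simp add: ennreal_mult mult.commute)
  finally have 1: "(\<integral>\<^sup>+w. u w \<partial>\<mu>) \<le> ennreal (K * s)" .
  have 2: "ennreal \<bar>LINT z|\<mu>. b z * \<phi> z\<bar> \<le> u w" if w: "w \<in> cube_set y (2 * r)" and phi: "\<phi> \<in> F_loc \<mu> n w" for w \<phi>
  proof -
    have [measurable]: "\<phi> \<in> borel_measurable \<mu>" using F_loc_size(5)[OF phi] by simp
    have p0: "0 \<le> \<phi> z" for z by (rule F_loc_size(1)[OF phi])
    have "ennreal \<bar>LINT z|\<mu>. b z * \<phi> z\<bar> \<le> (\<integral>\<^sup>+z. ennreal \<bar>b z * \<phi> z\<bar> \<partial>\<mu>)"
      using integral_norm_bound_ennreal[of \<mu> "\<lambda>z. b z * \<phi> z"]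
      by (cases "integrable \<mu> (\<lambda>z. b z * \<phi> z)") (auto simp: not_integrable_integral_eq)
    also have "\<dots> \<le> (\<integral>\<^sup>+z. (\<Sum>i. ennreal \<bar>c i\<bar> * (ennreal \<bar>a i z\<bar> * ennreal (\<phi> z))) \<partial>\<mu>)"
    proof (rule nn_integral_mono_AE, use rep(2) in eventually_elim)
      fix z assume "ennreal \<bar>b z\<bar> \<le> (\<Sum>i. ennreal \<bar>c i\<bar> * ennreal \<bar>a i z\<bar>)"
      then have "ennreal \<bar>b z\<bar> * ennreal (\<phi> z) \<le> (\<Sum>i. ennreal \<bar>c i\<bar> * ennreal \<bar>a i z\<bar>) * ennreal (\<phi> z)" by (rule mult_right_mono) simp
      then show "ennreal \<bar>b z * \<phi> z\<bar> \<le> (\<Sum>i. ennreal \<bar>c i\<bar> * (ennreal \<bar>a i z\<bar> * ennreal (\<phi> z)))"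
        using p0[of z] by (simp add: mult.assoc[symmetric] abs_mult ennreal_mult)
    qed
    also have "\<dots> = (\<Sum>i. ennreal \<bar>c i\<bar> * (\<integral>\<^sup>+z. ennreal \<bar>a i z\<bar> * ennreal (\<phi> z) \<partial>\<mu>))"
      by (simp add: nn_integral_suminf nn_integral_cmult)
    also have "\<dots> \<le> u w" unfolding u_def
    proof (intro suminf_le mult_left_mono)
      fix i
      have ai: "atom \<mu> n (Cube y r) (Cube (x i) (l i)) (a i)" using rep(1)[of i] by (simp only: Q)
      show "(\<integral>\<^sup>+z. ennreal \<bar>a i z\<bar> * ennreal (\<phi> z) \<partial>\<mu>) \<le> vnear (x i) (l i) r w"
        by (rule atom_maximal_near[OF ai w phi])
    qed auto
    finally show ?thesis .
  qed
  have "u \<in> borel_measurable \<mu>" unfolding u_def by measurable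
  then show "\<exists>u\<in>borel_measurable \<mu>. (\<integral>\<^sup>+w. u w \<partial>\<mu>) \<le> ennreal (K * s) \<and>
     (\<forall>w\<in>cube_set y (2 * r). \<forall>\<phi>\<in>F_loc \<mu> n w. ennreal \<bar>LINT z|\<mu>. b z * \<phi> z\<bar> \<le> u w)"
    using 1 2 by blast
qed

section \<open>Cancellation and decay away from the cube\<close>

lemma cancellation_bound:
  assumes b: "block \<mu> n (Cube y r) b s" and b0: "(LINT z|\<mu>. b z) = 0"
    and phi: "integrable \<mu> (\<lambda>z. b z * \<phi> z)"
    and osc: "\<And>z. z \<in> cube_set y r \<Longrightarrow> \<bar>\<phi> z - \<phi> y\<bar> \<le> B" and B: "0 \<le> B"
  shows "\<bar>LINT z|\<mu>. b z * \<phi> z\<bar> \<le> B * s"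
proof -
  note bL = block_L1[OF b]
  have sup: "AE z in \<mu>. z \<notin> cube_set y r \<longrightarrow> b z = 0" using b by (simp add: block_def supported_in_def)
  have "(LINT z|\<mu>. b z * \<phi> z) = (LINT z|\<mu>. b z * \<phi> z - b z * \<phi> y)"
    using phi bL(2) b0 by simp
  also have "ennreal \<bar>\<dots>\<bar> \<le> (\<integral>\<^sup>+z. ennreal \<bar>b z * \<phi> z - b z * \<phi> y\<bar> \<partial>\<mu>)"
    using integral_norm_bound_ennreal[of \<mu> "\<lambda>z. b z * \<phi> z - b z * \<phi> y"] phi bL(2) by simp
  also have "\<dots> \<le> (\<integral>\<^sup>+z. ennreal B * ennreal \<bar>b z\<bar> \<partial>\<mu>)"
  proof (rule nn_integral_mono_AE, use sup in eventually_elim)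
    fix z assume z: "z \<notin> cube_set y r \<longrightarrow> b z = 0"
    have "\<bar>b z * \<phi> z - b z * \<phi> y\<bar> = \<bar>\<phi> z - \<phi> y\<bar> * \<bar>b z\<bar>" by (simp add: right_diff_distrib[symmetric] abs_mult)
    also have "\<dots> \<le> B * \<bar>b z\<bar>" using z osc by (cases "z \<in> cube_set y r") (auto intro: mult_right_mono)
    finally show "ennreal \<bar>b z * \<phi> z - b z * \<phi> y\<bar> \<le> ennreal B * ennreal \<bar>b z\<bar>" using B by (simp add: ennreal_mult[symmetric] ennreal_leI)
  qed
  also have "\<dots> = ennreal B * (\<integral>\<^sup>+z. ennreal \<bar>b z\<bar> \<partial>\<mu>)" using bL(2) by (intro nn_integral_cmult) auto
  also have "\<dots> \<le> ennreal B * ennreal s" by (intro mult_left_mono bL) simp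
  also have "\<dots> = ennreal (B * s)" using B bL(3) by (simp add: ennreal_mult)
  finally show ?thesis using B bL(3) by simp
qed

lemma product_integrable:
  fixes b \<phi> :: "'a \<Rightarrow> real"
  assumes "integrable \<mu> b" "\<phi> \<in> borel_measurable \<mu>" "\<And>y. \<bar>\<phi> y\<bar> \<le> A"
  shows "integrable \<mu> (\<lambda>z. b z * \<phi> z)"
proof (rule Bochner_Integration.integrable_bound[of _ "\<lambda>z. A * b z"])
  have "\<bar>b z * \<phi> z\<bar> \<le> \<bar>A * b z\<bar>" for z
    using assms(3)[of z] mult_right_mono[of "\<bar>\<phi> z\<bar>" "\<bar>A\<bar>" "\<bar>b z\<bar>"] by (simp add: abs_mult mult.commute)
  then show "AE z in \<mu>. norm (b z * \<phi> z) \<le> norm (A * b z)" by simp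
qed (use assms in auto)

text \<open>Majorant off the double cube. The power of 1/2 comes from cancellation, and the factor
  \<open>Suc k\<close> makes room for the growth of the reference mean relative to \<open>G\<close>
  when \<open>w\<close> lies in the dilate by \<open>2 ^ Suc k\<close>.\<close>

definition qfar :: "'a \<Rightarrow> real \<Rightarrow> 'a \<Rightarrow> ennreal" where
  "qfar y r w = (\<Sum>k. ennreal (real (Suc k) * (1/2) ^ k / (2 ^ k * r) ^ n) * indicator (cube_set y (2 ^ Suc k * r)) w)"

lemma qfar_measurable [measurable]: "qfar y r \<in> borel_measurable borel"
  unfolding qfar_def by measurable

lemma qfar_integral:
  assumes "y \<in> S" "0 < r"
  shows "(\<integral>\<^sup>+w. qfar y r w \<partial>\<mu>) \<le> ennreal (\<bar>C0\<bar> * 2 ^ n * 4)"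
proof -
  have "(\<integral>\<^sup>+w. qfar y r w \<partial>\<mu>) = (\<Sum>k. ennreal (real (Suc k) * (1/2) ^ k / (2 ^ k * r) ^ n) * ennreal (m y (2 ^ Suc k * r)))"
    unfolding qfar_def by (simp add: nn_integral_suminf nn_integral_cmult_indicator emeasure_cube del: power_Suc)
  also have "\<dots> \<le> (\<Sum>k. ennreal (\<bar>C0\<bar> * 2 ^ n * (real (Suc k) * (1/2) ^ k)))"
  proof (intro suminf_le)
    fix k
    have p: "0 < 2 ^ k * r" using assms by simp
    have "m y (2 ^ Suc k * r) \<le> \<bar>C0\<bar> * (2 * (2 ^ k * r)) ^ n"
      using m_le[OF assms(1), of "2 ^ Suc k * r"] C0_pos[OF assms(1)] assms by (simp add: mult.assoc)
    also have "\<dots> = \<bar>C0\<bar> * 2 ^ n * (2 ^ k * r) ^ n" by (simp only: power_mult_distrib mult.assoc)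
    finally have "real (Suc k) * (1/2) ^ k / (2 ^ k * r) ^ n * m y (2 ^ Suc k * r) \<le>
        real (Suc k) * (1/2) ^ k / (2 ^ k * r) ^ n * (\<bar>C0\<bar> * 2 ^ n * (2 ^ k * r) ^ n)"
      using p by (intro mult_left_mono) auto
    also have "\<dots> = \<bar>C0\<bar> * 2 ^ n * (real (Suc k) * (1/2) ^ k)"
    proof -
      have "X / q * (c * q) = c * X" if "0 < q" for X c q :: real using that by simp
      from this[OF zero_less_power[OF p]] show ?thesis .
    qed
    finally show "ennreal (real (Suc k) * (1/2) ^ k / (2 ^ k * r) ^ n) * ennreal (m y (2 ^ Suc k * r)) \<le> ennreal (\<bar>C0\<bar> * 2 ^ n * (real (Suc k) * (1/2) ^ k))"
      using p by (subst ennreal_mult[symmetric]) (auto intro!: ennreal_leI simp del: of_nat_Suc power_Suc)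
  qed auto
  also have "\<dots> = ennreal (\<bar>C0\<bar> * 2 ^ n * 4)"
  proof (rule suminf_ennreal_eq)
    have "(\<lambda>k. real (Suc k) * (1/2) ^ k) sums (1 / (1 - 1/2)^2)" by (rule geometric_deriv_sums) simp
    then show "(\<lambda>k. \<bar>C0\<bar> * 2 ^ n * (real (Suc k) * (1/2) ^ k)) sums (\<bar>C0\<bar> * 2 ^ n * 4)"
      using sums_mult[of "\<lambda>k. real (Suc k) * (1/2) ^ k" 4 "\<bar>C0\<bar> * 2 ^ n"] by (simp add: power2_eq_square)
  qed simp
  finally show ?thesis .
qed

text \<open>Off the double of \<open>R\<close> the cancellation of \<open>b\<close> gives decay one order better than that of \<open>\<phi>\<close>.\<close>

lemma maximal_far:
  assumes b: "block \<mu> n (Cube y r) b s" and b0: "(LINT z|\<mu>. b z) = 0" and r: "0 < r"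
    and w: "w \<notin> cube_set y (2 ^ k * r)" "1 \<le> k" and phi: "\<phi> \<in> F_loc \<mu> n w"
  shows "\<bar>LINT z|\<mu>. b z * \<phi> z\<bar> \<le> 4 ^ (n + 1) * real DIM('a) * ((1/2) ^ k / (2 ^ k * r) ^ n) * s"
proof -
  note C = F_loc_size(4)[OF phi]
  \<comment> \<open>A lower bound for the distance, since (2^k - 1) r / 2 >= 2^k r / 4 for k >= 1.
    It holds on the whole cube and hence on all segments that enter the mean value theorem.\<close>
  define g where "g = 2 ^ k * r / 4"
  have g: "0 < g" using r by (simp add: g_def)
  have far: "g \<le> norm (z - w)" if z: "z \<in> cube_set y r" for z
  proof -
    have "(2 ^ k * r - r) / 2 \<le> norm (w - z)" by (rule norm_diff_ge_cube_set[OF w(1) z])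
    moreover have "2 * r \<le> 2 ^ k * r" using w(2) r power_increasing[of 1 k "2::real"] by (intro mult_right_mono) auto
    ultimately show ?thesis by (simp add: g_def norm_minus_commute)
  qed
  obtain A where A: "C1_bound \<phi> A" using that by (rule test_function_bound[OF F_loc_test[OF phi] order_refl])
  have intb: "integrable \<mu> (\<lambda>z. b z * \<phi> z)"
    using block_L1(2)[OF b] C1_boundD(1)[OF A] F_loc_size(5)[OF phi] by (intro product_integrable) auto
  define B where "B = 1 / g ^ (n + 1) * (real DIM('a) * r / 2)"
  have "\<bar>LINT z|\<mu>. b z * \<phi> z\<bar> \<le> B * s"
  proof (rule cancellation_bound[OF b b0 intb])
    show "0 \<le> B" using g r by (simp add: B_def)
    fix z assume z: "z \<in> cube_set y r"
    have "\<bar>\<phi> z - \<phi> y\<bar> \<le> 1 / g ^ (n + 1) * norm (z - y)"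
    proof (rule C1_mvt[OF C _ _ z])
      show "convex (cube_set y r)" by (simp add: cube_set_def)
      show "y \<in> cube_set y r" using r by (simp add: center_mem_cube_set)
      fix v assume v: "v \<in> cube_set y r"
      have nv: "g \<le> norm (v - w)" by (rule far[OF v])
      then have "v \<noteq> w" using g by auto
      then have "norm (gradient \<phi> v) \<le> 1 / norm (v - w) ^ (n + 1)" by (rule F_loc_size(3)[OF phi])
      also have "\<dots> \<le> 1 / g ^ (n + 1)" using nv g by (intro frac_le power_mono zero_less_power) auto
      finally show "norm (gradient \<phi> v) \<le> 1 / g ^ (n + 1)" .
    qed
    also have "\<dots> \<le> B" unfolding B_def using norm_diff_le_cube_set[OF z] g by (intro mult_left_mono) auto
    finally show "\<bar>\<phi> z - \<phi> y\<bar> \<le> B" .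
  qed
  also have "\<dots> \<le> 4 ^ (n + 1) * real DIM('a) * ((1/2) ^ k / (2 ^ k * r) ^ n) * s"
  proof (rule mult_right_mono)
    define X where "X = (1/2) ^ k / (2 ^ k * r) ^ n"
    have "0 \<le> X" using r by (simp add: X_def)
    then have X: "X / 2 \<le> X" by simp
    have "B = 4 ^ (n + 1) * real DIM('a) * (r / 2 / (2 ^ k * r) ^ (n + 1))" by (simp add: B_def g_def power_divide)
    also have "r / 2 / (2 ^ k * r) ^ (n + 1) = X / 2" using r by (simp add: X_def power_divide)
    also have "4 ^ (n + 1) * real DIM('a) * (X / 2) \<le> 4 ^ (n + 1) * real DIM('a) * X" using X by (rule mult_left_mono) simp
    finally show "B \<le> 4 ^ (n + 1) * real DIM('a) * ((1/2) ^ k / (2 ^ k * r) ^ n)" by (simp add: X_def)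
  qed (rule block_L1(3)[OF b])
  finally show ?thesis .
qed

end

section \<open>Products with blocks\<close>

lemma integrable_nn_integral_le:
  fixes g :: "'a \<Rightarrow> real"
  assumes "g \<in> borel_measurable M" "(\<integral>\<^sup>+x. ennreal \<bar>g x\<bar> \<partial>M) \<le> ennreal t" "0 \<le> t"
  shows "integrable M g" "(LINT x|M. \<bar>g x\<bar>) \<le> t"
proof -
  show int: "integrable M g" using assms by (intro integrableI_bounded) (auto intro: le_less_trans)
  have "ennreal (LINT x|M. \<bar>g x\<bar>) = (\<integral>\<^sup>+x. ennreal \<bar>g x\<bar> \<partial>M)"
    using int by (intro nn_integral_eq_integral[symmetric]) auto
  then have "ennreal (LINT x|M. \<bar>g x\<bar>) \<le> ennreal t" using assms(2) by simp
  then show "(LINT x|M. \<bar>g x\<bar>) \<le> t" using assms(3) by (subst (asm) ennreal_le_iff) auto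
qed

lemma L1_series:
  fixes e :: "nat \<Rightarrow> 'a \<Rightarrow> real"
  assumes meas: "\<And>j. e j \<in> borel_measurable M"
    and bd: "\<And>j. (\<integral>\<^sup>+x. ennreal \<bar>e j x\<bar> \<partial>M) \<le> ennreal (t j)" and t: "summable t" "\<And>j. 0 \<le> t j"
  shows "integrable M (e j)" and "(LINT x|M. \<bar>e j x\<bar>) \<le> t j"
    and "AE x in M. summable (\<lambda>j. \<bar>e j x\<bar>)" and "integrable M (\<lambda>x. \<Sum>j. e j x)"
proof -
  show int: "integrable M (e j)" and L1: "(LINT x|M. \<bar>e j x\<bar>) \<le> t j" for j
    by (rule integrable_nn_integral_le[OF meas bd t(2)])+
  have "(\<integral>\<^sup>+x. (\<Sum>j. ennreal \<bar>e j x\<bar>) \<partial>M) = (\<Sum>j. \<integral>\<^sup>+x. ennreal \<bar>e j x\<bar> \<partial>M)"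
    using meas by (intro nn_integral_suminf) measurable
  also have "\<dots> \<le> (\<Sum>j. ennreal (t j))" using bd by (intro suminf_le) auto
  also have "\<dots> < \<infinity>" using t by (simp add: suminf_ennreal2)
  finally have "AE x in M. (\<Sum>j. ennreal \<bar>e j x\<bar>) \<noteq> \<infinity>"
    using meas by (intro nn_integral_noteq_infinite) auto
  then show sm: "AE x in M. summable (\<lambda>j. \<bar>e j x\<bar>)"
    by eventually_elim (auto intro: summable_suminf_not_top)
  have "summable (\<lambda>j. LINT x|M. \<bar>e j x\<bar>)"
    using t(1) L1 by (intro summable_comparison_test[OF _ t(1)]) auto
  then show "integrable M (\<lambda>x. \<Sum>j. e j x)" using int sm by (intro integrable_suminf) auto
qed

context rbmo_function
begin

lemma osc_weighted:
  assumes "AE w in \<mu>. ennreal \<bar>a w\<bar> \<le> ennreal A * indicator (cube_set x l) w" "0 \<le> A"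
  shows "(\<integral>\<^sup>+w. ennreal \<bar>a w\<bar> * ennreal \<bar>f w - c\<bar> \<partial>\<mu>) \<le> ennreal (A * osc c x l)"
proof -
  have "(\<integral>\<^sup>+w. ennreal \<bar>a w\<bar> * ennreal \<bar>f w - c\<bar> \<partial>\<mu>) \<le> (\<integral>\<^sup>+w. ennreal A * (ennreal \<bar>f w - c\<bar> * indicator (cube_set x l) w) \<partial>\<mu>)"
  proof (rule nn_integral_mono_AE, use assms(1) in eventually_elim)
    fix w assume "ennreal \<bar>a w\<bar> \<le> ennreal A * indicator (cube_set x l) w"
    then have "ennreal \<bar>a w\<bar> * ennreal \<bar>f w - c\<bar> \<le> ennreal A * indicator (cube_set x l) w * ennreal \<bar>f w - c\<bar>"
      by (rule mult_right_mono) simp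
    then show "ennreal \<bar>a w\<bar> * ennreal \<bar>f w - c\<bar> \<le> ennreal A * (ennreal \<bar>f w - c\<bar> * indicator (cube_set x l) w)"
      by (simp add: mult_ac)
  qed
  also have "\<dots> = ennreal A * (\<integral>\<^sup>+w\<in>cube_set x l. ennreal \<bar>f w - c\<bar> \<partial>\<mu>)" by (intro nn_integral_cmult) measurable
  also have "\<dots> = ennreal (A * osc c x l)" unfolding osc_nn using assms(2) osc_nonneg by (simp add: ennreal_mult)
  finally show ?thesis .
qed

text \<open>Replacing \<open>F x l\<close> by \<open>c\<close> costs a multiple of 1 + D, which the
  same factor in the denominator of the atom bound compensates.\<close>

lemma osc_weighted_F:
  assumes x: "x \<in> S" "0 < l" and c: "\<bar>F x l - c\<bar> \<le> B * (1 + D x l t)" and B: "0 \<le> B"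
  shows "KA / (m x (2 * l) * (1 + D x l t)) * osc c x l \<le> KA * (KF + B)"
proof -
  have mp: "0 < m x (2 * l)" using m_pos x by simp
  define d where "d = 1 + D x l t"
  have d: "1 \<le> d" by (simp add: d_def)
  have "osc c x l \<le> osc (F x l) x l + \<bar>F x l - c\<bar> * m x l" by (rule osc_triangle)
  also have "\<dots> \<le> KF * m x (2 * l) * d + B * d * m x (2 * l)"
  proof (intro add_mono mult_mono)
    have "KF * m x (2 * l) * 1 \<le> KF * m x (2 * l) * d" using d KF_nonneg by (intro mult_left_mono) auto
    then show "osc (F x l) x l \<le> KF * m x (2 * l) * d" using F_osc[OF x] by simp
    show "m x l \<le> m x (2 * l)" using x by (intro m_mono_side) simp
  qed (use c B d in \<open>auto simp: d_def\<close>)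
  also have "\<dots> = (m x (2 * l) * d) * (KF + B)" by (simp add: algebra_simps)
  finally have "KA / (m x (2 * l) * d) * osc c x l \<le> KA / (m x (2 * l) * d) * ((m x (2 * l) * d) * (KF + B))"
    using mp d KA_ge_1 by (intro mult_left_mono) auto
  also have "\<dots> = KA * (KF + B)" using mp d by simp
  finally show ?thesis by (simp add: d_def)
qed

lemma atom_product_small:
  assumes a: "atom \<mu> n (Cube y r) Q a" and y: "y \<in> S"
  shows "(\<integral>\<^sup>+w. ennreal \<bar>a w\<bar> * ennreal \<bar>f w - F y r\<bar> \<partial>\<mu>) \<le> ennreal (KA * (KF + KF))"
proof -
  obtain x l where Q: "Q = Cube x l"
  proof (cases Q)
    case Whole
    then have "UNIV \<subseteq> cube_set y r" using a by (simp add: atom_def)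
    then show ?thesis using compact_imp_bounded[OF compact_cube_set[of y r]] not_bounded_UNIV bounded_subset by blast
  qed blast
  have x: "x \<in> S" "0 < l" and sub: "cube_set x l \<subseteq> cube_set y r" using a by (auto simp: atom_def Q)
  have lr: "x \<in> cube_set y r" "l \<le> r" using cube_set_subsetD[OF sub] x by auto
  define A where "A = KA / (m x (2 * l) * (1 + D x l r))"
  have "AE w in \<mu>. ennreal \<bar>a w\<bar> \<le> ennreal A * indicator (cube_set x l) w"
    unfolding A_def using a lr by (intro atom_bound[of "Cube y r"]) (auto simp: Q)
  moreover have "0 \<le> A" using KA_ge_1 by (simp add: A_def)
  ultimately have "(\<integral>\<^sup>+w. ennreal \<bar>a w\<bar> * ennreal \<bar>f w - F y r\<bar> \<partial>\<mu>) \<le> ennreal (A * osc (F y r) x l)" by (rule osc_weighted)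
  also have "\<dots> \<le> ennreal (KA * (KF + KF))"
    unfolding A_def using x y lr KF_nonneg by (intro ennreal_leI osc_weighted_F F_diff) auto
  finally show ?thesis .
qed

text \<open>Comparison with the concentric cube of side 2, whose value is bounded because its side
  exceeds 1.\<close>

lemma F_le_D: assumes "x \<in> S" "0 < l" "l \<le> 1" shows "\<bar>F x l\<bar> \<le> KF * (2 + 2 * \<bar>C0\<bar>) * (1 + D x l 1)"
proof -
  have "D x 1 2 \<le> 2 * \<bar>C0\<bar>" using D_le_log[OF assms(1), of 1 2] C0_pos[OF assms(1)] by simp
  then have D2: "D x l 2 \<le> D x l 1 + 2 * \<bar>C0\<bar>" using D_split[of l 1 x 2] assms by simp
  have "\<bar>F x l - F x 2\<bar> \<le> KF * (1 + D x l 2)" using assms by (intro F_diff center_mem_cube_set) auto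
  moreover have "\<bar>F x 2\<bar> \<le> KF" using assms by (intro F_big) auto
  moreover have "KF * (1 + D x l 2) \<le> KF * (1 + (D x l 1 + 2 * \<bar>C0\<bar>))" using D2 KF_nonneg by (intro mult_left_mono) auto
  ultimately have "\<bar>F x l\<bar> \<le> KF * (2 + 2 * \<bar>C0\<bar> + D x l 1)" by (simp add: algebra_simps)
  also have "\<dots> \<le> KF * ((2 + 2 * \<bar>C0\<bar>) * (1 + D x l 1))"
    using KF_nonneg mult_nonneg_nonneg[of "1 + 2 * \<bar>C0\<bar>" "D x l 1"] by (intro mult_left_mono) (auto simp: algebra_simps)
  finally show ?thesis by (simp add: mult.assoc)
qed

definition K1 :: real where "K1 = Cf + KA * (KF + KF * (2 + 2 * \<bar>C0\<bar>))"

lemma atom_product_large: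
  assumes a: "atom \<mu> n R Q a" and R: "1 < side R"
  shows "(\<integral>\<^sup>+w. ennreal \<bar>a w\<bar> * ennreal \<bar>f w\<bar> \<partial>\<mu>) \<le> ennreal K1"
proof (cases Q)
  case (Cube x l)
  \<comment> \<open>Densities need to be charged only up to scale 1, beyond which F is bounded, and
    scale 1 does not exceed the side of R.\<close>
  define t where "t = max l 1"
  define B where "B = KF * (2 + 2 * \<bar>C0\<bar>)"
  have B: "KF \<le> B" "0 \<le> B" using KF_nonneg mult_left_mono[of 1 "2 + 2 * \<bar>C0\<bar>" KF] by (auto simp: B_def)
  have x: "x \<in> S" "0 < l" and sub: "cube_set x l \<subseteq> cset R" using a by (auto simp: atom_def Cube)
  have "ennreal l \<le> side R"
  proof (cases R)
    case (Cube y r)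
    then show ?thesis using cube_set_subsetD[of x l y r] sub x by (simp add: ennreal_leI)
  qed simp
  then have tR: "ennreal t \<le> side R" using R by (auto simp: t_def max_def less_imp_le)
  define A where "A = KA / (m x (2 * l) * (1 + D x l t))"
  have "AE w in \<mu>. ennreal \<bar>a w\<bar> \<le> ennreal A * indicator (cube_set x l) w"
    unfolding A_def using a tR by (intro atom_bound[of R]) (auto simp: Cube t_def)
  moreover have "0 \<le> A" using KA_ge_1 by (simp add: A_def)
  ultimately have "(\<integral>\<^sup>+w. ennreal \<bar>a w\<bar> * ennreal \<bar>f w - 0\<bar> \<partial>\<mu>) \<le> ennreal (A * osc 0 x l)" by (rule osc_weighted)
  also have "\<dots> \<le> ennreal (KA * (KF + B))" unfolding A_def
  proof (intro ennreal_leI osc_weighted_F x B(2))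
    show "\<bar>F x l - 0\<bar> \<le> B * (1 + D x l t)"
    proof (cases "l \<le> 1")
      case True
      then show ?thesis using F_le_D[OF x True] by (simp add: t_def B_def max_def)
    next
      case False
      then have "\<bar>F x l\<bar> \<le> KF" using x by (intro F_big) auto
      also have "\<dots> \<le> B * 1" using B by simp
      also have "\<dots> \<le> B * (1 + D x l t)" using B by (intro mult_left_mono) auto
      finally show ?thesis by simp
    qed
  qed
  also have "\<dots> \<le> ennreal K1" using Cf by (intro ennreal_leI) (simp add: K1_def B_def)
  finally show ?thesis by simp
next
  case Whole
  \<comment> \<open>An atom on the full space is bounded by the reciprocal of the total mass, which
    matches the rbmo condition for the full space.\<close>
  define E where "E = emeasure \<mu> UNIV"
  have fin: "E < \<infinity>" and bd: "AE w in \<mu>. ennreal \<bar>a w\<bar> \<le> 1 / (E * S_coef \<mu> n Q R)" using a by (auto simp: atom_def Whole E_def)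
  show ?thesis
  proof (cases "E = 0")
    case True
    then have "AE w in \<mu>. False" by (intro AE_I[of _ _ UNIV]) (auto simp: E_def)
    then have "(\<integral>\<^sup>+w. ennreal \<bar>a w\<bar> * ennreal \<bar>f w\<bar> \<partial>\<mu>) = (\<integral>\<^sup>+w. 0 \<partial>\<mu>)" by (intro nn_integral_cong_AE) auto
    then show ?thesis by simp
  next
    case False
    then obtain e where e: "E = ennreal e" "0 < e" using fin by (cases E) (auto simp: less_le)
    have "E * 1 \<le> E * S_coef \<mu> n Q R" using S_coef_ge_1 by (intro mult_left_mono) auto
    then have le: "1 / (E * S_coef \<mu> n Q R) \<le> ennreal (1 / e)" using e by (intro ennreal_recip_le) auto
    have "(\<integral>\<^sup>+w. ennreal \<bar>a w\<bar> * ennreal \<bar>f w\<bar> \<partial>\<mu>) \<le> (\<integral>\<^sup>+w. ennreal (1 / e) * ennreal \<bar>f w\<bar> \<partial>\<mu>)"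
      using bd by (intro nn_integral_mono_AE, eventually_elim) (rule mult_right_mono, auto intro: order_trans[OF _ le])
    also have "\<dots> = ennreal (1 / e) * (\<integral>\<^sup>+w. ennreal \<bar>f w\<bar> \<partial>\<mu>)" by (intro nn_integral_cmult) measurable
    also have "\<dots> \<le> ennreal (1 / e) * (ennreal Cf * E)" using Whole_bounds(1) fin by (intro mult_left_mono) (auto simp: E_def)
    also have "\<dots> = ennreal (1 / e * (Cf * e))" using e Cf(1) by (simp only: e(1) ennreal_mult[symmetric] mult_nonneg_nonneg divide_nonneg_nonneg less_imp_le zero_le_one)
    also have "\<dots> \<le> ennreal K1" using e KF_nonneg KA_ge_1 by (intro ennreal_leI) (simp add: K1_def)
    finally show ?thesis .
  qed
qed

section \<open>Reference means, products with blocks and pairings with test functions\<close>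

definition refc :: "'a cube \<Rightarrow> real" where "refc R = mean \<mu> f (tilde \<mu> \<rho> \<beta> R)"

lemma refc_Cube: "refc (Cube y r) = avg y (tside y r)"
  by (simp add: refc_def tilde_Cube avg_def)

lemma refc_F: "y \<in> S \<Longrightarrow> 0 < r \<Longrightarrow> \<bar>refc (Cube y r) - F y r\<bar> \<le> KF"
  unfolding refc_Cube by (rule F_tilde)

lemma refc_large:
  assumes "is_cube \<mu> R" "1 < side R" shows "\<bar>refc R\<bar> \<le> Cf * \<beta>"
proof (cases R)
  case (Cube y r)
  have r: "y \<in> S" "0 < r" "1 < r" using assms Cube by (auto simp: ennreal_less_iff simp flip: ennreal_1)
  have "r \<le> tside y r" "dbl \<rho> \<beta> y (tside y r)" using tside r by auto
  then show ?thesis unfolding Cube refc_Cube using r by (intro avg_large) auto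
next
  case Whole
  have "\<bar>refc R\<bar> \<le> Cf" using Whole_bounds(2) assms by (simp add: Whole refc_def tilde_def)
  also have "\<dots> \<le> Cf * \<beta>" using Cf(1) rho_beta(3) by (simp add: mult_le_cancel_left1)
  finally show ?thesis .
qed

lemma F_times_side:
  assumes "y \<in> S" "0 < r" "r \<le> 1" shows "\<bar>F y r\<bar> * r \<le> KF * (2 + 4 * \<bar>C0\<bar>)"
proof -
  \<comment> \<open>With ln 2 >= 2/3 the bound ln u <= u at u = 2 / r becomes log 2 (2 / r) <= 3 /
    r, so the logarithmic factor times \<open>r\<close> is at most 4.\<close>
  have "ln (2 / r) \<le> 2 / r" using ln_le_minus_one[of "2 / r"] assms by simp
  then have "ln (2 / r) / ln 2 \<le> (2 / r) / (2 / 3)" using ln2_ge_two_thirds assms by (intro frac_le) auto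
  then have "log 2 (2 / r) \<le> 3 / r" by (simp add: log_def)
  then have lg: "(1 + log 2 (2 / r)) * r \<le> 4" using assms mult_right_mono[of "log 2 (2 / r)" "3 / r" r] by (simp add: distrib_right)
  have "\<bar>F y r - F y 2\<bar> \<le> KF * (1 + D y r 2)" using assms by (intro F_diff center_mem_cube_set) auto
  also have "\<dots> \<le> KF * (1 + \<bar>C0\<bar> * (1 + log 2 (2 / r)))"
    using D_le_log[of y r 2] assms C0_pos[OF assms(1)] KF_nonneg by (intro mult_left_mono) auto
  finally have "\<bar>F y r\<bar> \<le> KF * (2 + \<bar>C0\<bar> * (1 + log 2 (2 / r)))"
    using F_big[OF assms(1), of 2] by (simp add: algebra_simps)
  then have "\<bar>F y r\<bar> * r \<le> KF * (2 + \<bar>C0\<bar> * (1 + log 2 (2 / r))) * r" using assms by (intro mult_right_mono) auto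
  also have "\<dots> = KF * (2 * r + \<bar>C0\<bar> * ((1 + log 2 (2 / r)) * r))" by (simp add: algebra_simps)
  also have "\<dots> \<le> KF * (2 + \<bar>C0\<bar> * 4)"
    using lg assms KF_nonneg by (intro mult_left_mono add_mono) auto
  finally show ?thesis by (simp add: mult.commute)
qed

text \<open>The sum of the constants for products on large cubes, products on small cubes and
  pairings on small cubes, so that one value serves all of them.\<close>

definition K2 :: real where
  "K2 = (K1 + Cf * \<beta>) + (KA * (KF + KF) + KF) + KF * (3 + 4 * \<bar>C0\<bar>) * (real DIM('a))\<^sup>2"

lemma K2_parts: "0 \<le> K1 + Cf * \<beta>" "0 \<le> KA * (KF + KF) + KF" "0 \<le> KF * (3 + 4 * \<bar>C0\<bar>) * (real DIM('a))\<^sup>2" "0 \<le> K2"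
  using KF_nonneg Cf(1) rho_beta(3) KA_ge_1 by (auto simp: K1_def K2_def intro!: add_nonneg_nonneg mult_nonneg_nonneg)

lemma block_product_L1:
  assumes b: "block \<mu> n R b s"
  shows "(\<integral>\<^sup>+w. ennreal \<bar>(f w - refc R) * b w\<bar> \<partial>\<mu>) \<le> ennreal (K2 * s)"
proof -
  note bL = block_L1[OF b]
  have [measurable]: "b \<in> borel_measurable \<mu>" using bL(2) by simp
  have R: "is_cube \<mu> R" using b by (simp add: block_def)
  \<comment> \<open>The atom estimates are relative to 0 or to \<open>F y r\<close>; exchanging that
    constant for the reference mean costs a multiple of the L^1 norm of the block.\<close>
  have tri: "(\<integral>\<^sup>+w. ennreal \<bar>(f w - refc R) * b w\<bar> \<partial>\<mu>) \<le> ennreal (K * s + L * s)"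
    if K: "(\<integral>\<^sup>+w. ennreal \<bar>b w\<bar> * ennreal \<bar>f w - c\<bar> \<partial>\<mu>) \<le> ennreal (K * s)" "0 \<le> K"
      and L: "\<bar>refc R - c\<bar> \<le> L" for c K L
  proof -
    have "(\<integral>\<^sup>+w. ennreal \<bar>(f w - refc R) * b w\<bar> \<partial>\<mu>)
        \<le> (\<integral>\<^sup>+w. ennreal \<bar>b w\<bar> * ennreal \<bar>f w - c\<bar> + ennreal L * ennreal \<bar>b w\<bar> \<partial>\<mu>)"
    proof (rule nn_integral_mono)
      fix w
      have "\<bar>(f w - refc R) * b w\<bar> \<le> (\<bar>f w - c\<bar> + L) * \<bar>b w\<bar>"
        unfolding abs_mult using L by (intro mult_right_mono) auto
      also have "\<dots> = \<bar>b w\<bar> * \<bar>f w - c\<bar> + L * \<bar>b w\<bar>" by (simp add: algebra_simps)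
      finally have "ennreal \<bar>(f w - refc R) * b w\<bar> \<le> ennreal (\<bar>b w\<bar> * \<bar>f w - c\<bar> + L * \<bar>b w\<bar>)" by (rule ennreal_leI)
      also have "\<dots> = ennreal \<bar>b w\<bar> * ennreal \<bar>f w - c\<bar> + ennreal L * ennreal \<bar>b w\<bar>"
        using L by (subst ennreal_plus) (auto simp: ennreal_mult)
      finally show "ennreal \<bar>(f w - refc R) * b w\<bar> \<le> ennreal \<bar>b w\<bar> * ennreal \<bar>f w - c\<bar> + ennreal L * ennreal \<bar>b w\<bar>" .
    qed
    also have "\<dots> = (\<integral>\<^sup>+w. ennreal \<bar>b w\<bar> * ennreal \<bar>f w - c\<bar> \<partial>\<mu>) + ennreal L * (\<integral>\<^sup>+w. ennreal \<bar>b w\<bar> \<partial>\<mu>)"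
      by (subst nn_integral_add) (auto simp: nn_integral_cmult)
    also have "\<dots> \<le> ennreal (K * s) + ennreal L * ennreal s" using K bL by (intro add_mono mult_left_mono) auto
    also have "\<dots> = ennreal (K * s + L * s)" using K L bL(3) by (simp add: ennreal_mult[symmetric] flip: ennreal_plus)
    finally show ?thesis .
  qed
  show ?thesis
  proof (cases "1 < side R")
    case True
    have "(\<integral>\<^sup>+w. ennreal \<bar>b w\<bar> * ennreal \<bar>f w - 0\<bar> \<partial>\<mu>) \<le> ennreal (K1 * s)"
      using atom_product_large[OF _ True] KF_nonneg KA_ge_1 Cf(1) by (intro block_nn_integral_le[OF b]) (auto simp: K1_def)
    then have "(\<integral>\<^sup>+w. ennreal \<bar>(f w - refc R) * b w\<bar> \<partial>\<mu>) \<le> ennreal (K1 * s + (Cf * \<beta>) * s)"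
      using refc_large[OF R True] KF_nonneg KA_ge_1 Cf(1) by (intro tri[of 0]) (auto simp: K1_def)
    also have "\<dots> = ennreal ((K1 + Cf * \<beta>) * s)" by (simp add: distrib_right)
    also have "\<dots> \<le> ennreal (K2 * s)" using K2_parts bL(3) by (intro ennreal_leI mult_right_mono) (auto simp: K2_def)
    finally show ?thesis .
  next
    case False
    then obtain y r where yr: "R = Cube y r" by (cases R) auto
    then have y: "y \<in> S" "0 < r" using R by auto
    have "(\<integral>\<^sup>+w. ennreal \<bar>b w\<bar> * ennreal \<bar>f w - F y r\<bar> \<partial>\<mu>) \<le> ennreal (KA * (KF + KF) * s)"
    proof (rule block_nn_integral_le)
      show "block \<mu> n (Cube y r) b s" using b yr by simp
      show "0 \<le> KA * (KF + KF)" using KF_nonneg KA_ge_1 by simp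
      show "(\<integral>\<^sup>+w. ennreal \<bar>a w\<bar> * ennreal \<bar>f w - F y r\<bar> \<partial>\<mu>) \<le> ennreal (KA * (KF + KF))"
        if "atom \<mu> n (Cube y r) Q a" for Q a by (rule atom_product_small[OF that y(1)])
    qed measurable
    then have "(\<integral>\<^sup>+w. ennreal \<bar>(f w - refc R) * b w\<bar> \<partial>\<mu>) \<le> ennreal (KA * (KF + KF) * s + KF * s)"
      using refc_F[OF y] KF_nonneg KA_ge_1 by (intro tri[of "F y r"]) (auto simp: yr)
    also have "\<dots> = ennreal ((KA * (KF + KF) + KF) * s)" by (simp add: distrib_right)
    also have "\<dots> \<le> ennreal (K2 * s)" using K2_parts bL(3) by (intro ennreal_leI mult_right_mono) (auto simp: K2_def)
    finally show ?thesis .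
  qed
qed

text \<open>For small cubes the cancellation gains a factor \<open>\<ell>(R)\<close>, which beats the logarithmic growth of the means.\<close>

lemma block_pairing:
  assumes b: "block \<mu> n R b s" and b0: "side R \<le> 1 \<Longrightarrow> (LINT z|\<mu>. b z) = 0"
    and phi: "C_k 1 \<phi>" "C1_bound \<phi> A"
  shows "\<bar>refc R * (LINT z|\<mu>. b z * \<phi> z)\<bar> \<le> K2 * s * A"
proof -
  note bL = block_L1[OF b]
  have R: "is_cube \<mu> R" using b by (simp add: block_def)
  have A: "\<bar>\<phi> z\<bar> \<le> A" "0 \<le> A" for z using C1_boundD[OF phi(2)] by auto
  have pm: "\<phi> \<in> borel_measurable \<mu>" using C1_measurable[OF phi(1)] measurable_cong_sets[OF sets_eq refl] by blast
  have int: "integrable \<mu> (\<lambda>z. b z * \<phi> z)" using bL(2) pm A(1) by (rule product_integrable)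
  have sA: "0 \<le> s * A" using bL(3) A(2) by simp
  show ?thesis
  proof (cases "1 < side R")
    case True
    have "ennreal \<bar>LINT z|\<mu>. b z * \<phi> z\<bar> \<le> (\<integral>\<^sup>+z. ennreal \<bar>b z * \<phi> z\<bar> \<partial>\<mu>)"
      using integral_norm_bound_ennreal[OF int] by simp
    also have "\<dots> \<le> (\<integral>\<^sup>+z. ennreal A * ennreal \<bar>b z\<bar> \<partial>\<mu>)"
    proof (rule nn_integral_mono)
      fix z
      have "\<bar>b z * \<phi> z\<bar> \<le> A * \<bar>b z\<bar>" using mult_right_mono[OF A(1)[of z], of "\<bar>b z\<bar>"] by (simp add: abs_mult mult.commute)
      then show "ennreal \<bar>b z * \<phi> z\<bar> \<le> ennreal A * ennreal \<bar>b z\<bar>" using A(2) by (simp add: ennreal_mult[symmetric] ennreal_leI)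
    qed
    also have "\<dots> = ennreal A * (\<integral>\<^sup>+z. ennreal \<bar>b z\<bar> \<partial>\<mu>)" using bL(2) by (intro nn_integral_cmult) auto
    also have "\<dots> \<le> ennreal A * ennreal s" by (intro mult_left_mono bL) simp
    also have "\<dots> = ennreal (s * A)" using A bL(3) by (simp add: ennreal_mult mult.commute)
    finally have "\<bar>LINT z|\<mu>. b z * \<phi> z\<bar> \<le> s * A" using sA by simp
    then have "\<bar>refc R * (LINT z|\<mu>. b z * \<phi> z)\<bar> \<le> (Cf * \<beta>) * (s * A)"
      unfolding abs_mult using refc_large[OF R True] Cf(1) rho_beta(3) by (intro mult_mono) auto
    also have "\<dots> \<le> K2 * (s * A)"
      using K2_parts sA KF_nonneg KA_ge_1 Cf(1) by (intro mult_right_mono) (auto simp: K2_def K1_def)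
    finally show ?thesis by (simp add: mult.assoc)
  next
    case False
    then obtain y r where yr: "R = Cube y r" by (cases R) auto
    then have y: "y \<in> S" "0 < r" using R by auto
    have r1: "r \<le> 1" using False yr by (simp add: not_less)
    define d where "d = real DIM('a)"
    have d: "0 \<le> d" by (simp add: d_def)
    have "\<bar>LINT z|\<mu>. b z * \<phi> z\<bar> \<le> (d * A * (d * r)) * s"
    proof (rule cancellation_bound[of y r])
      show "block \<mu> n (Cube y r) b s" using b yr by simp
      show "(LINT z|\<mu>. b z) = 0" using b0 False by (simp add: not_less)
      show "integrable \<mu> (\<lambda>z. b z * \<phi> z)" by (rule int)
      show "0 \<le> d * A * (d * r)" using d A y by simp
      fix z assume z: "z \<in> cube_set y r"
      have "\<bar>\<phi> z - \<phi> y\<bar> \<le> d * A * norm (z - y)" unfolding d_def by (rule C1_bound_lipschitz[OF phi])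
      also have "norm (z - y) \<le> d * r"
      proof -
        have "0 \<le> d * r" using d y by simp
        then show ?thesis using norm_diff_le_cube_set[OF z] unfolding d_def by linarith
      qed
      finally show "\<bar>\<phi> z - \<phi> y\<bar> \<le> d * A * (d * r)" using d A by (simp add: mult_left_mono)
    qed
    then have "\<bar>refc R * (LINT z|\<mu>. b z * \<phi> z)\<bar> \<le> \<bar>refc R\<bar> * ((d * A * (d * r)) * s)"
      unfolding abs_mult by (intro mult_left_mono) auto
    also have "\<dots> = (\<bar>refc R\<bar> * r) * (d\<^sup>2 * (s * A))" by (simp add: power2_eq_square)
    also have "\<dots> \<le> (KF * (3 + 4 * \<bar>C0\<bar>)) * (d\<^sup>2 * (s * A))"
    proof (rule mult_right_mono)
      have "\<bar>refc R\<bar> * r \<le> (KF + \<bar>F y r\<bar>) * r" using refc_F[OF y] y by (intro mult_right_mono) (auto simp: yr)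
      also have "\<dots> \<le> KF * 1 + KF * (2 + 4 * \<bar>C0\<bar>)"
        unfolding distrib_right using F_times_side[OF y r1] r1 KF_nonneg by (intro add_mono mult_left_mono) auto
      also have "\<dots> = KF * (3 + 4 * \<bar>C0\<bar>)" by (simp add: algebra_simps)
      finally show "\<bar>refc R\<bar> * r \<le> KF * (3 + 4 * \<bar>C0\<bar>)" .
    qed (use sA in auto)
    also have "\<dots> = KF * (3 + 4 * \<bar>C0\<bar>) * (real DIM('a))\<^sup>2 * (s * A)" by (simp add: d_def)
    also have "\<dots> \<le> K2 * (s * A)" using K2_parts sA by (intro mult_right_mono) (auto simp: K2_def)
    finally show ?thesis by (simp add: mult.assoc)
  qed
qed

definition KW :: real where "KW = KF * (1 + 2 * \<bar>C0\<bar>) + KG + KF + 1"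

lemma KW_ge_1: "1 \<le> KW"
  using KF_nonneg by (auto simp: KW_def KG_def intro!: add_nonneg_nonneg)

text \<open>The dilate by \<open>2 ^ Suc k\<close> contains \<open>w\<close>, so its value is at
  most that of \<open>G\<close> at \<open>w\<close> up to a constant. Descending to the original
  cube crosses \<open>k + 1\<close> dyadic scales and costs a multiple of that number.\<close>

lemma refc_le_G:
  assumes y: "y \<in> S" "0 < r" and w: "w \<in> cube_set y (2 ^ Suc k * r)" and G: "G w < \<infinity>"
  shows "\<bar>refc (Cube y r)\<bar> \<le> real (Suc k) * (KW * (enn2real (G w) + 1))"
proof -
  define g where "g = enn2real (G w)"
  have g: "G w = ennreal g" "0 \<le> g" using G by (auto simp: g_def)
  have KG0: "0 \<le> KG" using KF_nonneg by (simp add: KG_def)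
  have p: "0 < 2 ^ Suc k * r" using y by simp
  have "ennreal \<bar>F y (2 ^ Suc k * r)\<bar> \<le> ennreal (g + KG)"
    using F_le_G[OF y(1) p w] g KG0 by simp
  then have 1: "\<bar>F y (2 ^ Suc k * r)\<bar> \<le> g + KG" using g KG0 by (subst (asm) ennreal_le_iff) auto
  have "(1::real) \<le> 2 ^ Suc k" by (rule one_le_power) simp
  then have "\<bar>F y r - F y (2 ^ Suc k * r)\<bar> \<le> KF * (1 + \<bar>C0\<bar> * (1 + log 2 (2 ^ Suc k)))" by (intro F_concentric y)
  also have "log 2 (2 ^ Suc k :: real) = real (Suc k)" by (simp only: log_pow_cancel)
  also have "KF * (1 + \<bar>C0\<bar> * (1 + real (Suc k))) \<le> KF * ((1 + 2 * \<bar>C0\<bar>) * real (Suc k))"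
    using KF_nonneg mult_nonneg_nonneg[of "\<bar>C0\<bar>" "real k"] by (intro mult_left_mono) (auto simp: algebra_simps)
  finally have 2: "\<bar>F y r - F y (2 ^ Suc k * r)\<bar> \<le> KF * (1 + 2 * \<bar>C0\<bar>) * real (Suc k)" by (simp only: mult.assoc)
  have "\<bar>refc (Cube y r)\<bar> \<le> KF + (KF * (1 + 2 * \<bar>C0\<bar>) * real (Suc k) + (g + KG))"
    using refc_F[OF y] 1 2 by linarith
  also have "\<dots> \<le> real (Suc k) * (KF + KF * (1 + 2 * \<bar>C0\<bar>) + (g + KG))"
  proof -
    define p where "p = real (Suc k)"
    have "0 \<le> (p - 1) * (KF + (g + KG))" using KF_nonneg g KG0 by (simp add: p_def)
    then show ?thesis unfolding p_def[symmetric] by (simp add: algebra_simps)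
  qed
  also have "\<dots> \<le> real (Suc k) * (KW * (g + 1))"
  proof (rule mult_left_mono)
    have "1 * g \<le> KW * g" using KW_ge_1 g by (intro mult_right_mono)
    then show "KF + KF * (1 + 2 * \<bar>C0\<bar>) + (g + KG) \<le> KW * (g + 1)" by (simp add: KW_def distrib_left)
  qed simp
  finally show ?thesis by (simp add: g_def)
qed

text \<open>On the double cube the majorant is that of \<open>block_maximal_near\<close>, elsewhere
  \<open>qfar\<close>. Estimating the reference mean through \<open>G\<close> at the evaluation
  point leaves \<open>G\<close> as a separate factor and \<open>u\<close> independent of \<phi>, as
  the Orlicz estimate for products requires.\<close>

lemma block_maximal:
  obtains K where "0 \<le> K" "\<And>y r b s. block \<mu> n (Cube y r) b s \<Longrightarrow> (LINT z|\<mu>. b z) = 0 \<Longrightarrow>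
     \<exists>u\<in>borel_measurable \<mu>. (\<integral>\<^sup>+w. u w \<partial>\<mu>) \<le> ennreal (K * s) \<and>
     (\<forall>w. G w < \<infinity> \<longrightarrow> (\<forall>\<phi>\<in>F_loc \<mu> n w.
        ennreal \<bar>refc (Cube y r) * (LINT z|\<mu>. b z * \<phi> z)\<bar> \<le> ennreal (KW * (enn2real (G w) + 1)) * u w))"
proof -
  obtain K0 where K0: "0 \<le> K0" "\<And>y r b s. block \<mu> n (Cube y r) b s \<Longrightarrow> \<exists>u\<in>borel_measurable \<mu>. (\<integral>\<^sup>+w. u w \<partial>\<mu>) \<le> ennreal (K0 * s) \<and>
     (\<forall>w\<in>cube_set y (2 * r). \<forall>\<phi>\<in>F_loc \<mu> n w. ennreal \<bar>LINT z|\<mu>. b z * \<phi> z\<bar> \<le> u w)" using that by (rule block_maximal_near)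
  define Kq where "Kq = 4 ^ (n + 1) * real DIM('a)"
  have Kq: "0 \<le> Kq" by (simp add: Kq_def)
  define K where "K = K0 + Kq * (\<bar>C0\<bar> * 2 ^ n * 4)"
  show ?thesis
  proof (rule that[of K])
    show "0 \<le> K" using K0 Kq by (simp add: K_def)
    fix y :: 'a and r b s assume b: "block \<mu> n (Cube y r) b s" and b0: "(LINT z|\<mu>. b z) = 0"
    have y: "y \<in> S" "0 < r" using b by (auto simp: block_def)
    note s0 = block_L1(3)[OF b]
    obtain u0 where u0: "u0 \<in> borel_measurable \<mu>" "(\<integral>\<^sup>+w. u0 w \<partial>\<mu>) \<le> ennreal (K0 * s)"
      "\<And>w \<phi>. w \<in> cube_set y (2 * r) \<Longrightarrow> \<phi> \<in> F_loc \<mu> n w \<Longrightarrow> ennreal \<bar>LINT z|\<mu>. b z * \<phi> z\<bar> \<le> u0 w" using K0(2)[OF b] by blast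
    note [measurable] = u0(1)
    define u where "u w = u0 w + ennreal (Kq * s) * qfar y r w" for w
    have "(\<integral>\<^sup>+w. u w \<partial>\<mu>) = (\<integral>\<^sup>+w. u0 w \<partial>\<mu>) + ennreal (Kq * s) * (\<integral>\<^sup>+w. qfar y r w \<partial>\<mu>)"
      unfolding u_def by (subst nn_integral_add) (auto simp: nn_integral_cmult)
    also have "\<dots> \<le> ennreal (K0 * s) + ennreal (Kq * s) * ennreal (\<bar>C0\<bar> * 2 ^ n * 4)"
      using u0(2) qfar_integral[OF y] by (intro add_mono mult_left_mono) auto
    also have "\<dots> = ennreal (K0 * s) + ennreal (Kq * s * (\<bar>C0\<bar> * 2 ^ n * 4))"
      using Kq s0 by (subst ennreal_mult) auto
    also have "\<dots> = ennreal (K0 * s + Kq * s * (\<bar>C0\<bar> * 2 ^ n * 4))"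
      using Kq s0 K0 by (intro ennreal_plus[symmetric]) auto
    also have "K0 * s + Kq * s * (\<bar>C0\<bar> * 2 ^ n * 4) = K * s" by (simp add: K_def algebra_simps)
    finally have 1: "(\<integral>\<^sup>+w. u w \<partial>\<mu>) \<le> ennreal (K * s)" .
    have 2: "ennreal \<bar>refc (Cube y r) * (LINT z|\<mu>. b z * \<phi> z)\<bar> \<le> ennreal (KW * (enn2real (G w) + 1)) * u w"
      if G: "G w < \<infinity>" and phi: "\<phi> \<in> F_loc \<mu> n w" for w \<phi>
    proof -
      define H where "H = KW * (enn2real (G w) + 1)"
      have H: "0 \<le> H" using KW_ge_1 by (simp add: H_def)
      show ?thesis
      proof (cases "w \<in> cube_set y (2 * r)")
        case True
        have "\<bar>refc (Cube y r)\<bar> \<le> H" using refc_le_G[OF y _ G, of 0] True by (simp add: H_def)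
        then have "ennreal \<bar>refc (Cube y r) * (LINT z|\<mu>. b z * \<phi> z)\<bar> \<le> ennreal (H * \<bar>LINT z|\<mu>. b z * \<phi> z\<bar>)"
          unfolding abs_mult by (intro ennreal_leI mult_right_mono) auto
        also have "\<dots> = ennreal H * ennreal \<bar>LINT z|\<mu>. b z * \<phi> z\<bar>" using H by (intro ennreal_mult) auto
        also have "\<dots> \<le> ennreal H * u w"
          unfolding u_def using u0(3)[OF True phi] by (intro mult_left_mono) (auto intro: add_increasing2)
        finally show ?thesis by (simp add: H_def)
      next
        case False
        obtain t where t: "\<And>l. w \<in> cube_set y l \<longleftrightarrow> t \<le> l" "0 \<le> t"
          using sup_norm_radius[of w y] by metis
        obtain N where N: "t / r < 2 ^ N" using real_arch_pow[of 2 "t / r"] by auto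
        \<comment> \<open>The least dilate containing \<open>w\<close>: then \<open>w\<close> is
          outside the dilate by \<open>2 ^ k\<close>, and k >= 1 because \<open>w\<close> is outside
          the double. Both \<open>maximal_far\<close> and \<open>refc_le_G\<close> apply with this
          \<open>k\<close>.\<close>
        define k where "k = (LEAST k. w \<in> cube_set y (2 ^ Suc k * r))"
        have ex: "w \<in> cube_set y (2 ^ Suc N * r)" 
        proof -
          have "t < 2 ^ N * r" using N y(2) by (simp add: pos_divide_less_eq)
          also have "\<dots> \<le> 2 ^ Suc N * r" using y(2) by simp
          finally show ?thesis unfolding t by simp
        qed
        have k: "w \<in> cube_set y (2 ^ Suc k * r)" unfolding k_def by (rule LeastI[of "\<lambda>k. w \<in> cube_set y (2 ^ Suc k * r)", OF ex])
        have k1: "1 \<le> k" using k False by (cases k) auto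
        have k2: "w \<notin> cube_set y (2 ^ k * r)"
          using not_less_Least[of "k - 1" "\<lambda>k. w \<in> cube_set y (2 ^ Suc k * r)"] k1 unfolding k_def[symmetric] by simp
        define X where "X = (1/2) ^ k / (2 ^ k * r) ^ n"
        have X: "0 \<le> X" using y by (simp add: X_def)
        have "\<bar>refc (Cube y r) * (LINT z|\<mu>. b z * \<phi> z)\<bar> \<le> (real (Suc k) * H) * (Kq * X * s)"
          unfolding abs_mult Kq_def X_def using refc_le_G[OF y k G] maximal_far[OF b b0 y(2) k2 k1 phi] H
          by (intro mult_mono) (auto simp: H_def)
        also have "\<dots> = H * (Kq * s * (real (Suc k) * (1/2) ^ k / (2 ^ k * r) ^ n))" by (simp add: X_def)
        finally have "ennreal \<bar>refc (Cube y r) * (LINT z|\<mu>. b z * \<phi> z)\<bar> \<le> ennreal (H * (Kq * s * (real (Suc k) * (1/2) ^ k / (2 ^ k * r) ^ n)))"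
          by (rule ennreal_leI)
        also have "\<dots> = ennreal H * (ennreal (Kq * s) * ennreal (real (Suc k) * (1/2) ^ k / (2 ^ k * r) ^ n))"
        proof -
          have *: "ennreal (H * (Kq * s * Y)) = ennreal H * (ennreal (Kq * s) * ennreal Y)" if "0 \<le> Y" for Y
            using H Kq s0 that by (simp add: ennreal_mult)
          show ?thesis by (rule *) (use y in simp)
        qed
        also have "\<dots> \<le> ennreal H * u w"
        proof (intro mult_left_mono)
          have "ennreal (real (Suc k) * (1/2) ^ k / (2 ^ k * r) ^ n) =
              (\<Sum>k\<in>{k}. ennreal (real (Suc k) * (1/2) ^ k / (2 ^ k * r) ^ n) * indicator (cube_set y (2 ^ Suc k * r)) w)"
            using k by (simp del: power_Suc of_nat_Suc)
          also have "\<dots> \<le> qfar y r w" unfolding qfar_def by (intro sum_le_suminf) auto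
          finally have "ennreal (Kq * s) * ennreal (real (Suc k) * (1/2) ^ k / (2 ^ k * r) ^ n) \<le> ennreal (Kq * s) * qfar y r w"
            by (intro mult_left_mono) auto
          then show "ennreal (Kq * s) * ennreal (real (Suc k) * (1/2) ^ k / (2 ^ k * r) ^ n) \<le> u w"
            unfolding u_def by (intro add_increasing) auto
        qed simp
        finally show ?thesis by (simp add: H_def)
      qed
    qed
    have "u \<in> borel_measurable \<mu>" unfolding u_def by measurable
    then show "\<exists>u\<in>borel_measurable \<mu>. (\<integral>\<^sup>+w. u w \<partial>\<mu>) \<le> ennreal (K * s) \<and>
     (\<forall>w. G w < \<infinity> \<longrightarrow> (\<forall>\<phi>\<in>F_loc \<mu> n w.
        ennreal \<bar>refc (Cube y r) * (LINT z|\<mu>. b z * \<phi> z)\<bar> \<le> ennreal (KW * (enn2real (G w) + 1)) * u w))"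
      using 1 2 by blast
  qed
qed

end

section \<open>The product as a distribution\<close>

definition trunc :: "real \<Rightarrow> real \<Rightarrow> real" where "trunc N t = max (- N) (min N t)"

lemma trunc_lipschitz: "\<bar>trunc N s - trunc N t\<bar> \<le> \<bar>s - t\<bar>"
  unfolding trunc_def by (auto simp: max_def min_def)

lemma abs_trunc_le: "0 \<le> N \<Longrightarrow> \<bar>trunc N t\<bar> \<le> \<bar>t\<bar>" "0 \<le> N \<Longrightarrow> \<bar>trunc N t\<bar> \<le> N"
  unfolding trunc_def by (auto simp: max_def min_def)

lemma trunc_tendsto: "(\<lambda>N. trunc (real N) t) \<longlonglongrightarrow> t"
proof (rule tendsto_eventually)
  obtain N0 :: nat where "\<bar>t\<bar> \<le> real N0" using real_arch_simple by blast
  then have "trunc (real N) t = t" if "N0 \<le> N" for N using that by (auto simp: trunc_def max_def min_def)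
  then show "\<forall>\<^sub>F N in sequentially. trunc (real N) t = t" by (auto simp: eventually_sequentially)
qed

lemma one_le_infinity: "1 \<le> (\<infinity>::enat)" by simp

lemma distribution_on_linear:
  assumes "distribution_on m T" "\<phi> \<in> test_functions m" "\<psi> \<in> test_functions m"
  shows "T (\<lambda>y. s * \<phi> y + t * \<psi> y) = s * T \<phi> + t * T \<psi>"
  using assms unfolding distribution_on_def by blast

lemma distribution_on_add:
  assumes "distribution_on m T1" "distribution_on m T2"
  shows "distribution_on m (\<lambda>\<phi>. T1 \<phi> + T2 \<phi>)"
  unfolding distribution_on_def
proof (intro conjI ballI allI impI)
  show "T1 (\<lambda>y. s * \<phi> y + t * \<psi> y) + T2 (\<lambda>y. s * \<phi> y + t * \<psi> y) = s * (T1 \<phi> + T2 \<phi>) + t * (T1 \<psi> + T2 \<psi>)"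
    if "\<phi> \<in> test_functions m" "\<psi> \<in> test_functions m" for \<phi> \<psi> s t
    using assms[THEN distribution_on_linear, OF that] by (simp add: algebra_simps)
  fix K :: "'a set" assume K: "compact K"
  let ?P = "\<lambda>T C k. \<forall>\<phi>\<in>test_functions m. \<forall>A. (\<forall>y. y \<notin> K \<longrightarrow> \<phi> y = 0) \<and>
     (\<forall>bs y. set bs \<subseteq> Basis \<and> length bs \<le> k \<longrightarrow> \<bar>iter_partial bs \<phi> y\<bar> \<le> A) \<longrightarrow> \<bar>T \<phi>\<bar> \<le> C * A"
  obtain C1 k1 where 1: "enat k1 \<le> m" "?P T1 C1 k1" using assms(1)[unfolded distribution_on_def, THEN conjunct2, rule_format, OF K] by auto
  obtain C2 k2 where 2: "enat k2 \<le> m" "?P T2 C2 k2" using assms(2)[unfolded distribution_on_def, THEN conjunct2, rule_format, OF K] by auto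
  show "\<exists>C k. enat k \<le> m \<and> ?P (\<lambda>\<phi>. T1 \<phi> + T2 \<phi>) C k"
  proof (intro exI[of _ "C1 + C2"] exI[of _ "max k1 k2"] conjI ballI allI impI)
    show "enat (max k1 k2) \<le> m" using 1(1) 2(1) by (auto simp: max_def)
    fix \<phi> :: "'a \<Rightarrow> real" and A assume t: "\<phi> \<in> test_functions m"
      and A: "(\<forall>y. y \<notin> K \<longrightarrow> \<phi> y = 0) \<and>
       (\<forall>bs y. set bs \<subseteq> Basis \<and> length bs \<le> max k1 k2 \<longrightarrow> \<bar>iter_partial bs \<phi> y\<bar> \<le> A)"
    have le: "(\<forall>y. y \<notin> K \<longrightarrow> \<phi> y = 0) \<and>
       (\<forall>bs y. set bs \<subseteq> Basis \<and> length bs \<le> i \<longrightarrow> \<bar>iter_partial bs \<phi> y\<bar> \<le> A)" if "i \<le> max k1 k2" for i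
      using A le_trans[OF _ that] by blast
    have "\<bar>T1 \<phi>\<bar> \<le> C1 * A" by (rule 1(2)[THEN bspec, OF t, THEN spec, THEN mp, OF le]) simp
    moreover have "\<bar>T2 \<phi>\<bar> \<le> C2 * A" by (rule 2(2)[THEN bspec, OF t, THEN spec, THEN mp, OF le]) simp
    ultimately show "\<bar>T1 \<phi> + T2 \<phi>\<bar> \<le> (C1 + C2) * A" unfolding distrib_right by linarith
  qed
qed

lemma trunc_measurable [measurable]: "trunc N \<in> borel_measurable borel"
  unfolding trunc_def by measurable

context rbmo_function
begin

lemma decompositionD:
  assumes "h1_decomposition \<mu> n h b R"
  obtains s where "summable s" "\<And>j. 0 \<le> s j" "\<And>j. block \<mu> n (R j) (b j) (s j)"
    "\<And>j. side (R j) \<le> 1 \<Longrightarrow> (LINT z|\<mu>. b j z) = 0" "AE x in \<mu>. (\<lambda>j. b j x) sums h x"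
proof -
  obtain s where s: "summable s" "\<And>j. side (R j) \<le> 1 \<Longrightarrow> atomic_block \<mu> n (R j) (b j) (s j)"
      "\<And>j. 1 < side (R j) \<Longrightarrow> block \<mu> n (R j) (b j) (s j)"
    and h: "AE x in \<mu>. (\<lambda>j. b j x) sums h x" using assms by (auto simp: h1_decomposition_def)
  have blk: "block \<mu> n (R j) (b j) (s j)" for j
    using s(2)[of j] s(3)[of j] by (cases "side (R j) \<le> 1") (auto simp: atomic_block_def)
  have c0: "(LINT z|\<mu>. b j z) = 0" if "side (R j) \<le> 1" for j using s(2)[OF that] by (simp add: atomic_block_def)
  show ?thesis by (rule that[OF s(1) block_L1(3)[OF blk] blk c0 h])
qed

section \<open>The two series of the product\<close>

definition Upart :: "(nat \<Rightarrow> 'a \<Rightarrow> real) \<Rightarrow> (nat \<Rightarrow> 'a cube) \<Rightarrow> nat \<Rightarrow> 'a \<Rightarrow> real" where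
  "Upart b R j x = (f x - refc (R j)) * b j x"

definition Vpart :: "(nat \<Rightarrow> 'a \<Rightarrow> real) \<Rightarrow> (nat \<Rightarrow> 'a cube) \<Rightarrow> nat \<Rightarrow> 'a \<Rightarrow> real" where
  "Vpart b R j x = refc (R j) * b j x"

lemma C1_measurable_mu: "C_k 1 \<phi> \<Longrightarrow> \<phi> \<in> borel_measurable \<mu>"
  using C1_measurable measurable_cong_sets[OF sets_eq refl] by blast

lemma test_measurable: "\<phi> \<in> test_functions k \<Longrightarrow> 1 \<le> k \<Longrightarrow> \<phi> \<in> borel_measurable \<mu>"
  by (intro C1_measurable_mu test_function_C1)

lemma regular_linear:
  assumes "integrable \<mu> g" "1 \<le> k" "\<phi> \<in> test_functions k" "\<psi> \<in> test_functions k"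
  shows "regular_distribution \<mu> g (\<lambda>y. a * \<phi> y + b * \<psi> y) = a * regular_distribution \<mu> g \<phi> + b * regular_distribution \<mu> g \<psi>"
proof -
  have i: "integrable \<mu> (\<lambda>y. g y * \<theta> y)" if t: "\<theta> \<in> test_functions k" for \<theta>
  proof -
    obtain A where "C1_bound \<theta> A" using that by (rule test_function_bound[OF t assms(2)])
    then show ?thesis using assms(1,2) t by (intro product_integrable[where A=A]) (auto intro: test_measurable C1_boundD(1))
  qed
  have "regular_distribution \<mu> g (\<lambda>y. a * \<phi> y + b * \<psi> y) = (LINT y|\<mu>. a * (g y * \<phi> y) + b * (g y * \<psi> y))"
    unfolding regular_distribution_def by (intro Bochner_Integration.integral_cong) (auto simp: algebra_simps)
  also have "\<dots> = a * regular_distribution \<mu> g \<phi> + b * regular_distribution \<mu> g \<psi>"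
    using i assms(3,4) by (simp add: regular_distribution_def)
  finally show ?thesis .
qed

lemma regular_bound:
  assumes "integrable \<mu> g" "(LINT y|\<mu>. \<bar>g y\<bar>) \<le> B" "\<phi> \<in> borel_measurable \<mu>" "\<And>y. \<bar>\<phi> y\<bar> \<le> A"
  shows "\<bar>regular_distribution \<mu> g \<phi>\<bar> \<le> B * A"
proof -
  have A0: "0 \<le> A" using assms(4)[of undefined] by simp
  have i: "integrable \<mu> (\<lambda>y. g y * \<phi> y)" using assms by (intro product_integrable)
  have "\<bar>regular_distribution \<mu> g \<phi>\<bar> \<le> (LINT y|\<mu>. \<bar>g y * \<phi> y\<bar>)"
    unfolding regular_distribution_def by (rule integral_abs_bound)
  also have "\<dots> \<le> (LINT y|\<mu>. \<bar>g y\<bar> * A)"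
  proof (rule integral_mono)
    show "integrable \<mu> (\<lambda>y. \<bar>g y * \<phi> y\<bar>)" "integrable \<mu> (\<lambda>y. \<bar>g y\<bar> * A)" using i assms(1) by auto
    show "\<bar>g y * \<phi> y\<bar> \<le> \<bar>g y\<bar> * A" for y unfolding abs_mult by (intro mult_left_mono assms(4)) simp
  qed
  also have "\<dots> = (LINT y|\<mu>. \<bar>g y\<bar>) * A" by simp
  also have "\<dots> \<le> B * A" using assms(2) A0 by (rule mult_right_mono)
  finally show ?thesis .
qed

lemma integrable_loc_integrable:
  assumes "integrable \<mu> g" shows "loc_integrable \<mu> g"
  unfolding loc_integrable_def set_integrable_def
proof (intro conjI allI impI)
  fix K :: "'a set" assume "compact K"
  then have "K \<in> sets \<mu>" by (simp add: compact_imp_closed borel_closed)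
  then show "integrable \<mu> (\<lambda>x. indicat_real K x *\<^sub>R g x)" using assms by (rule integrable_mult_indicator)
qed (use assms in auto)

lemma Upart_bounds:
  assumes "block \<mu> n (R j) (b j) s"
  shows "(\<integral>\<^sup>+x. ennreal \<bar>Upart b R j x\<bar> \<partial>\<mu>) \<le> ennreal (K2 * s)" "integrable \<mu> (Upart b R j)"
    "(LINT x|\<mu>. \<bar>Upart b R j x\<bar>) \<le> K2 * s" "integrable \<mu> (Vpart b R j)"
proof -
  note bL = block_L1[OF assms]
  have [measurable]: "b j \<in> borel_measurable \<mu>" using bL(2) by simp
  show 1: "(\<integral>\<^sup>+x. ennreal \<bar>Upart b R j x\<bar> \<partial>\<mu>) \<le> ennreal (K2 * s)"
    unfolding Upart_def by (rule block_product_L1[OF assms])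
  have [measurable]: "Upart b R j \<in> borel_measurable \<mu>" unfolding Upart_def[abs_def] by measurable
  have "0 \<le> K2 * s" using K2_parts(4) bL(3) by simp
  then show "integrable \<mu> (Upart b R j)" "(LINT x|\<mu>. \<bar>Upart b R j x\<bar>) \<le> K2 * s"
    by (intro integrable_nn_integral_le[OF _ 1]; simp)+
  show "integrable \<mu> (Vpart b R j)" unfolding Vpart_def[abs_def] using bL(2) by simp
qed

lemma Upart_series:
  assumes dec: "h1_decomposition \<mu> n h b R" and m: "1 \<le> k"
  shows "distribution_on k (\<lambda>\<phi>. \<Sum>j. regular_distribution \<mu> (Upart b R j) \<phi>)"
    and "\<phi> \<in> test_functions k \<Longrightarrow> summable (\<lambda>j. regular_distribution \<mu> (Upart b R j) \<phi>)"
proof -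
  obtain s where s: "summable s" "\<And>j. 0 \<le> s j" "\<And>j. block \<mu> n (R j) (b j) (s j)"
    "\<And>j. side (R j) \<le> 1 \<Longrightarrow> (LINT z|\<mu>. b j z) = 0" "AE x in \<mu>. (\<lambda>j. b j x) sums h x" using that by (rule decompositionD[OF dec])
  have U: "(\<integral>\<^sup>+x. ennreal \<bar>Upart b R j x\<bar> \<partial>\<mu>) \<le> ennreal (K2 * s j)" "integrable \<mu> (Upart b R j)"
    "(LINT x|\<mu>. \<bar>Upart b R j x\<bar>) \<le> K2 * s j" "integrable \<mu> (Vpart b R j)" for j
    by (rule Upart_bounds[of R j b "s j", OF s(3)])+
  have lin: "regular_distribution \<mu> (Upart b R j) (\<lambda>y. a * \<phi> y + c * \<psi> y) =
     a * regular_distribution \<mu> (Upart b R j) \<phi> + c * regular_distribution \<mu> (Upart b R j) \<psi>"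
    if "\<phi> \<in> test_functions k" "\<psi> \<in> test_functions k" for j \<phi> \<psi> a c
    by (rule regular_linear[OF U(2) m that])
  have bnd: "\<bar>regular_distribution \<mu> (Upart b R j) \<phi>\<bar> \<le> K2 * s j * A"
    if "\<phi> \<in> test_functions k" "C1_bound \<phi> A" for j \<phi> A
    by (rule regular_bound[OF U(2,3) test_measurable[OF that(1) m] C1_boundD(1)[OF that(2)]])
  show "distribution_on k (\<lambda>\<phi>. \<Sum>j. regular_distribution \<mu> (Upart b R j) \<phi>)"
    by (rule distribution_suminf(1)[OF m s(1) lin bnd])
  show "\<phi> \<in> test_functions k \<Longrightarrow> summable (\<lambda>j. regular_distribution \<mu> (Upart b R j) \<phi>)"
    by (rule distribution_suminf(2)[OF m s(1) lin bnd])
qed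

lemma Vpart_regular: "regular_distribution \<mu> (Vpart b R j) \<phi> = refc (R j) * (LINT z|\<mu>. b j z * \<phi> z)"
  unfolding regular_distribution_def Vpart_def by (simp add: mult.assoc)

text \<open>The index set \<open>J\<close> selects the terms: all of them for the second series of
  the product, those on small cubes for the part that goes into the Hardy space. Dropping terms
  keeps the order 1 bound.\<close>

lemma Vpart_series:
  assumes dec: "h1_decomposition \<mu> n h b R" and m: "1 \<le> k"
  shows "distribution_on k (\<lambda>\<phi>. \<Sum>j. if j \<in> J then regular_distribution \<mu> (Vpart b R j) \<phi> else 0)"
    and "\<phi> \<in> test_functions k \<Longrightarrow> summable (\<lambda>j. if j \<in> J then regular_distribution \<mu> (Vpart b R j) \<phi> else 0)"
proof -
  obtain s where s: "summable s" "\<And>j. 0 \<le> s j" "\<And>j. block \<mu> n (R j) (b j) (s j)"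
    "\<And>j. side (R j) \<le> 1 \<Longrightarrow> (LINT z|\<mu>. b j z) = 0" "AE x in \<mu>. (\<lambda>j. b j x) sums h x" using that by (rule decompositionD[OF dec])
  have V: "integrable \<mu> (Vpart b R j)" for j by (rule Upart_bounds(4)[of R j b "s j", OF s(3)])
  have lin: "(if j \<in> J then regular_distribution \<mu> (Vpart b R j) (\<lambda>y. a * \<phi> y + c * \<psi> y) else 0) =
     a * (if j \<in> J then regular_distribution \<mu> (Vpart b R j) \<phi> else 0) + c * (if j \<in> J then regular_distribution \<mu> (Vpart b R j) \<psi> else 0)"
    if "\<phi> \<in> test_functions k" "\<psi> \<in> test_functions k" for j \<phi> \<psi> a c
    using regular_linear[OF V m that] by simp
  have bnd: "\<bar>if j \<in> J then regular_distribution \<mu> (Vpart b R j) \<phi> else 0\<bar> \<le> K2 * s j * A"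
    if "\<phi> \<in> test_functions k" "C1_bound \<phi> A" for j \<phi> A
  proof -
    have "\<bar>regular_distribution \<mu> (Vpart b R j) \<phi>\<bar> \<le> K2 * s j * A" unfolding Vpart_regular
      by (rule block_pairing[OF s(3,4) test_function_C1[OF that(1) m] that(2)])
    moreover have "0 \<le> K2 * s j * A" using K2_parts(4) s(2) C1_boundD(3)[OF that(2)] by simp
    ultimately show ?thesis by simp
  qed
  show "distribution_on k (\<lambda>\<phi>. \<Sum>j. if j \<in> J then regular_distribution \<mu> (Vpart b R j) \<phi> else 0)"
    by (rule distribution_suminf(1)[OF m s(1) lin bnd])
  show "\<phi> \<in> test_functions k \<Longrightarrow> summable (\<lambda>j. if j \<in> J then regular_distribution \<mu> (Vpart b R j) \<phi> else 0)"
    by (rule distribution_suminf(2)[OF m s(1) lin bnd])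
qed

text \<open>Truncating \<open>f\<close> keeps all bounds uniform because truncation is 1-Lipschitz; since the truncated function
  is bounded, the truncated sums depend on \<open>h\<close> only.\<close>

lemma product_independent:
  assumes dec: "h1_decomposition \<mu> n h b R" and h[measurable]: "h \<in> borel_measurable \<mu>"
    and phi: "\<phi> \<in> test_functions \<infinity>"
  shows "(\<lambda>N. LINT x|\<mu>. trunc (real N) (f x) * \<phi> x * h x) \<longlonglongrightarrow>
    (\<Sum>j. regular_distribution \<mu> (Upart b R j) \<phi> + regular_distribution \<mu> (Vpart b R j) \<phi>)"
proof -
  obtain s where s: "summable s" "\<And>j. 0 \<le> s j" "\<And>j. block \<mu> n (R j) (b j) (s j)"
    "\<And>j. side (R j) \<le> 1 \<Longrightarrow> (LINT z|\<mu>. b j z) = 0" "AE x in \<mu>. (\<lambda>j. b j x) sums h x" using that by (rule decompositionD[OF dec])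
  have U: "(\<integral>\<^sup>+x. ennreal \<bar>Upart b R j x\<bar> \<partial>\<mu>) \<le> ennreal (K2 * s j)" "integrable \<mu> (Upart b R j)"
    "(LINT x|\<mu>. \<bar>Upart b R j x\<bar>) \<le> K2 * s j" "integrable \<mu> (Vpart b R j)" for j
    by (rule Upart_bounds[of R j b "s j", OF s(3)])+
  note bL = block_L1[OF s(3)]
  have C: "C_k 1 \<phi>" by (rule test_function_C1[OF phi]) simp
  have pm[measurable]: "\<phi> \<in> borel_measurable \<mu>" by (rule C1_measurable_mu[OF C])
  obtain A where A: "C1_bound \<phi> A" using that by (rule test_function_bound[OF phi one_le_infinity])
  note AA = C1_boundD[OF A]
  have bm[measurable]: "b j \<in> borel_measurable \<mu>" for j using bL(2)[of j] by simp
  define x where "x j N = (LINT z|\<mu>. trunc (real N) (f z) * \<phi> z * b j z)" for j N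
  have int: "integrable \<mu> (\<lambda>z. trunc (real N) (f z) * \<phi> z * b j z)" for j N
  proof (rule Bochner_Integration.integrable_bound[of _ "\<lambda>z. real N * A * b j z"])
    show "AE z in \<mu>. norm (trunc (real N) (f z) * \<phi> z * b j z) \<le> norm (real N * A * b j z)"
      using AA by (intro AE_I2) (auto simp: abs_mult intro!: mult_right_mono mult_mono abs_trunc_le(2))
  qed (use bL(2) in auto)
  have bound: "\<bar>x j N\<bar> \<le> 2 * K2 * A * s j" for j N
  proof -
    \<comment> \<open>The truncated function is compared with the truncated reference mean. Both
      resulting terms are dominated by those without truncation, the first because truncation is
      1-Lipschitz, the second because it does not increase absolute values.\<close>
    define c where "c = trunc (real N) (refc (R j))"
    define g where "g z = (trunc (real N) (f z) - c) * b j z" for z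
    have gm[measurable]: "g \<in> borel_measurable \<mu>" unfolding g_def by measurable
    have gle: "\<bar>g z\<bar> \<le> \<bar>Upart b R j z\<bar>" for z
      unfolding g_def Upart_def abs_mult c_def by (intro mult_right_mono trunc_lipschitz) auto
    have gi: "integrable \<mu> g" using gle by (intro Bochner_Integration.integrable_bound[OF U(2)]) auto
    have "(LINT z|\<mu>. \<bar>g z\<bar>) \<le> (LINT z|\<mu>. \<bar>Upart b R j z\<bar>)" using gle gi U(2) by (intro integral_mono) auto
    then have g1: "\<bar>regular_distribution \<mu> g \<phi>\<bar> \<le> K2 * s j * A"
      using U(3)[of j] AA by (intro regular_bound[OF gi _ pm]) auto
    have "\<bar>c * (LINT z|\<mu>. b j z * \<phi> z)\<bar> \<le> \<bar>refc (R j) * (LINT z|\<mu>. b j z * \<phi> z)\<bar>"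
      unfolding abs_mult c_def by (intro mult_right_mono abs_trunc_le) auto
    also have "\<dots> \<le> K2 * s j * A" by (rule block_pairing[OF s(3,4) C A])
    finally have g2: "\<bar>c * (LINT z|\<mu>. b j z * \<phi> z)\<bar> \<le> K2 * s j * A" .
    have i1: "integrable \<mu> (\<lambda>z. g z * \<phi> z)" by (rule product_integrable[OF gi pm AA(1)])
    have i2: "integrable \<mu> (\<lambda>z. b j z * \<phi> z)" by (rule product_integrable[OF bL(2) pm AA(1)])
    have "x j N = (LINT z|\<mu>. g z * \<phi> z + c * (b j z * \<phi> z))"
      unfolding x_def g_def by (intro Bochner_Integration.integral_cong) (auto simp: algebra_simps)
    also have "\<dots> = regular_distribution \<mu> g \<phi> + c * (LINT z|\<mu>. b j z * \<phi> z)"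
      using i1 i2 by (simp add: regular_distribution_def)
    finally have "\<bar>x j N\<bar> \<le> K2 * s j * A + K2 * s j * A" using g1 g2 by linarith
    then show ?thesis by (simp add: mult_ac)
  qed
  have limit: "(\<lambda>N. x j N) \<longlonglongrightarrow> regular_distribution \<mu> (Upart b R j) \<phi> + regular_distribution \<mu> (Vpart b R j) \<phi>" for j
  proof -
    have i1: "integrable \<mu> (\<lambda>z. Upart b R j z * \<phi> z)" by (rule product_integrable[OF U(2) pm AA(1)])
    have i2: "integrable \<mu> (\<lambda>z. Vpart b R j z * \<phi> z)" by (rule product_integrable[OF U(4) pm AA(1)])
    have e: "Upart b R j z * \<phi> z + Vpart b R j z * \<phi> z = f z * \<phi> z * b j z" for z
      by (simp add: Upart_def Vpart_def algebra_simps)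
    have i3: "integrable \<mu> (\<lambda>z. f z * \<phi> z * b j z)"
      using Bochner_Integration.integrable_add[OF i1 i2] unfolding e .
    have "(\<lambda>N. x j N) \<longlonglongrightarrow> (LINT z|\<mu>. f z * \<phi> z * b j z)" unfolding x_def
    proof (rule integral_dominated_convergence[where w="\<lambda>z. \<bar>f z * \<phi> z * b j z\<bar>"])
      show "AE z in \<mu>. (\<lambda>N. trunc (real N) (f z) * \<phi> z * b j z) \<longlonglongrightarrow> f z * \<phi> z * b j z"
        by (intro AE_I2 tendsto_mult tendsto_const trunc_tendsto)
      show "AE z in \<mu>. norm (trunc (real N) (f z) * \<phi> z * b j z) \<le> \<bar>f z * \<phi> z * b j z\<bar>" for N
        by (intro AE_I2) (auto simp: abs_mult intro!: mult_right_mono abs_trunc_le(1))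
    qed (use i3 in auto)
    also have "(LINT z|\<mu>. f z * \<phi> z * b j z) = regular_distribution \<mu> (Upart b R j) \<phi> + regular_distribution \<mu> (Vpart b R j) \<phi>"
      unfolding regular_distribution_def e[symmetric] by (rule Bochner_Integration.integral_add[OF i1 i2])
    finally show ?thesis .
  qed
  have sm: "summable (\<lambda>j. 2 * K2 * A * s j)" using s(1) by (intro summable_mult)
  have ev: "eventually (\<lambda>(j, N). norm (x j N) \<le> 2 * K2 * A * s j) (at_top \<times>\<^sub>F sequentially)"
    by (rule always_eventually) (use bound in auto)
  \<comment> \<open>Dominated convergence for series: the majorant \<open>2 * K2 * A * s j\<close>
    does not depend on the truncation level.\<close>
  have "(\<lambda>N. \<Sum>j. x j N) \<longlonglongrightarrow> (\<Sum>j. regular_distribution \<mu> (Upart b R j) \<phi> + regular_distribution \<mu> (Vpart b R j) \<phi>)"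
    using tannerys_theorem[OF limit ev sm sequentially_bot] by blast
  \<comment> \<open>At a fixed truncation level the multiplier of the blocks is bounded, so their
    absolute summability in L^1 allows summation under the integral, and only \<open>h\<close>
    remains.\<close>
  moreover have "(\<Sum>j. x j N) = (LINT z|\<mu>. trunc (real N) (f z) * \<phi> z * h z)" for N
  proof -
    have bser: "AE z in \<mu>. summable (\<lambda>j. \<bar>b j z\<bar>)" "(LINT z|\<mu>. \<bar>b j z\<bar>) \<le> s j" for j
      using L1_series[of b \<mu> s] bL(1) s(1,2) by auto
    have le: "\<bar>trunc (real N) (f z) * \<phi> z * b j z\<bar> \<le> real N * A * \<bar>b j z\<bar>" for z j
      using AA by (auto simp: abs_mult intro!: mult_right_mono mult_mono abs_trunc_le(2))
    have "(\<lambda>j. x j N) sums (LINT z|\<mu>. (\<Sum>j. trunc (real N) (f z) * \<phi> z * b j z))" unfolding x_def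
    proof (rule sums_integral[OF int])
      show "AE z in \<mu>. summable (\<lambda>j. norm (trunc (real N) (f z) * \<phi> z * b j z))"
        using bser(1)
      proof eventually_elim
        fix z assume "summable (\<lambda>j. \<bar>b j z\<bar>)"
        then have "summable (\<lambda>j. real N * A * \<bar>b j z\<bar>)" by (rule summable_mult)
        then show "summable (\<lambda>j. norm (trunc (real N) (f z) * \<phi> z * b j z))"
          by (rule summable_comparison_test'[where N=0]) (use le in auto)
      qed
      show "summable (\<lambda>j. LINT z|\<mu>. norm (trunc (real N) (f z) * \<phi> z * b j z))"
      proof (rule summable_comparison_test'[where N=0])
        show "summable (\<lambda>j. real N * A * s j)" using s(1) by (rule summable_mult)
        fix j
        have "(LINT z|\<mu>. norm (trunc (real N) (f z) * \<phi> z * b j z)) \<le> (LINT z|\<mu>. real N * A * \<bar>b j z\<bar>)"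
          using int[of N j] bL(2)[of j] le by (intro integral_mono) auto
        also have "\<dots> \<le> real N * A * s j" using bser(2)[of j] AA(3) by (simp add: mult_left_mono)
        finally show "norm (LINT z|\<mu>. norm (trunc (real N) (f z) * \<phi> z * b j z)) \<le> real N * A * s j" by simp
      qed
    qed
    moreover have "(LINT z|\<mu>. (\<Sum>j. trunc (real N) (f z) * \<phi> z * b j z)) = (LINT z|\<mu>. trunc (real N) (f z) * \<phi> z * h z)"
    proof (rule integral_cong_AE)
      show "AE z in \<mu>. (\<Sum>j. trunc (real N) (f z) * \<phi> z * b j z) = trunc (real N) (f z) * \<phi> z * h z"
        using s(5) by eventually_elim (auto simp: sums_iff suminf_mult)
    qed measurable
    ultimately show ?thesis by (simp add: sums_iff)
  qed
  ultimately show ?thesis by simp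
qed

lemma Upart_Vpart_add:
  assumes dec: "h1_decomposition \<mu> n h b R" and phi: "\<phi> \<in> test_functions \<infinity>"
  shows "(\<Sum>j. regular_distribution \<mu> (Upart b R j) \<phi> + regular_distribution \<mu> (Vpart b R j) \<phi>)
    = (\<Sum>j. regular_distribution \<mu> (Upart b R j) \<phi>) + (\<Sum>j. regular_distribution \<mu> (Vpart b R j) \<phi>)"
  using Upart_series(2)[OF dec _ phi] Vpart_series(2)[OF dec _ phi, of UNIV]
  by (intro suminf_add[symmetric]) auto

text \<open>The blocks on large cubes contribute an integrable function; only the atomic blocks on small
  cubes go into the Hardy space part.\<close>

definition Lpart :: "(nat \<Rightarrow> 'a \<Rightarrow> real) \<Rightarrow> (nat \<Rightarrow> 'a cube) \<Rightarrow> nat \<Rightarrow> 'a \<Rightarrow> real" where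
  "Lpart b R j x = Upart b R j x + (if 1 < side (R j) then Vpart b R j x else 0)"

lemma Lpart_series:
  assumes dec: "h1_decomposition \<mu> n h b R"
  shows "integrable \<mu> (\<lambda>x. \<Sum>j. Lpart b R j x)"
    and "\<phi> \<in> test_functions \<infinity> \<Longrightarrow> (\<lambda>j. regular_distribution \<mu> (Lpart b R j) \<phi>) sums regular_distribution \<mu> (\<lambda>x. \<Sum>j. Lpart b R j x) \<phi>"
proof -
  obtain s where s: "summable s" "\<And>j. 0 \<le> s j" "\<And>j. block \<mu> n (R j) (b j) (s j)"
    "\<And>j. side (R j) \<le> 1 \<Longrightarrow> (LINT z|\<mu>. b j z) = 0" "AE x in \<mu>. (\<lambda>j. b j x) sums h x" using that by (rule decompositionD[OF dec])
  have U: "(\<integral>\<^sup>+x. ennreal \<bar>Upart b R j x\<bar> \<partial>\<mu>) \<le> ennreal (K2 * s j)" "integrable \<mu> (Upart b R j)"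
    "(LINT x|\<mu>. \<bar>Upart b R j x\<bar>) \<le> K2 * s j" "integrable \<mu> (Vpart b R j)" for j
    by (rule Upart_bounds[of R j b "s j", OF s(3)])+
  note bL = block_L1[OF s(3)]
  define K where "K = K2 + Cf * \<beta>"
  have CB: "0 \<le> Cf * \<beta>" using Cf(1) rho_beta(3) by simp
  have K0: "0 \<le> K" using K2_parts(4) CB by (simp add: K_def)
  have int: "integrable \<mu> (Lpart b R j)" for j unfolding Lpart_def[abs_def] using U(2,4)[of j] by (cases "1 < side (R j)") simp_all
  have bd: "(\<integral>\<^sup>+x. ennreal \<bar>Lpart b R j x\<bar> \<partial>\<mu>) \<le> ennreal (K * s j)" for j
  proof -
    have [measurable]: "Upart b R j \<in> borel_measurable \<mu>" "b j \<in> borel_measurable \<mu>" using U(2)[of j] bL(2)[of j] by auto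
    have "(\<integral>\<^sup>+x. ennreal \<bar>Lpart b R j x\<bar> \<partial>\<mu>) \<le> (\<integral>\<^sup>+x. ennreal \<bar>Upart b R j x\<bar> + ennreal (Cf * \<beta>) * ennreal \<bar>b j x\<bar> \<partial>\<mu>)"
    proof (rule nn_integral_mono)
      fix x
      have "\<bar>if 1 < side (R j) then Vpart b R j x else 0\<bar> \<le> Cf * \<beta> * \<bar>b j x\<bar>"
        using refc_large[of "R j"] s(3)[of j] CB by (auto simp: Vpart_def abs_mult block_def intro: mult_right_mono)
      then have "\<bar>Lpart b R j x\<bar> \<le> \<bar>Upart b R j x\<bar> + Cf * \<beta> * \<bar>b j x\<bar>" unfolding Lpart_def by linarith
      then have "ennreal \<bar>Lpart b R j x\<bar> \<le> ennreal (\<bar>Upart b R j x\<bar> + Cf * \<beta> * \<bar>b j x\<bar>)" by (rule ennreal_leI)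
      also have "\<dots> = ennreal \<bar>Upart b R j x\<bar> + ennreal (Cf * \<beta>) * ennreal \<bar>b j x\<bar>"
        using CB by (subst ennreal_plus) (auto simp: ennreal_mult[symmetric])
      finally show "ennreal \<bar>Lpart b R j x\<bar> \<le> ennreal \<bar>Upart b R j x\<bar> + ennreal (Cf * \<beta>) * ennreal \<bar>b j x\<bar>" .
    qed
    also have "\<dots> = (\<integral>\<^sup>+x. ennreal \<bar>Upart b R j x\<bar> \<partial>\<mu>) + ennreal (Cf * \<beta>) * (\<integral>\<^sup>+x. ennreal \<bar>b j x\<bar> \<partial>\<mu>)"
      by (subst nn_integral_add) (auto simp: nn_integral_cmult)
    also have "\<dots> \<le> ennreal (K2 * s j) + ennreal (Cf * \<beta>) * ennreal (s j)"
      using U(1) bL(1) by (intro add_mono mult_left_mono) auto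
    also have "\<dots> = ennreal (K2 * s j) + ennreal (Cf * \<beta> * s j)" using CB s(2) by (simp add: ennreal_mult[symmetric])
    also have "\<dots> = ennreal (K2 * s j + Cf * \<beta> * s j)" using CB s(2) K2_parts(4) by (intro ennreal_plus[symmetric]) auto
    also have "K2 * s j + Cf * \<beta> * s j = K * s j" by (simp add: K_def distrib_right)
    finally show ?thesis .
  qed
  have sK: "summable (\<lambda>j. K * s j)" using s(1) by (rule summable_mult)
  have L: "AE x in \<mu>. summable (\<lambda>j. \<bar>Lpart b R j x\<bar>)" "(LINT x|\<mu>. \<bar>Lpart b R j x\<bar>) \<le> K * s j" for j
    using L1_series[of "Lpart b R" \<mu> "\<lambda>j. K * s j"] bd sK int K0 s(2) by auto
  show "integrable \<mu> (\<lambda>x. \<Sum>j. Lpart b R j x)"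
    using L1_series(4)[of "Lpart b R" \<mu> "\<lambda>j. K * s j"] bd sK int K0 s(2) by auto
  assume phi: "\<phi> \<in> test_functions \<infinity>"
  have pm: "\<phi> \<in> borel_measurable \<mu>" by (rule test_measurable[OF phi]) simp
  obtain A where A: "C1_bound \<phi> A" using that by (rule test_function_bound[OF phi one_le_infinity])
  note AA = C1_boundD[OF A]
  have i: "integrable \<mu> (\<lambda>x. Lpart b R j x * \<phi> x)" for j by (rule product_integrable[OF int pm AA(1)])
  have le: "\<bar>Lpart b R j x * \<phi> x\<bar> \<le> \<bar>Lpart b R j x\<bar> * A" for j x unfolding abs_mult by (intro mult_left_mono AA) auto
  have "(\<lambda>j. LINT x|\<mu>. Lpart b R j x * \<phi> x) sums (LINT x|\<mu>. (\<Sum>j. Lpart b R j x * \<phi> x))"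
  proof (rule sums_integral[OF i])
    show "AE x in \<mu>. summable (\<lambda>j. norm (Lpart b R j x * \<phi> x))"
      using L(1)
    proof eventually_elim
      fix x assume "summable (\<lambda>j. \<bar>Lpart b R j x\<bar>)"
      then have "summable (\<lambda>j. \<bar>Lpart b R j x\<bar> * A)" by (rule summable_mult2)
      then show "summable (\<lambda>j. norm (Lpart b R j x * \<phi> x))" by (rule summable_comparison_test'[where N=0]) (use le in auto)
    qed
    show "summable (\<lambda>j. LINT x|\<mu>. norm (Lpart b R j x * \<phi> x))"
    proof (rule summable_comparison_test'[where N=0])
      show "summable (\<lambda>j. K * s j * A)" using sK by (rule summable_mult2)
      fix j
      have "(LINT x|\<mu>. norm (Lpart b R j x * \<phi> x)) \<le> (LINT x|\<mu>. \<bar>Lpart b R j x\<bar> * A)"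
        using i[of j] int[of j] le by (intro integral_mono) auto
      also have "\<dots> \<le> K * s j * A" using L(2)[of j] AA(3) by (simp add: mult_right_mono)
      finally show "norm (LINT x|\<mu>. norm (Lpart b R j x * \<phi> x)) \<le> K * s j * A" by simp
    qed
  qed
  moreover have "(LINT x|\<mu>. (\<Sum>j. Lpart b R j x * \<phi> x)) = (LINT x|\<mu>. (\<Sum>j. Lpart b R j x) * \<phi> x)"
  proof (rule integral_cong_AE)
    have Lm: "Lpart b R j \<in> borel_measurable \<mu>" for j using int by auto
    show "(\<lambda>x. \<Sum>j. Lpart b R j x * \<phi> x) \<in> borel_measurable \<mu>" using Lm pm by measurable
    show "(\<lambda>x. (\<Sum>j. Lpart b R j x) * \<phi> x) \<in> borel_measurable \<mu>" using Lm pm by measurable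
    show "AE x in \<mu>. (\<Sum>j. Lpart b R j x * \<phi> x) = (\<Sum>j. Lpart b R j x) * \<phi> x"
      using L(1)
    proof eventually_elim
      fix x assume "summable (\<lambda>j. \<bar>Lpart b R j x\<bar>)"
      then have "summable (\<lambda>j. Lpart b R j x)" by (rule summable_rabs_cancel)
      then show "(\<Sum>j. Lpart b R j x * \<phi> x) = (\<Sum>j. Lpart b R j x) * \<phi> x" by (rule suminf_mult2[symmetric])
    qed
  qed
  ultimately show "(\<lambda>j. regular_distribution \<mu> (Lpart b R j) \<phi>) sums regular_distribution \<mu> (\<lambda>x. \<Sum>j. Lpart b R j x) \<phi>"
    by (simp add: regular_distribution_def)
qed

text \<open>The factor involving \<open>G\<close> is common to all blocks, so summing the majorants
  leaves one product of an exponentially integrable function with the integrable sum of the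
  \<open>u j\<close>.\<close>

lemma small_part_maximal:
  assumes dec: "h1_decomposition \<mu> n h b R"
  defines "T \<equiv> (\<lambda>\<phi>. \<Sum>j. if j \<in> {j. side (R j) \<le> 1} then regular_distribution \<mu> (Vpart b R j) \<phi> else 0)"
  shows "local_maximal \<mu> n T \<in> orlicz_amalgam \<mu> wp_log"
proof -
  obtain s where s: "summable s" "\<And>j. 0 \<le> s j" "\<And>j. block \<mu> n (R j) (b j) (s j)"
    "\<And>j. side (R j) \<le> 1 \<Longrightarrow> (LINT z|\<mu>. b j z) = 0" "AE x in \<mu>. (\<lambda>j. b j x) sums h x" using that by (rule decompositionD[OF dec])
  obtain K where K: "0 \<le> K" "\<And>y r b s. block \<mu> n (Cube y r) b s \<Longrightarrow> (LINT z|\<mu>. b z) = 0 \<Longrightarrow>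
     \<exists>u\<in>borel_measurable \<mu>. (\<integral>\<^sup>+w. u w \<partial>\<mu>) \<le> ennreal (K * s) \<and>
     (\<forall>w. G w < \<infinity> \<longrightarrow> (\<forall>\<phi>\<in>F_loc \<mu> n w.
        ennreal \<bar>refc (Cube y r) * (LINT z|\<mu>. b z * \<phi> z)\<bar> \<le> ennreal (KW * (enn2real (G w) + 1)) * u w))"
    using that by (rule block_maximal)
  obtain B where B: "0 \<le> B" "\<And>j. (\<integral>\<^sup>+x\<in>cube_set j 1. ennreal (exp (cG * enn2real (G x))) \<partial>\<mu>) \<le> ennreal B"
    using that by (rule exp_G_integral)
  define W where "W x = KW * (enn2real (G x) + 1)" for x
  have KW0: "0 < KW" using KW_ge_1 by simp
  have W0: "0 \<le> W x" for x using KW0 by (simp add: W_def)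
  define J where "J = {j. side (R j) \<le> 1}"
  have "\<forall>j. \<exists>u. u \<in> borel_measurable \<mu> \<and> (\<integral>\<^sup>+w. u w \<partial>\<mu>) \<le> ennreal (K * s j) \<and>
     (\<forall>w. G w < \<infinity> \<longrightarrow> (\<forall>\<phi>\<in>F_loc \<mu> n w.
        ennreal \<bar>if j \<in> J then regular_distribution \<mu> (Vpart b R j) \<phi> else 0\<bar> \<le> ennreal (W w) * u w))"
  proof
    fix j
    show "\<exists>u. u \<in> borel_measurable \<mu> \<and> (\<integral>\<^sup>+w. u w \<partial>\<mu>) \<le> ennreal (K * s j) \<and>
     (\<forall>w. G w < \<infinity> \<longrightarrow> (\<forall>\<phi>\<in>F_loc \<mu> n w.
        ennreal \<bar>if j \<in> J then regular_distribution \<mu> (Vpart b R j) \<phi> else 0\<bar> \<le> ennreal (W w) * u w))"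
    proof (cases "j \<in> J")
      case True
      then have j: "side (R j) \<le> 1" by (simp add: J_def)
      then obtain y r where yr: "R j = Cube y r" by (cases "R j") (auto simp: top_unique)
      have "block \<mu> n (Cube y r) (b j) (s j)" using s(3)[of j] by (simp add: yr)
      from K(2)[OF this s(4)[OF j]] show ?thesis
        unfolding Vpart_regular yr W_def if_P[OF True] by blast
    next
      case False
      then show ?thesis by (intro exI[of _ "\<lambda>_. 0"]) auto
    qed
  qed
  then obtain u where u: "\<And>j. u j \<in> borel_measurable \<mu>" "\<And>j. (\<integral>\<^sup>+w. u j w \<partial>\<mu>) \<le> ennreal (K * s j)"
    "\<And>j w \<phi>. G w < \<infinity> \<Longrightarrow> \<phi> \<in> F_loc \<mu> n w \<Longrightarrow>
        ennreal \<bar>if j \<in> J then regular_distribution \<mu> (Vpart b R j) \<phi> else 0\<bar> \<le> ennreal (W w) * u j w" by metis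
  note [measurable] = u(1)
  define \<Phi> where "\<Phi> w = (\<Sum>j. u j w)" for w
  have dist: "distribution_on 1 T" unfolding T_def by (rule Vpart_series(1)[OF dec order_refl])
  show ?thesis
  \<comment> \<open>The exponent \<open>cG / KW\<close> cancels the factor \<open>KW\<close> of
    \<open>W\<close>; the summand 1 in \<open>W\<close> contributes only the factor
    \<open>exp cG\<close>.\<close>
  proof (rule orlicz_amalgam_product[where W=W and \<Phi>=\<Phi> and c="cG / KW" and B="max 1 (exp cG * B)"])
    show "sets \<mu> = sets borel" by (rule sets_eq)
    show "local_maximal \<mu> n T \<in> borel_measurable \<mu>" by (rule local_maximal_measurable[OF dist])
    show "W \<in> borel_measurable \<mu>" unfolding W_def[abs_def] by measurable
    show "\<Phi> \<in> borel_measurable \<mu>" unfolding \<Phi>_def[abs_def] by measurable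
    show "0 \<le> W x" for x by (rule W0)
    show "0 < cG / KW" using cG_pos KW0 by simp
    show "1 \<le> max 1 (exp cG * B)" by simp
    have "(\<integral>\<^sup>+x. \<Phi> x \<partial>\<mu>) = (\<Sum>j. \<integral>\<^sup>+x. u j x \<partial>\<mu>)" unfolding \<Phi>_def by (intro nn_integral_suminf) measurable
    also have "\<dots> \<le> (\<Sum>j. ennreal (K * s j))" using u(2) by (intro suminf_le) auto
    also have "\<dots> < \<infinity>" using s(1,2) K(1) by (simp add: suminf_ennreal2 summable_mult)
    finally show "(\<integral>\<^sup>+x. \<Phi> x \<partial>\<mu>) < \<infinity>" .
    fix j :: 'a
    have e: "ennreal (exp (cG / KW * W x)) = ennreal (exp cG) * ennreal (exp (cG * enn2real (G x)))" for x
      using KW0 by (simp add: W_def distrib_left exp_add ennreal_mult mult.commute)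
    have "(\<integral>\<^sup>+x\<in>cube_set j 1. ennreal (exp (cG / KW * W x)) \<partial>\<mu>)
        = ennreal (exp cG) * (\<integral>\<^sup>+x\<in>cube_set j 1. ennreal (exp (cG * enn2real (G x))) \<partial>\<mu>)"
      unfolding e mult.assoc by (intro nn_integral_cmult) measurable
    also have "\<dots> \<le> ennreal (exp cG) * ennreal B" by (intro mult_left_mono B) simp
    also have "\<dots> = ennreal (exp cG * B)" using B(1) by (simp add: ennreal_mult)
    also have "\<dots> \<le> ennreal (max 1 (exp cG * B))" by (intro ennreal_leI) simp
    finally show "(\<integral>\<^sup>+x\<in>cube_set j 1. ennreal (exp (cG / KW * W x)) \<partial>\<mu>) \<le> ennreal (max 1 (exp cG * B))" .
    show "AE x in \<mu>. x \<in> cube_set j 1 \<longrightarrow> local_maximal \<mu> n T x \<le> ennreal (W x) * \<Phi> x"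
      using AE_G_finite[of j]
    proof eventually_elim
      fix w assume w: "w \<in> cube_set j 1 \<longrightarrow> G w < \<infinity>"
      show "w \<in> cube_set j 1 \<longrightarrow> local_maximal \<mu> n T w \<le> ennreal (W w) * \<Phi> w"
      proof
        assume "w \<in> cube_set j 1"
        then have Gw: "G w < \<infinity>" using w by blast
        show "local_maximal \<mu> n T w \<le> ennreal (W w) * \<Phi> w" unfolding local_maximal_def
        proof (rule SUP_least)
          fix \<phi> assume phi: "\<phi> \<in> F_loc \<mu> n w"
          have sm: "summable (\<lambda>j. if j \<in> J then regular_distribution \<mu> (Vpart b R j) \<phi> else 0)"
            by (rule Vpart_series(2)[OF dec order_refl F_loc_test[OF phi]])
          have "ennreal \<bar>T \<phi>\<bar> \<le> (\<Sum>j. ennreal \<bar>if j \<in> J then regular_distribution \<mu> (Vpart b R j) \<phi> else 0\<bar>)"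
            using abs_le_suminf_ennreal[OF summable_sums[OF sm]] by (simp add: T_def J_def)
          also have "\<dots> \<le> (\<Sum>j. ennreal (W w) * u j w)" using u(3)[OF Gw phi] by (intro suminf_le) auto
          also have "\<dots> = ennreal (W w) * \<Phi> w" by (simp add: \<Phi>_def)
          finally show "ennreal \<bar>T \<phi>\<bar> \<le> ennreal (W w) * \<Phi> w" .
        qed
      qed
    qed
  qed
qed

end

theorem proposition4p3:
  fixes \<mu> :: "'a::euclidean_space measure"
    and n :: nat and C0 \<eta> \<rho> \<beta> :: real
    and f h :: "'a \<Rightarrow> real"
  assumes "0 < n" and "n \<le> DIM('a)"
    and "growth_measure n C0 \<mu>"
    and "1 < \<eta>" and "\<eta> \<le> \<rho>"
    and "doubling_constant \<mu> n \<rho> \<beta>"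
    and "h \<in> h1 \<mu> n"
    and "f \<in> rbmo \<mu> n \<eta> \<rho> \<beta>"
  shows "\<exists>T. distribution_on \<infinity> T \<and>
           (\<forall>b R. h1_decomposition \<mu> n h b R \<longrightarrow>
              (\<exists>U V. sums_distribution \<mu> (\<lambda>j x. (f x - mean \<mu> f (tilde \<mu> \<rho> \<beta> (R j))) * b j x) U \<and>
                     sums_distribution \<mu> (\<lambda>j x. mean \<mu> f (tilde \<mu> \<rho> \<beta> (R j)) * b j x) V \<and>
                     (\<forall>\<phi>\<in>test_functions \<infinity>. T \<phi> = U \<phi> + V \<phi>))) \<and>
           T \<in> L1_plus_h_wp_star \<mu> n (\<lambda>t. t / ln (exp 1 + t))"
proof -
  interpret rbmo_function \<mu> n C0 \<eta> \<rho> \<beta> f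
    using assms by unfold_locales
  have h: "h \<in> borel_measurable \<mu>" using assms(7) by (simp add: h1_def)
  obtain b0 R0 where dec0: "h1_decomposition \<mu> n h b0 R0" using assms(7) by (auto simp: h1_def)
  define g where "g x = (\<Sum>j. Lpart b0 R0 j x)" for x
  define H where "H \<phi> = (\<Sum>j. if j \<in> {j. side (R0 j) \<le> 1} then regular_distribution \<mu> (Vpart b0 R0 j) \<phi> else 0)" for \<phi>
  define T where "T \<phi> = (\<Sum>j. regular_distribution \<mu> (Upart b0 R0 j) \<phi>) + (\<Sum>j. regular_distribution \<mu> (Vpart b0 R0 j) \<phi>)" for \<phi>
  have one: "1 \<le> (\<infinity>::enat)" by simp
  have Vser: "distribution_on \<infinity> (\<lambda>\<phi>. \<Sum>j. regular_distribution \<mu> (Vpart b R j) \<phi>)"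
    "\<phi> \<in> test_functions \<infinity> \<Longrightarrow> summable (\<lambda>j. regular_distribution \<mu> (Vpart b R j) \<phi>)"
    if "h1_decomposition \<mu> n h b R" for b R \<phi>
    using Vpart_series[OF that one, where J=UNIV] by auto
  have dT: "distribution_on \<infinity> T" unfolding T_def[abs_def]
    by (rule distribution_on_add[OF Upart_series(1)[OF dec0 one] Vser(1)[OF dec0]])
  have decomp: "\<exists>U V. sums_distribution \<mu> (\<lambda>j x. (f x - mean \<mu> f (tilde \<mu> \<rho> \<beta> (R j))) * b j x) U \<and>
                     sums_distribution \<mu> (\<lambda>j x. mean \<mu> f (tilde \<mu> \<rho> \<beta> (R j)) * b j x) V \<and>
                     (\<forall>\<phi>\<in>test_functions \<infinity>. T \<phi> = U \<phi> + V \<phi>)"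
    if dec: "h1_decomposition \<mu> n h b R" for b R
  proof (intro exI conjI ballI)
    have blk: "\<exists>s. block \<mu> n (R j) (b j) s" for j
      using dec unfolding h1_decomposition_def atomic_block_def by (meson not_less)
    have loc: "loc_integrable \<mu> (Upart b R j)" "loc_integrable \<mu> (Vpart b R j)" for j
      using blk[of j] Upart_bounds(2,4) integrable_loc_integrable by blast+
    have U: "(\<lambda>j x. (f x - mean \<mu> f (tilde \<mu> \<rho> \<beta> (R j))) * b j x) = Upart b R"
      and V: "(\<lambda>j x. mean \<mu> f (tilde \<mu> \<rho> \<beta> (R j)) * b j x) = Vpart b R"
      by (simp_all add: fun_eq_iff Upart_def Vpart_def refc_def)
    show "sums_distribution \<mu> (\<lambda>j x. (f x - mean \<mu> f (tilde \<mu> \<rho> \<beta> (R j))) * b j x) (\<lambda>\<phi>. \<Sum>j. regular_distribution \<mu> (Upart b R j) \<phi>)"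
      unfolding U sums_distribution_def
      by (intro conjI allI ballI loc Upart_series(1)[OF dec one] summable_sums Upart_series(2)[OF dec one])
    show "sums_distribution \<mu> (\<lambda>j x. mean \<mu> f (tilde \<mu> \<rho> \<beta> (R j)) * b j x) (\<lambda>\<phi>. \<Sum>j. regular_distribution \<mu> (Vpart b R j) \<phi>)"
      unfolding V sums_distribution_def
      by (intro conjI allI ballI loc Vser(1)[OF dec] summable_sums Vser(2)[OF dec])
    fix \<phi> :: "'a \<Rightarrow> real" assume phi: "\<phi> \<in> test_functions \<infinity>"
    show "T \<phi> = (\<Sum>j. regular_distribution \<mu> (Upart b R j) \<phi>) + (\<Sum>j. regular_distribution \<mu> (Vpart b R j) \<phi>)"
      using LIMSEQ_unique[OF product_independent[OF dec0 h phi] product_independent[OF dec h phi]]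
      unfolding Upart_Vpart_add[OF dec0 phi] Upart_Vpart_add[OF dec phi] T_def .
  qed
  have dH: "distribution_on 1 H" unfolding H_def[abs_def] by (rule Vpart_series(1)[OF dec0 order_refl])
  \<comment> \<open>The same functional serves as the distribution and as its own extension, since
    its series already converges on C^1 test functions.\<close>
  have "H \<in> h_wp_star \<mu> n wp_log" unfolding h_wp_star_def
    using distribution_on_mono[OF dH one] dH small_part_maximal[OF dec0] unfolding H_def[abs_def] by blast
  moreover have "integrable \<mu> g" unfolding g_def by (rule Lpart_series(1)[OF dec0])
  moreover have "T \<phi> = regular_distribution \<mu> g \<phi> + H \<phi>" if phi: "\<phi> \<in> test_functions \<infinity>" for \<phi>
  proof -
    have blk: "\<exists>s. block \<mu> n (R0 j) (b0 j) s" for j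
      using dec0 unfolding h1_decomposition_def atomic_block_def by (meson not_less)
    obtain A where A: "C1_bound \<phi> A" using that by (rule test_function_bound[OF phi one])
    have i: "integrable \<mu> (\<lambda>x. Upart b0 R0 j x * \<phi> x)" "integrable \<mu> (\<lambda>x. Vpart b0 R0 j x * \<phi> x)" for j
      using blk[of j] Upart_bounds(2,4) product_integrable[OF _ test_measurable[OF phi one] C1_boundD(1)[OF A]] by blast+
    \<comment> \<open>Moving the large-cube terms of the second series into the integrable part
      regroups each summand and leaves the total unchanged.\<close>
    have e: "regular_distribution \<mu> (Lpart b0 R0 j) \<phi> + (if j \<in> {j. side (R0 j) \<le> 1} then regular_distribution \<mu> (Vpart b0 R0 j) \<phi> else 0)
      = regular_distribution \<mu> (Upart b0 R0 j) \<phi> + regular_distribution \<mu> (Vpart b0 R0 j) \<phi>" for j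
    proof (cases "1 < side (R0 j)")
      case True
      then have "\<not> side (R0 j) \<le> 1" by (simp only: not_le)
      with True show ?thesis using i[of j] by (simp add: regular_distribution_def Lpart_def distrib_right)
    next
      case False
      then have "side (R0 j) \<le> 1" by (simp only: not_less)
      moreover have "Lpart b0 R0 j = Upart b0 R0 j" using False by (simp add: Lpart_def fun_eq_iff)
      ultimately show ?thesis by simp
    qed
    have "(\<lambda>j. regular_distribution \<mu> (Lpart b0 R0 j) \<phi> + (if j \<in> {j. side (R0 j) \<le> 1} then regular_distribution \<mu> (Vpart b0 R0 j) \<phi> else 0))
      sums (regular_distribution \<mu> g \<phi> + H \<phi>)"
      unfolding g_def H_def
      by (intro sums_add Lpart_series(2)[OF dec0 phi] summable_sums Vpart_series(2)[OF dec0 one phi])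
    then show ?thesis unfolding e using Upart_Vpart_add[OF dec0 phi] by (simp add: sums_iff T_def)
  qed
  ultimately have "T \<in> L1_plus_h_wp_star \<mu> n wp_log" unfolding L1_plus_h_wp_star_def by blast
  then show ?thesis using dT decomp by blast
qed

end
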